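(* Let $\alpha>0$ and let $v(z)=\exp\left(-\frac{\alpha}{1-|z|}\right)$ for $z\in\mathbb{D}$. Let $1\le p<\infty$. Then the Bergman projection $$P_v(f)(z)=\int_{\mathbb{D}} f(\zeta)\,K(z,\zeta)\,v(\zeta)\,dm(\zeta)$$ is bounded from $L^p\left(\mathbb{D},v^{p/2}\right)$ to $A^p_{v^{p/2}}$. Moreover, $P_v: L^\infty_{v^{1/2}}\to A^\infty_{v^{1/2}}$ is bounded.
   Context: $\mathbb{D}$ is the open unit disc in $\mathbb{C}$, $dm(z)=\frac{dx\,dy}{\pi}$ is normalized area measure, and $H(\mathbb{D})$ is the space of analytic functions on $\mathbb{D}$. A weight is an integrable function $w:\mathbb{D}\to(0,\infty)$. For $0<p<\infty$, $L^p(\mathbb{D},w)$ is the space of measurable $f$ on $\mathbb{D}$ with $\int_{\mathbb{D}}|f|^p w\,dm<\infty$, and $A^p_w=H(\mathbb{D})\cap L^p(\mathbb{D},w)$ with $\|f\|_{A^p_w}^p=\int_{\mathbb{D}}|f(z)|^pw(z)\,dm(z)$. $L^\infty_w$ is the space of measurable $f$ with $\|f\|_{L^\infty_w}=\sup_{z\in\mathbb{D}}|f(z)|w(z)<\infty$, and $A^\infty_w=H(\mathbb{D})\cap L^\infty_w$. For a continuous weight $w$, $A^2_w$ is a closed subspace of $L^2(\mathbb{D},w)$ with bounded point evaluations; $K_z\in A^2_w$ denotes the reproducing kernel at $z$, i.e. $f(z)=\int_{\mathbb{D}}f(\zeta)\overline{K_z(\zeta)}w(\zeta)\,dm(\zeta)$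 for all $f\in A^2_w$, and $K(z,\zeta)=\overline{K_z(\zeta)}$. The Bergman projection $P_w$ is the orthogonal projection of $L^2(\mathbb{D},w)$ onto $A^2_w$, which is the integral operator $P_wf(z)=\int_{\mathbb{D}}f(\zeta)K(z,\zeta)w(\zeta)\,dm(\zeta)$; this integral formula is used to define $P_w f$ on the other spaces. In the claim $K$ is the reproducing kernel of $A^2_v$. *)

theory Defs
  imports "HOL-Analysis.Analysis"
begin

abbreviation unit_disc :: "complex set" where
  "unit_disc \<equiv> ball 0 1"

text \<open>Normalized area measure on the unit disc. Functions on the disc are represented by
  functions on \<^typ>\<open>complex\<close>; their values off the disc never matter.\<close>

definition disc_measure :: "complex measure" where
  "disc_measure = density (lebesgue_on unit_disc) (\<lambda>_. ennreal (1 / pi))"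

definition Lp_space :: "real \<Rightarrow> (complex \<Rightarrow> real) \<Rightarrow> (complex \<Rightarrow> complex) set" where
  "Lp_space p w = {f \<in> borel_measurable disc_measure.
     integrable disc_measure (\<lambda>z. norm (f z) powr p * w z)}"

definition Lp_norm :: "real \<Rightarrow> (complex \<Rightarrow> real) \<Rightarrow> (complex \<Rightarrow> complex) \<Rightarrow> real" where
  "Lp_norm p w f = (LINT z|disc_measure. norm (f z) powr p * w z) powr (1 / p)"

definition Linf_space :: "(complex \<Rightarrow> real) \<Rightarrow> (complex \<Rightarrow> complex) set" where
  "Linf_space w = {f \<in> borel_measurable disc_measure.
     bdd_above ((\<lambda>z. norm (f z) * w z) ` unit_disc)}"

definition Linf_norm :: "(complex \<Rightarrow> real) \<Rightarrow> (complex \<Rightarrow> complex) \<Rightarrow> real" where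
  "Linf_norm w f = (SUP z\<in>unit_disc. norm (f z) * w z)"

definition Ap_space :: "real \<Rightarrow> (complex \<Rightarrow> real) \<Rightarrow> (complex \<Rightarrow> complex) set" where
  "Ap_space p w = {f. f holomorphic_on unit_disc} \<inter> Lp_space p w"

definition Ainf_space :: "(complex \<Rightarrow> real) \<Rightarrow> (complex \<Rightarrow> complex) set" where
  "Ainf_space w = {f. f holomorphic_on unit_disc} \<inter> Linf_space w"

definition is_reproducing_kernel_at ::
    "(complex \<Rightarrow> real) \<Rightarrow> complex \<Rightarrow> (complex \<Rightarrow> complex) \<Rightarrow> bool" where
  "is_reproducing_kernel_at w z k \<longleftrightarrow> k \<in> Ap_space 2 w \<and>
     (\<forall>f\<in>Ap_space 2 w.
        f z = (LINT \<zeta>|disc_measure. f \<zeta> * cnj (k \<zeta>) * complex_of_real (w \<zeta>)))"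

text \<open>The reproducing kernel is unique only as a function on the disc, since values off the
  disc are unconstrained; hence \<open>SOME\<close> and not \<open>THE\<close>.\<close>

definition reproducing_kernel :: "(complex \<Rightarrow> real) \<Rightarrow> complex \<Rightarrow> complex \<Rightarrow> complex" where
  "reproducing_kernel w z = (SOME k. is_reproducing_kernel_at w z k)"

definition bergman_kernel :: "(complex \<Rightarrow> real) \<Rightarrow> complex \<Rightarrow> complex \<Rightarrow> complex" where
  "bergman_kernel w z \<zeta> = cnj (reproducing_kernel w z \<zeta>)"

definition bergman_integrand ::
    "(complex \<Rightarrow> real) \<Rightarrow> (complex \<Rightarrow> complex) \<Rightarrow> complex \<Rightarrow> complex \<Rightarrow> complex" where
  "bergman_integrand w f z \<zeta> = f \<zeta> * bergman_kernel w z \<zeta> * complex_of_real (w \<zeta>)"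

definition bergman_projection ::
    "(complex \<Rightarrow> real) \<Rightarrow> (complex \<Rightarrow> complex) \<Rightarrow> complex \<Rightarrow> complex" where
  "bergman_projection w f z = (LINT \<zeta>|disc_measure. bergman_integrand w f z \<zeta>)"

text \<open>The Bochner integral is \<open>0\<close> for non-integrable integrands, so convergence of the
  integral defining the projection is demanded explicitly.\<close>

definition bergman_projection_bounded ::
    "(complex \<Rightarrow> real) \<Rightarrow> (complex \<Rightarrow> complex) set \<Rightarrow> (complex \<Rightarrow> complex) set \<Rightarrow>
     ((complex \<Rightarrow> complex) \<Rightarrow> real) \<Rightarrow> bool" where
  "bergman_projection_bounded w X Y N \<longleftrightarrow>
     (\<forall>f\<in>X. \<forall>z\<in>unit_disc. integrable disc_measure (bergman_integrand w f z)) \<and>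
     (\<forall>f\<in>X. bergman_projection w f \<in> Y) \<and>
     (\<exists>C\<ge>0. \<forall>f\<in>X. N (bergman_projection w f) \<le> C * N f)"

definition exp_weight :: "real \<Rightarrow> complex \<Rightarrow> real" where
  "exp_weight \<alpha> z = exp (- (\<alpha> / (1 - norm z)))"

end

theory Submission
  imports Defs "HOL-Complex_Analysis.Complex_Analysis"
begin

text \<open>The kernel is \<open>K(z,w) = \<Sum>n. (z cnj w)\<^sup>n / x\<^sub>n\<close> with \<open>x\<^sub>n\<close> the squared norm of \<open>z\<^sup>n\<close>.
  Everything follows by Schur's test from the bound
  \<open>\<integral> |K(z,w)| v(w)\<^sup>1\<^sup>/\<^sup>2 dm(w) \<le> C v(z)\<^sup>-\<^sup>1\<^sup>/\<^sup>2\<close>. By the inequality of arithmetic and geometric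
  means this reduces to an \<open>L\<^sup>2\<close> bound for \<open>K(z,\<cdot>)\<close> with the additional factor
  \<open>1 + |w - z|\<^sup>4 / \<delta>\<^sup>6\<close>, where \<open>\<delta> = 1 - |z|\<close>: its reciprocal has integral \<open>O(\<delta>\<^sup>3)\<close>, and
  \<open>(w - z)\<^sup>2 K(z,w)\<close> has explicit Taylor coefficients. Summation by parts in the index \<open>n\<close> bounds
  their weighted sum in terms of \<open>K(z,z)\<close>, given that the ratios \<open>p\<^sub>n = x\<^sub>n / x\<^sub>n\<^sub>-\<^sub>1\<close> satisfy
  \<open>p\<^sub>n\<^sub>+\<^sub>1 - p\<^sub>n \<le> C (1 - p\<^sub>n)\<^sup>3\<close>. The latter comes from a three-term recurrence for the moments of
  the weight, and \<open>K(z,z) = O(\<delta>\<^sup>-\<^sup>3 / v(z))\<close> from a mean value argument on discs of radius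
  comparable to \<open>\<delta>\<^sup>3\<^sup>/\<^sup>2\<close>.\<close>

section \<open>Moment ratios\<close>

text \<open>The exponent \<alpha> / (1 - |z|) has Laplacian of order \<open>\<delta>^(-3)\<close>,
  so \<open>\<delta>^(3/2)\<close> is the natural length at distance \<delta> from the boundary. It
  governs both the mean value discs and the factor \<open>1 + |w - z|^4 / \<delta>^6\<close>. A
  square in place of the fourth power would cost a logarithm, since the reciprocal of
  \<open>1 + |w - z|^2 / \<delta>^3\<close> barely fails to be integrable over the plane. The
  obstacle is that no closed form of the moments is at hand. Only their positivity, monotonicity,
  log-convexity and recurrence are used. With \<open>U k = 1 - x (Suc k) / x k\<close> the heuristic
  is \<open>U k ~ sqrt (\<alpha> / k)\<close> with decrements of order \<open>k^(-3/2)\<close>, that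
  is of order \<open>(U k)^3\<close>; the first locale turns this into inequalities. The numbers
  \<open>s^(2n) / x (2n)\<close> are best read as weights of a measure on the index n. It
  concentrates where \<open>p n\<close> is close to \<open>s^2\<close>, and \<open>p n\<close>
  fluctuates there by about \<open>\<delta>^(3/2)\<close>. Hence the exponent 6 for the fourth
  moment of this deviation and for the second moment of the increments of p.\<close>

locale ratio_recurrence =
  fixes U :: "nat \<Rightarrow> real" and \<alpha> :: real
  assumes \<alpha>: "\<alpha> > 0"
    and U_pos: "0 < U k" and U_less_1: "U k < 1" and U_Suc_le: "U (Suc k) \<le> U k"
    and U_rec: "(real k + 2) * (U k / (1 - U k) - U (Suc k)) = \<alpha> + 2 * U (Suc k)"
begin

lemma U_antimono: "i \<le> j \<Longrightarrow> U j \<le> U i"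
  by (rule lift_Suc_antimono_le[of U]) (auto intro: U_Suc_le)

text \<open>Replacing \<open>U (Suc k)\<close> by the larger \<open>U k\<close> on the left of the
  recurrence leaves \<open>(U k)^2 / (1 - U k)\<close>. This is the upper half of
  \<open>U k ~ sqrt (\<alpha> / k)\<close>.\<close>

lemma U_sq_le: "(U k)\<^sup>2 \<le> (\<alpha> + 2) / (real k + 2)"
proof -
  have "(U k)\<^sup>2 \<le> U k / (1 - U k) - U k"
  proof -
    have "(U k)\<^sup>2 * (1 - U k) \<le> (U k)\<^sup>2 * 1"
      using U_pos[of k] by (intro mult_left_mono) auto
    moreover have "U k / (1 - U k) - U k = (U k)\<^sup>2 / (1 - U k)"
      using U_less_1[of k] by (simp add: field_simps power2_eq_square)
    ultimately show ?thesis using U_less_1[of k] by (simp add: field_simps)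
  qed
  also have "\<dots> \<le> U k / (1 - U k) - U (Suc k)" using U_Suc_le[of k] by simp
  also have "\<dots> = (\<alpha> + 2 * U (Suc k)) / (real k + 2)"
    using U_rec[of k] by (simp add: field_simps)
  also have "\<dots> \<le> (\<alpha> + 2) / (real k + 2)"
    using U_less_1[of "Suc k"] by (intro divide_right_mono) auto
  finally show ?thesis .
qed

lemma U_tendsto_0: "U \<longlonglongrightarrow> 0"
proof -
  have "(\<lambda>k. (\<alpha> + 2) / (real k + 2)) \<longlonglongrightarrow> 0" by real_asymp
  then have "(\<lambda>k. (U k)\<^sup>2) \<longlonglongrightarrow> 0"
    by (rule Lim_null_comparison[rotated]) (auto intro!: always_eventually U_sq_le)
  then show ?thesis by simp
qed

text \<open>A discrete Riccati equation: the decrement is a source of order \<alpha> / k minus a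
  quadratic term. The balance between the two is unstable, because a value of U that is too small
  makes the next decrement larger. Positivity of U at all indices is what keeps U near the
  balance.\<close>

lemma U_diff: "U k - U (Suc k) = (\<alpha> + 2 * U (Suc k)) / (real k + 2) - (U k)\<^sup>2 / (1 - U k)"
proof -
  have "(U k)\<^sup>2 / (1 - U k) = U k / (1 - U k) - U k"
    using U_less_1[of k] by (simp add: field_simps power2_eq_square)
  moreover have "(\<alpha> + 2 * U (Suc k)) / (real k + 2) = U k / (1 - U k) - U (Suc k)"
    unfolding U_rec[symmetric] by simp
  ultimately show ?thesis by simp
qed

text \<open>If \<open>(k + 2) * (U k)^2\<close> were tiny, the source would dominate the quadratic
  term on the whole block from k to 2k + 1, and the decrements there would add up to nearly \<alpha>
  / 2, more than \<open>U k\<close> has to lose.\<close>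

lemma U_sq_ge: obtains c where "c > 0" "c \<le> 1" "\<And>k. c \<le> (real k + 2) * (U k)\<^sup>2"
proof -
  define \<kappa> where "\<kappa> = 1 / (1 - U 0)"
  have \<kappa>: "\<kappa> > 0" using U_less_1[of 0] by (simp add: \<kappa>_def)
  \<comment> \<open>Chosen so that \<open>(1 + \<kappa>) * e \<le> \<alpha> / 4\<close>, half of the
    total source on the block; \<open>e \<le> 1\<close> allows \<open>e^2\<close> to be replaced by
    e.\<close>
  define e where "e = min 1 (\<alpha> / (4 * (1 + \<kappa>)))"
  have e: "e > 0" "e \<le> 1" using \<alpha> \<kappa> by (auto simp: e_def)
  have F_le: "(U j)\<^sup>2 / (1 - U j) \<le> \<kappa> * (U k)\<^sup>2" if "k \<le> j" for j k
  proof -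
    have "(U j)\<^sup>2 / (1 - U j) \<le> (U k)\<^sup>2 / (1 - U 0)"
      using U_pos[of j] U_antimono[OF that] U_antimono[of 0 j] U_less_1[of 0]
      by (intro frac_le power_mono) auto
    then show ?thesis by (simp add: \<kappa>_def)
  qed
  have "e\<^sup>2 \<le> (real k + 2) * (U k)\<^sup>2" for k
  proof (rule ccontr)
    assume "\<not> ?thesis"
    then have less: "(real k + 2) * (U k)\<^sup>2 < e\<^sup>2" by simp
    have "(U k)\<^sup>2 \<le> (real k + 2) * (U k)\<^sup>2"
      using mult_right_mono[of 1 "real k + 2" "(U k)\<^sup>2"] by simp
    with less have "(U k)\<^sup>2 < e\<^sup>2" by linarith
    then have Uk: "U k < e" using e power2_less_imp_less[of "U k" e] by simp
    \<comment> \<open>The block has k + 2 members, and all of them satisfy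
      \<open>j + 2 \<le> 2 * (k + 2)\<close>, so every source term is at least
      \<open>\<alpha> / (2 * (k + 2))\<close>.\<close>
    have "(real k + 2) * (\<alpha> / (2 * (real k + 2)) - \<kappa> * (U k)\<^sup>2)
        = (\<Sum>j=k..<2*k+2. \<alpha> / (2 * (real k + 2)) - \<kappa> * (U k)\<^sup>2)" by simp
    also have "\<dots> \<le> (\<Sum>j=k..<2*k+2. U j - U (Suc j))"
    proof (intro sum_mono)
      fix j assume j: "j \<in> {k..<2*k+2}"
      have "\<alpha> / (2 * (real k + 2)) \<le> (\<alpha> + 2 * U (Suc j)) / (real j + 2)"
        using j \<alpha> U_pos[of "Suc j"] by (intro frac_le) auto
      moreover have "(U j)\<^sup>2 / (1 - U j) \<le> \<kappa> * (U k)\<^sup>2" using j by (intro F_le) auto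
      ultimately show "\<alpha> / (2 * (real k + 2)) - \<kappa> * (U k)\<^sup>2 \<le> U j - U (Suc j)"
        unfolding U_diff by linarith
    qed
    also have "\<dots> = U k - U (2*k+2)"
      using sum_Suc_diff'[of k "2*k+2" "\<lambda>j. - U j"] by simp
    also have "\<dots> < e" using Uk U_pos[of "2*k+2"] by linarith
    finally have "(real k + 2) * (\<alpha> / (2 * (real k + 2))) < e + \<kappa> * ((real k + 2) * (U k)\<^sup>2)"
      by (simp add: algebra_simps)
    moreover have "(real k + 2) * (\<alpha> / (2 * (real k + 2))) = \<alpha> / 2" by (simp add: divide_simps)
    ultimately have "\<alpha> / 2 < e + \<kappa> * ((real k + 2) * (U k)\<^sup>2)" by linarith
    also have "\<dots> \<le> e + \<kappa> * e\<^sup>2" using less \<kappa> by (intro add_left_mono mult_left_mono) auto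
    also have "\<dots> \<le> e + \<kappa> * e"
    proof -
      have "e\<^sup>2 \<le> e" using e power_le_one_iff[of e 2] by (simp add: power2_eq_square mult_left_le)
      then show ?thesis using \<kappa> by simp
    qed
    also have "\<dots> = (1 + \<kappa>) * e" by (simp add: algebra_simps)
    also have "\<dots> \<le> (1 + \<kappa>) * (\<alpha> / (4 * (1 + \<kappa>)))"
      using \<kappa> by (intro mult_left_mono) (auto simp: e_def)
    also have "\<dots> = \<alpha> / 4" using \<kappa> by (simp add: field_simps)
    finally show False using \<alpha> by simp
  qed
  moreover have "e\<^sup>2 > 0" "e\<^sup>2 \<le> 1" using e by (auto simp: power_le_one)
  ultimately show ?thesis using that by blast
qed

text \<open>Difference of two consecutive instances of \<open>U_diff\<close>. The quadratic term
  amplifies a decrement by \<open>1 + U k\<close>; the slowly varying source only damps it by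
  \<open>1 + 2 / (k + 3)\<close> and an error of order \<open>k^(-2)\<close>. As \<open>U k\<close>
  is of order \<open>k^(-1/2)\<close>, amplification eventually wins.\<close>

lemma U_diff_step:
  "(U k - U (Suc k)) * (1 + U k) - (\<alpha> + 2) / (real k + 2)\<^sup>2
     \<le> (U (Suc k) - U (Suc (Suc k))) * (1 + 2 / (real k + 3))"
proof -
  define n where "n = real k + 2"
  define a b c where "a = U k" and "b = U (Suc k)" and "c = U (Suc (Suc k))"
  have n: "n \<ge> 2" by (simp add: n_def)
  have ab: "0 < b" "b \<le> a" "a < 1" "b < 1"
    using U_pos U_less_1 U_Suc_le by (auto simp: a_def b_def)
  have 1: "a - b = (\<alpha> + 2 * b) / n - a\<^sup>2 / (1 - a)"
    using U_diff[of k] by (simp add: a_def b_def n_def)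
  have 2: "b - c = (\<alpha> + 2 * c) / (n + 1) - b\<^sup>2 / (1 - b)"
    using U_diff[of "Suc k"] by (simp add: a_def b_def c_def n_def add_ac)
  \<comment> \<open>Splitting \<open>x^2 / (1 - x)\<close> into \<open>x^2 + x^3 / (1 - x)\<close>
    isolates the square; the cubic part is increasing and only helps.\<close>
  have F: "a\<^sup>2 / (1 - a) - b\<^sup>2 / (1 - b) \<ge> a * (a - b)"
  proof -
    have eq: "x\<^sup>2 / (1 - x) = x\<^sup>2 + x ^ 3 / (1 - x)" if "x < 1" for x :: real
      using that by (simp add: field_simps power2_eq_square power3_eq_cube)
    have "b ^ 3 / (1 - b) \<le> a ^ 3 / (1 - a)" using ab by (intro frac_le power_mono) auto
    moreover have "a\<^sup>2 - b\<^sup>2 = a * (a - b) + b * (a - b)"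
      by (simp add: power2_eq_square algebra_simps)
    moreover have "b * (a - b) \<ge> 0" using ab by simp
    ultimately show ?thesis using eq[of a] eq[of b] ab by linarith
  qed
  have "(\<alpha> + 2 * c) / (n + 1) - (\<alpha> + 2 * b) / n = - ((\<alpha> + 2 * b) / (n * (n + 1))) - (b - c) * (2 / (n + 1))"
    using n by (simp add: divide_simps) (simp add: algebra_simps)
  moreover have "(\<alpha> + 2 * b) / (n * (n + 1)) \<le> (\<alpha> + 2) / n\<^sup>2"
    using n ab \<alpha> by (intro frac_le) (auto simp: power2_eq_square)
  ultimately have "b - c \<ge> (a - b) + a * (a - b) - (\<alpha> + 2) / n\<^sup>2 - (b - c) * (2 / (n + 1))"
    using 1 2 F by linarith
  then show ?thesis
    by (simp add: a_def b_def c_def n_def algebra_simps)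
qed

text \<open>If a decrement of \<open>U\<close> were too large, the recurrence would force all later decrements to be
  at least as large, and \<open>U\<close> would eventually become negative.\<close>

lemma U_diff_le: obtains C where "C > 0" "\<And>k. U k - U (Suc k) \<le> C * (U k) ^ 3"
proof -
  obtain c where c: "c > 0" "c \<le> 1" "\<And>k. c \<le> (real k + 2) * (U k)\<^sup>2" by (rule U_sq_ge) blast
  \<comment> \<open>The summand \<open>64 / c^3\<close> settles the indices with k + 2 < 16 / c,
    where \<open>U k \<ge> c / 4\<close> makes the right side at least 1. The other summand lets
    half of the amplification in \<open>U_diff_step\<close> absorb the error term.\<close>
  define C where "C = 2 * (\<alpha> + 2) / c\<^sup>2 + 64 / c ^ 3"
  have C: "C > 0" "C \<ge> 2 * (\<alpha> + 2) / c\<^sup>2" "C \<ge> 64 / c ^ 3"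
    using c \<alpha> by (auto simp: C_def add_pos_pos)
  have c_le: "c / (real k + 2) \<le> (U k)\<^sup>2" for k using c(3)[of k] by (simp add: field_simps)
  have small: "U k - U (Suc k) \<le> C * (U k) ^ 3" if k: "real k + 2 < 16 / c" for k
  proof -
    have "c\<^sup>2 / 16 = c / (16 / c)" by (simp add: power2_eq_square)
    also have "\<dots> \<le> c / (real k + 2)" using k c by (intro divide_left_mono) auto
    also have "\<dots> \<le> (U k)\<^sup>2" by (rule c_le)
    finally have "(c / 4)\<^sup>2 \<le> (U k)\<^sup>2" by (simp add: power_divide)
    then have "c / 4 \<le> U k" using U_pos[of k] power2_le_imp_le[of "c/4" "U k"] by simp
    then have "(c / 4) ^ 3 \<le> (U k) ^ 3" using c by (intro power_mono) auto
    then have "64 / c ^ 3 * (c / 4) ^ 3 \<le> C * (U k) ^ 3"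
      using C c by (intro mult_mono) auto
    moreover have "64 / c ^ 3 * (c / 4) ^ 3 = 1" using c by (simp add: power_divide)
    ultimately show ?thesis using U_less_1[of k] U_pos[of "Suc k"] by linarith
  qed
  \<comment> \<open>The threshold 16 / c gives \<open>4 / n \<le> U k\<close>, so the damping
    \<open>2 / (n + 1)\<close> uses up at most the other half of the amplification.\<close>
  have step: "U (Suc k) - U (Suc (Suc k)) \<ge> U k - U (Suc k)"
    if k: "real k + 2 \<ge> 16 / c" and w: "U k - U (Suc k) > C * (U k) ^ 3" for k
  proof -
    define n where "n = real k + 2"
    have n: "n \<ge> 2" by (simp add: n_def)
    have "(4 / n)\<^sup>2 = 16 / n / n" by (simp add: power2_eq_square)
    also have "\<dots> \<le> c / n" using k c n by (intro divide_right_mono) (auto simp: n_def field_simps)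
    also have "\<dots> \<le> (U k)\<^sup>2" using c_le[of k] by (simp add: n_def)
    finally have "4 / n \<le> U k" using U_pos[of k] power2_le_imp_le[of "4/n" "U k"] by simp
    moreover have "4 / (n + 1) \<le> 4 / n" using n by (intro divide_left_mono) auto
    ultimately have a: "2 / (n + 1) \<le> U k / 2" by (simp add: field_simps)
    have w0: "U k - U (Suc k) \<ge> 0" using U_Suc_le[of k] by simp
    have "(\<alpha> + 2) / n\<^sup>2 = (2 * (\<alpha> + 2) / c\<^sup>2) * ((c / n) * (c / n)) / 2"
      using c n by (simp add: field_simps power2_eq_square)
    also have "\<dots> \<le> C * ((U k)\<^sup>2 * (U k)\<^sup>2) / 2"
      using C c_le[of k] c n \<alpha> by (intro divide_right_mono mult_mono) (auto simp: n_def)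
    also have "\<dots> = C * (U k) ^ 3 * (U k / 2)" by (simp add: power2_eq_square power3_eq_cube)
    also have "\<dots> \<le> (U k - U (Suc k)) * (U k / 2)"
      using w U_pos[of k] by (intro mult_right_mono) auto
    also have "\<dots> = (U k - U (Suc k)) * (U k - U k / 2)" by simp
    also have "\<dots> \<le> (U k - U (Suc k)) * (U k - 2 / (n + 1))"
      using a w0 by (intro mult_left_mono) auto
    finally have "(U k - U (Suc k)) * (1 + 2 / (n + 1)) \<le> (U k - U (Suc k)) * (1 + U k) - (\<alpha> + 2) / n\<^sup>2"
      by (simp add: algebra_simps)
    also have "\<dots> \<le> (U (Suc k) - U (Suc (Suc k))) * (1 + 2 / (n + 1))"
      using U_diff_step[of k] by (simp add: n_def add_ac)
    finally show ?thesis
      by (rule mult_right_le_imp_le) (use n in \<open>simp add: add_pos_nonneg\<close>)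
  qed
  have "U k - U (Suc k) \<le> C * (U k) ^ 3" for k
  proof (rule ccontr)
    assume "\<not> ?thesis"
    then have w: "U k - U (Suc k) > C * (U k) ^ 3" by simp
    then have k: "real k + 2 \<ge> 16 / c" using small[of k] by force
    define w where "w = U k - U (Suc k)"
    have wpos: "w > 0" using w C U_pos[of k] by (simp add: w_def) (smt (verit) mult_pos_pos zero_less_power)
    \<comment> \<open>The excess is hereditary: the bound \<open>C * U^3\<close> falls with the
      index while the decrement does not.\<close>
    have ge: "U (k + j) - U (Suc (k + j)) \<ge> w" for j
    proof (induction j)
      case (Suc j)
      have "C * (U (k + j)) ^ 3 \<le> C * (U k) ^ 3"
        using C U_pos[of "k+j"] U_antimono[of k "k + j"] by (intro mult_left_mono power_mono) auto
      also have "\<dots> < w" using w by (simp add: w_def)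
      also have "w \<le> U (k + j) - U (Suc (k + j))" by fact
      finally have "U (Suc (k+j)) - U (Suc (Suc (k+j))) \<ge> U (k+j) - U (Suc (k+j))"
        using k by (intro step) auto
      with Suc show ?case by simp
    qed (simp add: w_def)
    have "U (k + j) \<le> U k - real j * w" for j
    proof (induction j)
      case (Suc j)
      with ge[of j] show ?case by (simp add: algebra_simps)
    qed simp
    moreover obtain j :: nat where "real j * w > U k" using wpos reals_Archimedean3 by blast
    ultimately show False using U_pos[of "k + j"] by (smt (verit))
  qed
  with C show ?thesis using that by blast
qed

end

section \<open>Norm ratios of monomials and weighted sums over the degree\<close>

locale weight_moments =
  fixes x :: "nat \<Rightarrow> real" and \<alpha> :: real
  assumes \<alpha>: "\<alpha> > 0"
    and x_pos: "0 < x k" and x_Suc_less: "x (Suc k) < x k"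
    and x_log_convex: "(x (Suc k))\<^sup>2 \<le> x k * x (Suc (Suc k))"
    and x_rec: "(real k + 2) * (x k - 2 * x (Suc k) + x (Suc (Suc k)))
                  - 2 * (x (Suc k) - x (Suc (Suc k))) = \<alpha> * x (Suc k)"
begin

text \<open>These ratios run over all integer moments because the three-term recurrence links
  consecutive ones; the monomial norms only use the even moments.\<close>

definition U :: "nat \<Rightarrow> real" where "U k = 1 - x (Suc k) / x k"

sublocale ratio_recurrence U \<alpha>
proof
  show "0 < \<alpha>" by (rule \<alpha>)
  show "0 < U k" "U k < 1" for k
    using x_pos[of k] x_pos[of "Suc k"] x_Suc_less[of k] by (auto simp: U_def field_simps)
  show "U (Suc k) \<le> U k" for k
    using x_pos[of k] x_pos[of "Suc k"] x_log_convex[of k]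
    by (simp add: U_def field_simps power2_eq_square)
  show "(real k + 2) * (U k / (1 - U k) - U (Suc k)) = \<alpha> + 2 * U (Suc k)" for k
  proof -
    have "U k / (1 - U k) - U (Suc k) = (x k - 2 * x (Suc k) + x (Suc (Suc k))) / x (Suc k)"
      using x_pos[of k] x_pos[of "Suc k"] by (simp add: U_def field_simps)
    moreover have "2 * U (Suc k) = 2 * (x (Suc k) - x (Suc (Suc k))) / x (Suc k)"
      using x_pos[of "Suc k"] by (simp add: U_def field_simps)
    moreover have "(real k + 2) * ((x k - 2 * x (Suc k) + x (Suc (Suc k))) / x (Suc k))
        = \<alpha> + 2 * (x (Suc k) - x (Suc (Suc k))) / x (Suc k)"
      using x_rec[of k] x_pos[of "Suc k"] by (simp add: field_simps)
    ultimately show ?thesis by simp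
  qed
qed

text \<open>\<open>p n\<close> is the squared norm ratio of \<open>z\<^sup>n\<close> and \<open>z\<^sup>n\<^sup>-\<^sup>1\<close>; the value at \<open>0\<close> is chosen
  such that summation by parts has no boundary term.\<close>

definition p :: "nat \<Rightarrow> real" where "p n = (case n of 0 \<Rightarrow> 0 | Suc j \<Rightarrow> x (2 * n) / x (2 * j))"
definition h :: "nat \<Rightarrow> real" where "h n = 1 - p n"
definition d :: "nat \<Rightarrow> real" where "d n = p (Suc n) - p n"

lemma p_0 [simp]: "p 0 = 0" by (simp add: p_def)

lemma p_Suc: "p (Suc n) = x (2 * Suc n) / x (2 * n)" by (simp add: p_def)

lemma p_Suc_U: "p (Suc n) = (1 - U (2 * n)) * (1 - U (Suc (2 * n)))"
  using x_pos[of "2*n"] x_pos[of "Suc (2*n)"] by (simp add: p_Suc U_def)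

lemma p_Suc_pos: "p (Suc n) > 0" using x_pos by (simp add: p_Suc)

lemma p_nonneg: "p n \<ge> 0" using p_Suc_pos[of "n - 1"] by (cases n) auto

lemma h_Suc_bounds: "U (2 * n) \<le> h (Suc n)" "h (Suc n) \<le> 2 * U (2 * n)"
proof -
  have "h (Suc n) = U (2 * n) + U (Suc (2 * n)) * (1 - U (2 * n))"
    by (simp add: h_def p_Suc_U algebra_simps)
  moreover have "U (Suc (2 * n)) * (1 - U (2 * n)) \<le> U (2 * n) * 1"
    using U_pos U_less_1[of "2*n"] U_Suc_le by (intro mult_mono) (auto intro: less_imp_le)
  moreover have "U (Suc (2 * n)) * (1 - U (2 * n)) \<ge> 0"
    using U_pos[of "Suc (2*n)"] U_less_1[of "2*n"] by simp
  ultimately show "U (2 * n) \<le> h (Suc n)" "h (Suc n) \<le> 2 * U (2 * n)" by linarith+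
qed

lemma h_pos: "h n > 0"
  using h_Suc_bounds(1)[of "n - 1"] U_pos[of "2 * (n-1)"] by (cases n) (auto simp: h_def)

lemma h_le_1: "h n \<le> 1" using p_nonneg by (simp add: h_def)

lemma h_tendsto_0: "h \<longlonglongrightarrow> 0"
proof -
  have "(\<lambda>n. 2 * U (2 * n)) \<longlonglongrightarrow> 2 * 0"
    using LIMSEQ_subseq_LIMSEQ[OF U_tendsto_0, of "\<lambda>n. 2 * n"]
    by (intro tendsto_intros) (auto simp: strict_mono_def o_def)
  then have "(\<lambda>n. h (Suc n)) \<longlonglongrightarrow> 0"
    using h_Suc_bounds(2) h_pos
    by (intro Lim_null_comparison[of "\<lambda>n. h (Suc n)" "\<lambda>n. 2 * U (2 * n)"])
       (auto intro!: always_eventually simp: abs_of_pos)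
  then show ?thesis by (rule LIMSEQ_imp_Suc)
qed

lemma d_nonneg: "d n \<ge> 0"
proof (cases n)
  case (Suc j)
  have "(1 - U (2 * j)) * (1 - U (Suc (2 * j))) \<le> (1 - U (2 * Suc j)) * (1 - U (Suc (2 * Suc j)))"
    using U_antimono[of "2*j" "2 * Suc j"] U_antimono[of "Suc (2*j)" "Suc (2 * Suc j)"] U_less_1
    by (intro mult_mono) (auto intro: less_imp_le simp: le_diff_eq)
  then show ?thesis by (simp add: Suc d_def p_Suc_U)
qed (use p_nonneg in \<open>simp add: d_def\<close>)

lemma p_le_1: "p n \<le> 1" using h_pos[of n] by (simp add: h_def)

lemma d_le_1: "d n \<le> 1" using p_nonneg[of n] p_le_1[of "Suc n"] by (simp add: d_def)

text \<open>One step of p moves each of the two factors in \<open>p_Suc_U\<close> by two indices.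
  The increment is therefore bounded by three consecutive decrements of U, the middle one counted
  twice, and each is at most \<open>C * (U (2 * j))^3\<close>.\<close>

lemma d_le_h_cube: obtains C where "C \<ge> 1" "\<And>n. d n \<le> C * (h n) ^ 3"
proof -
  obtain C where C: "C > 0" "\<And>k. U k - U (Suc k) \<le> C * (U k) ^ 3" by (rule U_diff_le) blast
  have "d n \<le> max 1 (4 * C) * (h n) ^ 3" for n
  proof (cases n)
    \<comment> \<open>The conventional value \<open>p 0 = 0\<close> gives \<open>h 0 = 1\<close>,
      which is why the constant is taken at least 1.\<close>
    case 0
    then show ?thesis using d_le_1[of 0] by (simp add: h_def)
  next
    case (Suc j)
    define a b a' b' where "a = U (2*j)" and "b = U (Suc (2*j))"
      and "a' = U (Suc (Suc (2*j)))" and "b' = U (Suc (Suc (Suc (2*j))))"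
    have ab: "0 < a" "a < 1" "0 < b'" "b' \<le> a'" "a' \<le> b" "b \<le> a"
      using U_pos U_less_1 U_Suc_le by (auto simp: a_def b_def a'_def b'_def)
    have diff: "U i - U (Suc i) \<le> C * a ^ 3" if "2 * j \<le> i" for i
    proof -
      have "C * (U i) ^ 3 \<le> C * a ^ 3"
        using C U_pos[of i] U_antimono[OF that] by (intro mult_left_mono power_mono) (auto simp: a_def)
      with C(2)[of i] show ?thesis by linarith
    qed
    have "d n = (1 - a') * (1 - b') - (1 - a) * (1 - b)"
      by (simp add: Suc d_def p_Suc_U a_def b_def a'_def b'_def)
    also have "\<dots> = (a - a') * (1 - b') + (b - b') * (1 - a)"
      by (simp add: algebra_simps)
    also have "\<dots> \<le> (a - a') * 1 + (b - b') * 1"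
      using ab by (intro add_mono mult_left_mono) auto
    also have "\<dots> = (a - b) + (b - a') + (b - a') + (a' - b')" by simp
    also have "\<dots> \<le> 4 * (C * a ^ 3)"
      using diff[of "2*j"] diff[of "Suc (2*j)"] diff[of "Suc (Suc (2*j))"]
      by (simp add: a_def b_def a'_def b'_def)
    also have "\<dots> \<le> 4 * (C * (h n) ^ 3)"
      using C ab h_Suc_bounds(1)[of j] by (intro mult_left_mono power_mono) (auto simp: Suc a_def)
    also have "\<dots> = (4 * C) * (h n) ^ 3" by simp
    also have "\<dots> \<le> max 1 (4 * C) * (h n) ^ 3"
      using h_pos[of n] by (intro mult_right_mono) auto
    finally show ?thesis .
  qed
  then show ?thesis using that[of "max 1 (4 * C)"] by auto
qed

text \<open>For s = |z| these are the terms of the series of K(z,z). They serve below as weights of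
  a measure on n.\<close>

definition \<beta> :: "real \<Rightarrow> nat \<Rightarrow> real" where "\<beta> s n = s ^ (2 * n) / x (2 * n)"

lemma \<beta>_nonneg: "0 \<le> s \<Longrightarrow> \<beta> s n \<ge> 0"
  using x_pos[of "2*n"] by (simp add: \<beta>_def)

lemma \<beta>_mono: "0 \<le> s \<Longrightarrow> s \<le> t \<Longrightarrow> \<beta> s n \<le> \<beta> t n"
  using x_pos[of "2*n"] by (auto simp: \<beta>_def intro!: divide_right_mono power_mono)

lemma \<beta>_Suc_p: "\<beta> s (Suc n) * p (Suc n) = s\<^sup>2 * \<beta> s n"
  using x_pos[of "2*n"] x_pos[of "2 * Suc n"] by (simp add: \<beta>_def p_Suc power2_eq_square)

text \<open>Ratio test: consecutive terms have ratio \<open>t / p (Suc n)\<close>, which tends to t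
  because h tends to 0.\<close>

lemma summable_inverse_moments:
  assumes "0 \<le> t" "t < 1" shows "summable (\<lambda>n. t ^ n / x (2 * n))"
proof -
  obtain c where c: "t < c" "c < 1" using assms dense by blast
  have c0: "c > 0" using assms c by simp
  have "eventually (\<lambda>n. h n < 1 - t / c) sequentially"
    using c c0 assms by (intro order_tendstoD(2)[OF h_tendsto_0]) auto
  then obtain N where N: "\<And>n. n \<ge> N \<Longrightarrow> h n < 1 - t / c" by (auto simp: eventually_sequentially)
  show ?thesis
  proof (rule summable_ratio_test[OF \<open>c < 1\<close>, of N])
    fix n assume "n \<ge> N"
    then have "t / c < p (Suc n)" using N[of "Suc n"] by (simp add: h_def)
    then have *: "t \<le> c * p (Suc n)" using c0 by (simp add: field_simps)
    have "t ^ Suc n / x (2 * Suc n) \<le> t ^ n * (c * p (Suc n)) / x (2 * Suc n)"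
      using * assms x_pos[of "2 * Suc n"] mult_left_mono[OF *, of "t ^ n"]
      by (intro divide_right_mono) (auto simp: mult_ac)
    also have "\<dots> = c * (t ^ n / x (2 * n))"
      using x_pos[of "2 * Suc n"] by (simp add: p_Suc)
    finally show "norm (t ^ Suc n / x (2 * Suc n)) \<le> c * norm (t ^ n / x (2 * n))"
      using assms x_pos[of "2*n"] x_pos[of "2 * Suc n"] by simp
  qed
qed

lemma summable_\<beta>: "0 \<le> s \<Longrightarrow> s < 1 \<Longrightarrow> summable (\<beta> s)"
  using summable_inverse_moments[of "s\<^sup>2"]
  by (simp add: \<beta>_def[abs_def] power_mult power_less_one_iff)

lemma summable_\<beta>_mult:
  assumes "0 \<le> s" "s < 1" "\<And>n. \<bar>g n\<bar> \<le> B"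
  shows "summable (\<lambda>n. \<beta> s n * g n)"
proof (rule summable_comparison_test')
  show "summable (\<lambda>n. \<beta> s n * B)" using summable_\<beta>[of s] assms by (intro summable_mult2) auto
  show "norm (\<beta> s n * g n) \<le> \<beta> s n * B" for n
    using assms \<beta>_nonneg[of s n] by (auto simp: abs_mult intro!: mult_left_mono)
qed

text \<open>A Stein identity for the weights \<beta>: by \<open>\<beta>_Suc_p\<close>, a factor
  \<open>p n\<close> shifts the index, and the boundary term carries \<open>p 0 = 0\<close>. It
  trades a deviation \<open>p n - s^2\<close> for an increment of g, which is where all smallness
  comes from.\<close>

lemma stein:
  assumes s: "0 \<le> s" "s < 1" and g: "\<And>n. \<bar>g n\<bar> \<le> B"
  shows "(\<Sum>n. \<beta> s n * ((p n - s\<^sup>2) * g n)) = s\<^sup>2 * (\<Sum>n. \<beta> s n * (g (Suc n) - g n))"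
proof -
  have B: "0 \<le> B" using g[of 0] by linarith
  have pg: "\<bar>p n * g n\<bar> \<le> B" for n
    using mult_mono[OF p_le_1[of n] g[of n]] p_nonneg[of n] B by (simp add: abs_mult)
  note sm = summable_\<beta>_mult[OF s]
  have "(\<Sum>n. \<beta> s n * (p n * g n)) = (\<Sum>n. \<beta> s (Suc n) * (p (Suc n) * g (Suc n)))"
    by (subst suminf_split_head[OF sm, of "\<lambda>n. p n * g n" B]) (auto simp: pg)
  also have "\<dots> = (\<Sum>n. s\<^sup>2 * (\<beta> s n * g (Suc n)))"
    by (simp only: mult.assoc[symmetric] \<beta>_Suc_p)
  also have "\<dots> = s\<^sup>2 * (\<Sum>n. \<beta> s n * g (Suc n))"
    by (intro suminf_mult sm[of _ B] g)
  finally have 1: "(\<Sum>n. \<beta> s n * (p n * g n)) = s\<^sup>2 * (\<Sum>n. \<beta> s n * g (Suc n))" .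
  have "(\<Sum>n. \<beta> s n * ((p n - s\<^sup>2) * g n)) = (\<Sum>n. \<beta> s n * (p n * g n) - s\<^sup>2 * (\<beta> s n * g n))"
    by (simp add: algebra_simps)
  also have "\<dots> = (\<Sum>n. \<beta> s n * (p n * g n)) - (\<Sum>n. s\<^sup>2 * (\<beta> s n * g n))"
    by (intro suminf_diff[symmetric] summable_mult sm[of _ B] g pg)
  also have "(\<Sum>n. s\<^sup>2 * (\<beta> s n * g n)) = s\<^sup>2 * (\<Sum>n. \<beta> s n * g n)"
    by (intro suminf_mult sm[of _ B] g)
  also have "(\<Sum>n. \<beta> s n * (p n * g n)) - s\<^sup>2 * (\<Sum>n. \<beta> s n * g n)
      = s\<^sup>2 * ((\<Sum>n. \<beta> s n * g (Suc n)) - (\<Sum>n. \<beta> s n * g n))"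
    unfolding 1 right_diff_distrib ..
  also have "(\<Sum>n. \<beta> s n * g (Suc n)) - (\<Sum>n. \<beta> s n * g n) = (\<Sum>n. \<beta> s n * (g (Suc n) - g n))"
    unfolding right_diff_distrib by (rule suminf_diff) (intro sm[of _ B] g)+
  finally show ?thesis .
qed

text \<open>With \<open>\<eta> = 1 - s^2\<close> one has \<open>h n = \<eta> - (p n - s^2)\<close>,
  so \<open>h^6\<close> splits into \<open>\<eta> h^5\<close> and a term to which
  \<open>stein\<close> applies. The increment of \<open>h^5\<close> is at most
  \<open>5 C h^7\<close>, of lower order since h tends to 0. Half of the sum is absorbed on the
  left, leaving \<open>\<eta>^6\<close> times the total mass and finitely many indices.\<close>

lemma sum_\<beta>_h6:
  obtains A where "A > 0"
    "\<And>s. 0 \<le> s \<Longrightarrow> s < 1 \<Longrightarrow> (\<Sum>n. \<beta> s n * h n ^ 6) \<le> A * ((1 - s\<^sup>2) ^ 6 * (\<Sum>n. \<beta> s n) + 1)"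
proof -
  obtain C where C: "C \<ge> 1" "\<And>n. d n \<le> C * (h n) ^ 3" by (rule d_le_h_cube) blast
  \<comment> \<open>Beyond this N the term \<open>5 C h^7\<close> is at most
    \<open>h^6 / 4\<close>.\<close>
  have "eventually (\<lambda>n. h n < 1 / (20 * C)) sequentially"
    using C by (intro order_tendstoD(2)[OF h_tendsto_0]) auto
  then obtain N where N: "\<And>n. n \<ge> N \<Longrightarrow> h n < 1 / (20 * C)" by (auto simp: eventually_sequentially)
  \<comment> \<open>Twice the 1024 that arises from splitting at \<open>\<eta> = h / 4\<close>, plus
    twice the contribution \<open>5 C / x (2 * n)\<close> of the indices below N; the doubling pays
    for the absorption.\<close>
  define A where "A = 2048 + 10 * C * (\<Sum>n<N. 1 / x (2 * n))"
  have A0: "(\<Sum>n<N. 1 / x (2 * n)) \<ge> 0" using x_pos by (intro sum_nonneg) (auto intro: less_imp_le)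
  have A: "A > 0" "A \<ge> 2048" "A \<ge> 10 * C * (\<Sum>n<N. 1 / x (2 * n))"
    using C A0 by (auto simp: A_def add_pos_nonneg)
  have main: "(\<Sum>n. \<beta> s n * h n ^ 6) \<le> A * ((1 - s\<^sup>2) ^ 6 * (\<Sum>n. \<beta> s n) + 1)"
    if s: "0 \<le> s" "s < 1" for s
  proof -
    note sm = summable_\<beta>_mult[OF s]
    define \<eta> where "\<eta> = 1 - s\<^sup>2"
    have s2: "s\<^sup>2 \<le> 1" using s by (simp add: power_le_one)
    have \<eta>: "0 \<le> \<eta>" "\<eta> \<le> 1" using s2 by (auto simp: \<eta>_def)
    have hk: "\<bar>h n ^ k\<bar> \<le> 1" for n k
      using h_pos[of n] h_le_1[of n] by (simp add: power_le_one)
    have dh: "h n ^ 5 - h (Suc n) ^ 5 \<le> 5 * C * h n ^ 7" for n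
    proof -
      define a b where "a = h n" and "b = h (Suc n)"
      have ab: "0 < b" "b \<le> a" "a - b = d n"
        using h_pos d_nonneg[of n] by (auto simp: a_def b_def d_def h_def)
      have "a ^ 5 - b ^ 5 = (a - b) * (a^4 + a^3*b + a^2*b^2 + a*b^3 + b^4)"
        by (simp add: algebra_simps power2_eq_square power3_eq_cube power4_eq_xxxx eval_nat_numeral)
      also have "\<dots> \<le> (a - b) * (a^4 + a^3*a + a^2*a^2 + a*a^3 + a^4)"
        using ab by (intro mult_left_mono add_mono mult_mono power_mono) auto
      also have "\<dots> = d n * (5 * a ^ 4)"
        using ab(3) by (simp add: eval_nat_numeral)
      also have "\<dots> \<le> (C * a ^ 3) * (5 * a ^ 4)"
        using C(2)[of n] ab by (intro mult_right_mono) (auto simp: a_def)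
      also have "\<dots> = 5 * C * a ^ 7" by (simp add: eval_nat_numeral)
      finally show ?thesis by (simp add: a_def b_def)
    qed
    define R where "R n = (if n < N then 5 * C / x (2 * n) else 0)" for n
    have R: "summable R" "(\<Sum>n. R n) = 5 * C * (\<Sum>n<N. 1 / x (2 * n))"
    proof -
      have "R sums (\<Sum>n<N. R n)" by (rule sums_finite) (auto simp: R_def)
      moreover have "(\<Sum>n<N. R n) = 5 * C * (\<Sum>n<N. 1 / x (2 * n))"
        by (simp add: R_def sum_distrib_left)
      ultimately show "summable R" "(\<Sum>n. R n) = 5 * C * (\<Sum>n<N. 1 / x (2 * n))"
        by (auto simp: sums_iff)
    qed
    have pt: "\<beta> s n * h n ^ 6 + \<beta> s n * ((p n - s\<^sup>2) * h n ^ 5) \<le> \<beta> s n * h n ^ 6 / 4 + 1024 * \<eta> ^ 6 * \<beta> s n" for n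
    proof -
      have "h n ^ 6 + (p n - s\<^sup>2) * h n ^ 5 = \<eta> * h n ^ 5"
        by (simp add: \<eta>_def h_def eval_nat_numeral algebra_simps)
      also have "\<dots> \<le> h n ^ 6 / 4 + 1024 * \<eta> ^ 6"
      proof (cases "\<eta> \<le> h n / 4")
        case True
        have "\<eta> * h n ^ 5 \<le> h n / 4 * h n ^ 5" using True h_pos[of n] by (intro mult_right_mono) auto
        moreover have "h n / 4 * h n ^ 5 = h n ^ 6 / 4" by (simp add: eval_nat_numeral)
        ultimately show ?thesis using zero_le_power[OF \<eta>(1), of 6] by linarith
      next
        case False
        then have "\<eta> * h n ^ 5 \<le> \<eta> * (4 * \<eta>) ^ 5"
          using h_pos[of n] \<eta> by (intro mult_left_mono power_mono) auto
        also have "\<dots> = 1024 * \<eta> ^ 6" by (simp add: eval_nat_numeral)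
        finally show ?thesis using h_pos[of n] zero_le_power[of "h n" 6] by linarith
      qed
      finally show ?thesis using mult_left_mono[of _ _ "\<beta> s n", OF _ \<beta>_nonneg[OF s(1)]]
        by (fastforce simp: algebra_simps)
    qed
    have pt2: "\<beta> s n * (h n ^ 5 - h (Suc n) ^ 5) \<le> \<beta> s n * h n ^ 6 / 4 + R n" for n
    proof -
      have "\<beta> s n * (h n ^ 5 - h (Suc n) ^ 5) \<le> \<beta> s n * (5 * C * h n ^ 7)"
        using dh[of n] \<beta>_nonneg[OF s(1)] by (intro mult_left_mono)
      also have "\<dots> \<le> \<beta> s n * h n ^ 6 / 4 + R n"
      proof (cases "n < N")
        case True
        have "\<beta> s n \<le> 1 / x (2 * n)"
          using s x_pos[of "2*n"] by (auto simp: \<beta>_def intro!: divide_right_mono power_le_one)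
        then have "\<beta> s n * (5 * C * h n ^ 7) \<le> 1 / x (2 * n) * (5 * C * 1)"
          using hk[of n 7] C h_pos[of n] x_pos[of "2*n"] by (intro mult_mono) auto
        also have "\<dots> = R n" using True by (simp add: R_def)
        finally show ?thesis using \<beta>_nonneg[OF s(1), of n] h_pos[of n] by (simp add: add_increasing)
      next
        case False
        then have "C * h n \<le> 1 / 20" using N[of n] C by (simp add: field_simps)
        then have "5 * (C * h n) * h n ^ 6 \<le> 5 * (1 / 20) * h n ^ 6"
          using h_pos[of n] by (intro mult_right_mono) auto
        then have "5 * C * h n ^ 7 \<le> h n ^ 6 / 4" by (simp add: eval_nat_numeral mult_ac)
        then show ?thesis using False mult_left_mono[OF _ \<beta>_nonneg[OF s(1), of n]]
          by (fastforce simp: R_def)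
      qed
      finally show ?thesis .
    qed
    define H where "H = (\<Sum>n. \<beta> s n * h n ^ 6)"
    define Z where "Z = (\<Sum>n. \<beta> s n)"
    have H0: "summable (\<lambda>n. \<beta> s n * h n ^ 6)" by (rule sm[OF hk])
    have smp: "summable (\<lambda>n. \<beta> s n * ((p n - s\<^sup>2) * h n ^ 5))"
    proof (rule sm)
      fix n
      have "\<bar>p n - s\<^sup>2\<bar> \<le> 1" using p_nonneg[of n] p_le_1[of n] s2 zero_le_power2[of s] unfolding abs_le_iff by linarith
      then show "\<bar>(p n - s\<^sup>2) * h n ^ 5\<bar> \<le> 1"
        using mult_mono[of "\<bar>p n - s\<^sup>2\<bar>" 1 "\<bar>h n ^ 5\<bar>" 1] hk[of n 5] by (simp add: abs_mult)
    qed
    have smd: "summable (\<lambda>n. \<beta> s n * (h n ^ 5 - h (Suc n) ^ 5))"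
    proof (rule sm[of _ 2])
      show "\<bar>h n ^ 5 - h (Suc n) ^ 5\<bar> \<le> 2" for n using hk[of n 5] hk[of "Suc n" 5] by linarith
    qed
    have dH0: "(\<Sum>n. \<beta> s n * (h n ^ 5 - h (Suc n) ^ 5)) \<ge> 0"
      using \<beta>_nonneg[OF s(1)] h_pos d_nonneg p_le_1
      by (intro suminf_nonneg smd mult_nonneg_nonneg)
         (auto intro!: power_mono less_imp_le[OF h_pos] simp: h_def d_def)
    have "H + (\<Sum>n. \<beta> s n * ((p n - s\<^sup>2) * h n ^ 5))
        = (\<Sum>n. \<beta> s n * h n ^ 6 + \<beta> s n * ((p n - s\<^sup>2) * h n ^ 5))"
      unfolding H_def by (rule suminf_add[OF H0 smp])
    also have "\<dots> \<le> (\<Sum>n. \<beta> s n * h n ^ 6 / 4 + 1024 * \<eta> ^ 6 * \<beta> s n)"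
      by (intro suminf_le pt summable_add H0 smp summable_divide summable_mult summable_\<beta> s)
    also have "\<dots> = H / 4 + 1024 * \<eta> ^ 6 * Z"
      unfolding H_def Z_def
      by (subst suminf_add[symmetric])
         (auto intro!: H0 summable_divide summable_mult summable_\<beta> s simp: suminf_divide[OF H0] suminf_mult[OF summable_\<beta>[OF s]])
    finally have 1: "H + (\<Sum>n. \<beta> s n * ((p n - s\<^sup>2) * h n ^ 5)) \<le> H / 4 + 1024 * \<eta> ^ 6 * Z" .
    have "(\<Sum>n. \<beta> s n * ((p n - s\<^sup>2) * h n ^ 5)) = s\<^sup>2 * (\<Sum>n. \<beta> s n * (h (Suc n) ^ 5 - h n ^ 5))"
      by (rule stein[OF s hk])
    also have "(\<Sum>n. \<beta> s n * (h (Suc n) ^ 5 - h n ^ 5)) = - (\<Sum>n. \<beta> s n * (h n ^ 5 - h (Suc n) ^ 5))"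
      by (subst suminf_minus[OF smd, symmetric]) (simp add: algebra_simps)
    finally have "- (\<Sum>n. \<beta> s n * ((p n - s\<^sup>2) * h n ^ 5)) = s\<^sup>2 * (\<Sum>n. \<beta> s n * (h n ^ 5 - h (Suc n) ^ 5))"
      by simp
    also have "\<dots> \<le> 1 * (\<Sum>n. \<beta> s n * (h n ^ 5 - h (Suc n) ^ 5))"
      using s2 dH0 by (intro mult_right_mono)
    also have "\<dots> \<le> (\<Sum>n. \<beta> s n * h n ^ 6 / 4 + R n)"
      unfolding mult_1 by (intro suminf_le pt2 smd summable_add summable_divide H0 R)
    also have "\<dots> = H / 4 + (\<Sum>n. R n)"
      unfolding H_def by (subst suminf_add[symmetric]) (auto intro!: H0 summable_divide R simp: suminf_divide[OF H0])
    finally have 2: "- (\<Sum>n. \<beta> s n * ((p n - s\<^sup>2) * h n ^ 5)) \<le> H / 4 + (\<Sum>n. R n)" .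
    have "Z \<ge> 0" unfolding Z_def using s by (auto intro!: suminf_nonneg summable_\<beta> \<beta>_nonneg)
    have "H \<le> 2048 * (\<eta> ^ 6 * Z) + 2 * (\<Sum>n. R n)" using 1 2 by (simp add: field_simps)
    also have "\<dots> \<le> A * (\<eta> ^ 6 * Z) + A"
      using A \<open>Z \<ge> 0\<close> \<eta> R(2) by (intro add_mono mult_right_mono) auto
    also have "\<dots> = A * (\<eta> ^ 6 * Z + 1)" by (simp add: algebra_simps)
    finally show ?thesis by (simp add: H_def Z_def \<eta>_def)
  qed
  with A show ?thesis using that by blast
qed

text \<open>With \<open>y n = p n - s^2\<close>, \<open>stein\<close> for \<open>g = y^3\<close>
  turns \<open>y^4\<close> into increments of \<open>y^3\<close>, whose leading part
  \<open>3 y^2 d\<close> is shared between \<open>y^4 / 2\<close> and a multiple of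
  \<open>d^2\<close>. So the sum of \<open>d^2\<close> controls everything, and
  \<open>d^2 \<le> C^2 h^6\<close>. Two multiplications of the kernel section by w - z will produce
  exactly these two sums.\<close>

lemma sum_\<beta>_fourth_moment:
  obtains A where "A > 0"
    "\<And>s. 0 \<le> s \<Longrightarrow> s < 1 \<Longrightarrow>
       (\<Sum>n. \<beta> s n * (p n - s\<^sup>2) ^ 4) + (\<Sum>n. \<beta> s n * (d n)\<^sup>2) \<le> A * ((1 - s\<^sup>2) ^ 6 * (\<Sum>n. \<beta> s n) + 1)"
proof -
  obtain C where C: "C \<ge> 1" "\<And>n. d n \<le> C * (h n) ^ 3" by (rule d_le_h_cube) blast
  obtain A where A: "A > 0" "\<And>s. 0 \<le> s \<Longrightarrow> s < 1 \<Longrightarrow>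
      (\<Sum>n. \<beta> s n * h n ^ 6) \<le> A * ((1 - s\<^sup>2) ^ 6 * (\<Sum>n. \<beta> s n) + 1)"
    by (rule sum_\<beta>_h6) blast
  have "(\<Sum>n. \<beta> s n * (p n - s\<^sup>2) ^ 4) + (\<Sum>n. \<beta> s n * (d n)\<^sup>2)
      \<le> (18 * C\<^sup>2 * A) * ((1 - s\<^sup>2) ^ 6 * (\<Sum>n. \<beta> s n) + 1)" if s: "0 \<le> s" "s < 1" for s
  proof -
    note sm = summable_\<beta>_mult[OF s]
    have s2: "s\<^sup>2 \<le> 1" using s by (simp add: power_le_one)
    define y where "y n = p n - s\<^sup>2" for n
    have y1: "\<bar>y n\<bar> \<le> 1" for n
      using p_nonneg[of n] p_le_1[of n] s2 zero_le_power2[of s] unfolding y_def abs_le_iff by linarith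
    have yk: "\<bar>y n ^ k\<bar> \<le> 1" for n k
      using y1[of n] by (simp add: power_abs power_le_one)
    have d2: "\<bar>(d n)\<^sup>2\<bar> \<le> 1" for n
      using d_nonneg[of n] d_le_1[of n] by (simp add: power_le_one)
    have hk: "\<bar>h n ^ k\<bar> \<le> 1" for n k
      using h_pos[of n] h_le_1[of n] by (simp add: power_le_one)
    define Y where "Y = (\<Sum>n. \<beta> s n * y n ^ 4)"
    define D where "D = (\<Sum>n. \<beta> s n * (d n)\<^sup>2)"
    have D0: "D \<ge> 0" and Y0: "Y \<ge> 0"
      unfolding D_def Y_def by (auto intro!: suminf_nonneg sm[OF d2] sm[OF yk] mult_nonneg_nonneg \<beta>_nonneg s)
    \<comment> \<open>The constant 17/2 is 9/2 + 3 + 1, one summand for each term of the expanded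
      cube; it leads to \<open>Y \<le> 17 * D\<close>.\<close>
    have pt: "\<beta> s n * (y (Suc n) ^ 3 - y n ^ 3) \<le> \<beta> s n * y n ^ 4 / 2 + 17/2 * (\<beta> s n * (d n)\<^sup>2)" for n
    proof -
      define a e where "a = y n" and "e = d n"
      have ae: "\<bar>a\<bar> \<le> 1" "0 \<le> e" "e \<le> 1" "y (Suc n) = a + e"
        using y1 d_nonneg d_le_1 by (auto simp: a_def e_def y_def d_def)
      have "(a + e) ^ 3 - a ^ 3 = 3 * a\<^sup>2 * e + 3 * a * e\<^sup>2 + e ^ 3"
        by (simp add: power2_eq_square power3_eq_cube algebra_simps)
      moreover have "3 * a\<^sup>2 * e \<le> a ^ 4 / 2 + 9/2 * e\<^sup>2"
        using zero_le_power2[of "a\<^sup>2 - 3 * e"] by (simp add: power2_eq_square eval_nat_numeral algebra_simps)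
      moreover have "3 * a * e\<^sup>2 \<le> 3 * 1 * e\<^sup>2" using ae by (intro mult_right_mono mult_left_mono) auto
      moreover have "e ^ 3 \<le> e\<^sup>2" using ae by (intro power_decreasing) auto
      ultimately have "(a + e) ^ 3 - a ^ 3 \<le> a ^ 4 / 2 + 17/2 * e\<^sup>2" by linarith
      then have "\<beta> s n * (y (Suc n) ^ 3 - y n ^ 3) \<le> \<beta> s n * (y n ^ 4 / 2 + 17/2 * (d n)\<^sup>2)"
        unfolding ae(4) by (intro mult_left_mono \<beta>_nonneg s) (auto simp: a_def e_def)
      then show ?thesis by (simp add: algebra_simps)
    qed
    have "Y = (\<Sum>n. \<beta> s n * ((p n - s\<^sup>2) * y n ^ 3))"
      by (simp add: Y_def y_def eval_nat_numeral)
    also have "\<dots> = s\<^sup>2 * (\<Sum>n. \<beta> s n * (y (Suc n) ^ 3 - y n ^ 3))"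
      by (rule stein[OF s yk])
    also have "\<dots> \<le> s\<^sup>2 * (\<Sum>n. \<beta> s n * y n ^ 4 / 2 + 17/2 * (\<beta> s n * (d n)\<^sup>2))"
    proof (intro mult_left_mono suminf_le pt summable_add summable_divide summable_mult sm[OF yk] sm[OF d2])
      show "summable (\<lambda>n. \<beta> s n * (y (Suc n) ^ 3 - y n ^ 3))"
      proof (rule sm[of _ 2])
        show "\<bar>y (Suc n) ^ 3 - y n ^ 3\<bar> \<le> 2" for n using yk[of n 3] yk[of "Suc n" 3] by linarith
      qed
    qed simp
    also have "(\<Sum>n. \<beta> s n * y n ^ 4 / 2 + 17/2 * (\<beta> s n * (d n)\<^sup>2)) = Y / 2 + 17/2 * D"
      unfolding Y_def D_def suminf_divide[OF sm[OF yk], symmetric] suminf_mult[OF sm[OF d2], symmetric]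
      by (rule suminf_add[symmetric]) (intro summable_divide summable_mult sm[OF yk] sm[OF d2])+
    also have "s\<^sup>2 * (Y / 2 + 17/2 * D) \<le> 1 * (Y / 2 + 17/2 * D)"
      using s2 Y0 D0 by (intro mult_right_mono) auto
    finally have "Y + D \<le> 18 * D" by simp
    also have "D \<le> (\<Sum>n. C\<^sup>2 * (\<beta> s n * h n ^ 6))"
      unfolding D_def
    proof (intro suminf_le sm[OF d2] summable_mult sm[OF hk])
      fix n
      have "(d n)\<^sup>2 \<le> (C * h n ^ 3)\<^sup>2" using C(2)[of n] d_nonneg[of n] by (intro power_mono)
      also have "\<dots> = C\<^sup>2 * h n ^ 6" by (simp add: power_mult_distrib flip: power_mult)
      finally show "\<beta> s n * (d n)\<^sup>2 \<le> C\<^sup>2 * (\<beta> s n * h n ^ 6)"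
        using mult_left_mono[OF _ \<beta>_nonneg[OF s(1), of n]] by (fastforce simp: mult_ac)
    qed
    also have "\<dots> = C\<^sup>2 * (\<Sum>n. \<beta> s n * h n ^ 6)" by (rule suminf_mult[OF sm[OF hk]])
    also have "\<dots> \<le> C\<^sup>2 * (A * ((1 - s\<^sup>2) ^ 6 * (\<Sum>n. \<beta> s n) + 1))"
      by (intro mult_left_mono A s) auto
    finally show ?thesis by (simp add: Y_def D_def y_def algebra_simps)
  qed
  moreover have "18 * C\<^sup>2 * A > 0" using A C by simp
  ultimately show ?thesis using that by blast
qed

end

section \<open>Area measure on the disc\<close>

abbreviation vec_complex :: "real ^ 2 \<Rightarrow> complex" where
  "vec_complex v \<equiv> Complex (v $ 1) (v $ 2)"

lemma Basis_real2: "(Basis :: (real ^ 2) set) = {axis 1 1, axis 2 1}"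
  by (auto simp: Basis_vec_def UNIV_2)

lemma vec_complex_measurable [measurable]: "vec_complex \<in> borel_measurable borel"
  unfolding Complex_eq by (intro borel_measurable_continuous_onI continuous_intros)

lemma distr_lborel_vec_complex: "distr lborel borel vec_complex = lborel"
proof (rule lborel_eqI[symmetric])
  fix l u :: complex assume le: "\<And>b. b \<in> Basis \<Longrightarrow> l \<bullet> b \<le> u \<bullet> b"
  define l' u' :: "real ^ 2" where "l' = vector [Re l, Im l]" and "u' = vector [Re u, Im u]"
  have pre: "vec_complex -` box l u = box l' u'"
    by (auto simp: box_def Basis_real2 Basis_complex_def inner_axis l'_def u'_def)
  have le': "Re l \<le> Re u" "Im l \<le> Im u"
    using le[of 1] le[of \<i>] by (auto simp: Basis_complex_def)
  have "(axis 1 1 :: real^2) \<noteq> axis 2 1" by (simp add: axis_eq_axis)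
  then have "emeasure lborel (box l' u') = ennreal ((Re u - Re l) * (Im u - Im l))"
    using le' by (subst emeasure_lborel_box)
      (auto simp: Basis_real2 inner_axis l'_def u'_def)
  then show "emeasure (distr lborel borel vec_complex) (box l u) = (\<Prod>b\<in>Basis. (u - l) \<bullet> b)"
    using le' by (simp add: emeasure_distr pre Basis_complex_def complex_inner_1_right complex_inner_i_right)
qed simp

text \<open>Seen in \<open>real ^ 2\<close>, the preimage of a box under the rotation is the image
  of a box under the inverse rotation \<open>g\<close>, which is multiplication by
  \<open>cnj c\<close>. Orthogonal images preserve measure, and boxes determine Lebesgue
  measure.\<close>

lemma distr_lborel_rotation:
  fixes c :: complex assumes c: "norm c = 1"
  shows "distr lborel borel (\<lambda>z. c * z) = lborel"
proof (rule lborel_eqI[symmetric])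
  fix l u :: complex assume le: "\<And>b. b \<in> Basis \<Longrightarrow> l \<bullet> b \<le> u \<bullet> b"
  define g :: "real ^ 2 \<Rightarrow> real ^ 2"
    where "g v = vector [Re c * v $ 1 + Im c * v $ 2, Re c * v $ 2 - Im c * v $ 1]" for v
  define B where "B = vec_complex -` box l u"
  have cc: "(Re c)\<^sup>2 + (Im c)\<^sup>2 = 1" using c by (simp add: norm_complex_def)
  have cnjc: "cnj c * c = 1" using cc by (simp add: complex_eq_iff power2_eq_square)
  have "linear g"
    by (rule linearI) (auto simp: g_def vec_eq_iff forall_2 algebra_simps)
  moreover have "norm (g v) = norm v" for v
  proof -
    have "(g v $ 1)\<^sup>2 + (g v $ 2)\<^sup>2 = ((Re c)\<^sup>2 + (Im c)\<^sup>2) * ((v $ 1)\<^sup>2 + (v $ 2)\<^sup>2)"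
      by (simp add: g_def algebra_simps power2_eq_square)
    then show ?thesis by (simp add: norm_vec_def L2_set_def UNIV_2 cc)
  qed
  ultimately have og: "orthogonal_transformation g" by (simp add: orthogonal_transformation)
  have inv: "vec_complex (g v) = cnj c * vec_complex v" for v
    by (simp add: g_def complex_eq_iff)
  have pre: "vec_complex -` ((*) c -` box l u) = g ` B"
  proof (intro equalityI subsetI)
    fix v assume "v \<in> vec_complex -` ((*) c -` box l u)"
    then have v: "c * vec_complex v \<in> box l u" by simp
    define w :: "real ^ 2" where "w = vector [Re (c * vec_complex v), Im (c * vec_complex v)]"
    have w: "vec_complex w = c * vec_complex v" by (simp add: w_def complex_eq_iff)
    have "vec_complex (g w) = vec_complex v"
      unfolding inv w mult.assoc[symmetric] cnjc by simp
    then have "g w = v" by (simp add: vec_eq_iff forall_2)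
    moreover have "w \<in> B" using v by (simp add: B_def w)
    ultimately show "v \<in> g ` B" by blast
  next
    fix v assume "v \<in> g ` B"
    then obtain w where "v = g w" "w \<in> B" by blast
    moreover have "c * vec_complex (g w) = vec_complex w"
      unfolding inv by (simp add: complex_mult_cnj cc flip: mult.assoc)
    ultimately show "v \<in> vec_complex -` ((*) c -` box l u)" by (simp add: B_def)
  qed
  have Bb: "B \<in> sets borel" unfolding B_def by (rule measurable_sets_borel[OF vec_complex_measurable]) simp
  have mB: "emeasure lborel B = emeasure lborel (box l u)"
    using emeasure_distr[of vec_complex lborel borel "box l u"]
    by (simp add: distr_lborel_vec_complex B_def)
  then have "emeasure lborel B < \<infinity>" using emeasure_lborel_box_finite[of l u] by (simp only: infinity_ennreal_def)
  then have Bm: "B \<in> lmeasurable" using Bb by (simp add: fmeasurable_def emeasure_completion)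
  have gB: "g ` B \<in> sets borel"
    unfolding pre[symmetric]
    by (intro measurable_sets_borel[OF vec_complex_measurable] measurable_sets_borel[of "(*) c" borel]) auto
  have "emeasure lborel (g ` B) = emeasure lborel B"
    using measurable_orthogonal_image[OF og Bm] measure_orthogonal_image[OF og Bm] Bm gB Bb
      emeasure_eq_measure2[of "g ` B" lebesgue] emeasure_eq_measure2[of B lebesgue] by (simp add: emeasure_completion)
  moreover have "emeasure (distr lborel borel (\<lambda>z. c * z)) (box l u) = emeasure lborel ((*) c -` box l u)"
    by (simp add: emeasure_distr)
  moreover have "\<dots> = emeasure lborel (g ` B)"
    unfolding pre[symmetric]
    by (subst distr_lborel_vec_complex[symmetric], subst emeasure_distr)
       (auto intro!: measurable_sets_borel[of "(*) c" borel])
  ultimately show "emeasure (distr lborel borel (\<lambda>z. c * z)) (box l u) = (\<Prod>b\<in>Basis. (u - l) \<bullet> b)"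
    using le by (simp add: mB)
qed simp

section \<open>Normalized area on the disc: polar coordinates and rotation invariance\<close>

lemma space_disc_measure [simp]: "space disc_measure = unit_disc"
  by (simp add: disc_measure_def)

lemma borel_measurable_disc_measure: 
  "f \<in> borel_measurable borel \<Longrightarrow> f \<in> borel_measurable disc_measure"
  for f :: "complex \<Rightarrow> 'a :: topological_space"
  by (auto simp: disc_measure_def intro!: measurable_restrict_space1 measurable_completion)

lemma id_measurable_disc_measure [measurable]: "(\<lambda>z. z) \<in> disc_measure \<rightarrow>\<^sub>M borel"
  by (intro borel_measurable_disc_measure) simp

lemma nn_integral_disc_measure:
  assumes [measurable]: "g \<in> borel_measurable borel"
  shows "(\<integral>\<^sup>+z. g z \<partial>disc_measure) = ennreal (1 / pi) * (\<integral>\<^sup>+z. g z * indicator unit_disc z \<partial>lborel)"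
proof -
  have "(\<integral>\<^sup>+z. g z \<partial>disc_measure) = (\<integral>\<^sup>+z. ennreal (1 / pi) * g z \<partial>lebesgue_on unit_disc)"
    unfolding disc_measure_def
    by (intro nn_integral_density) (auto intro!: measurable_restrict_space1 measurable_completion)
  also have "\<dots> = ennreal (1 / pi) * (\<integral>\<^sup>+z. g z \<partial>lebesgue_on unit_disc)"
    by (intro nn_integral_cmult) (auto intro!: measurable_restrict_space1 measurable_completion)
  also have "(\<integral>\<^sup>+z. g z \<partial>lebesgue_on unit_disc) = (\<integral>\<^sup>+z. g z * indicator unit_disc z \<partial>lebesgue)"
    by (intro nn_integral_restrict_space) simp
  also have "\<dots> = (\<integral>\<^sup>+z. g z * indicator unit_disc z \<partial>lborel)"
    by (intro nn_integral_completion)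
  finally show ?thesis .
qed

lemma emeasure_disc_measure:
  assumes A: "A \<in> sets borel" "A \<subseteq> unit_disc"
  shows "emeasure disc_measure A = ennreal (1 / pi) * emeasure lborel A"
proof -
  have "A = (\<lambda>z. z) -` A \<inter> space disc_measure" using A by auto
  also have "\<dots> \<in> sets disc_measure"
    by (rule measurable_sets[OF id_measurable_disc_measure A(1)])
  finally have "A \<in> sets disc_measure" .
  moreover have "indicator A z * indicator unit_disc z = (indicator A z :: ennreal)" for z
    using A(2) by (auto simp: indicator_def)
  ultimately show ?thesis
    using nn_integral_disc_measure[of "indicator A"] A(1) by simp
qed

lemma emeasure_disc_measure_ball:
  assumes "ball c r \<subseteq> unit_disc" "0 \<le> r"
  shows "emeasure disc_measure (ball c r) = ennreal (r\<^sup>2)"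
proof -
  have "emeasure disc_measure (ball c r) = ennreal (1 / pi) * ennreal (pi * r\<^sup>2)"
    using assms by (subst emeasure_disc_measure) (auto simp: emeasure_ball unit_ball_vol_2)
  also have "\<dots> = ennreal (r\<^sup>2)" using assms by (simp add: ennreal_mult[symmetric])
  finally show ?thesis .
qed

lemma prob_disc: "emeasure disc_measure (space disc_measure) = 1"
  using emeasure_disc_measure_ball[of 0 1] by simp

interpretation disc: finite_measure disc_measure
  by standard (simp only: prob_disc, simp)

interpretation disc2: pair_sigma_finite disc_measure disc_measure ..

text \<open>Polar coordinates from the area of discs alone: both measures give the ray above x the
  mass \<open>1 - m^2\<close>, where m is x clamped to the unit interval.\<close>

lemma distr_disc_norm:
  "distr disc_measure borel norm = density lborel (\<lambda>r. ennreal (2 * r) * indicator {0..1} r)"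
    (is "?M = ?N")
proof (rule measure_eqI_lessThan)
  show "sets ?M = sets borel" "sets ?N = sets borel" by simp_all
  have M: "emeasure ?M {x<..} = emeasure disc_measure {z \<in> unit_disc. x < norm z}" for x :: real
    by (subst emeasure_distr) (auto intro!: arg_cong[where f="emeasure disc_measure"] simp: borel_measurable_disc_measure)
  show "emeasure ?M {x<..} < \<infinity>" for x
    unfolding M infinity_ennreal_def by (metis disc.emeasure_finite infinity_ennreal_def top.not_eq_extremum)
  fix x :: real
  define m where "m = max 0 (min x 1)"
  have m: "0 \<le> m" "m \<le> 1" by (auto simp: m_def)
  have "emeasure ?N {x<..} = (\<integral>\<^sup>+r. ennreal (2 * r) * indicator {0..1} r * indicator {x<..} r \<partial>lborel)"
    by (subst emeasure_density) auto
  also have "\<dots> = (\<integral>\<^sup>+r. ennreal (2 * r) * indicator {m..1} r \<partial>lborel)"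
    by (rule nn_integral_cong_AE)
       (use AE_lborel_singleton[of x] AE_lborel_singleton[of 1] in eventually_elim, auto simp: m_def indicator_def max_def min_def split: if_splits)
  also have "\<dots> = ennreal (1 - m\<^sup>2)"
    using m by (subst nn_integral_FTC_Icc[where F="\<lambda>r. r\<^sup>2"]) (auto intro!: derivative_eq_intros)
  finally have N: "emeasure ?N {x<..} = ennreal (1 - m\<^sup>2)" .
  have "emeasure disc_measure {z \<in> unit_disc. x < norm z} = ennreal (1 - m\<^sup>2)"
  proof (cases "x < 0")
    case True
    then have "{z \<in> unit_disc. x < norm z} = unit_disc" using less_le_trans[OF True norm_ge_zero] by auto
    then show ?thesis using True prob_disc by (simp add: m_def)
  next
    case False
    have "{z \<in> unit_disc. x < norm z} = unit_disc - cball 0 m"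
      using False by (auto simp: m_def)
    moreover have "emeasure disc_measure (unit_disc - cball 0 m) = ennreal (1 - m\<^sup>2)"
    proof -
      have "emeasure disc_measure (unit_disc - cball 0 m) = ennreal (1 / pi) * emeasure lborel (unit_disc - cball (0::complex) m)"
        by (intro emeasure_disc_measure) auto
      also have "emeasure lborel (unit_disc - cball (0::complex) m) = emeasure lborel (unit_disc - ball (0::complex) m)"
      proof -
        have "AE z in lborel. z \<notin> sphere (0::complex) m"
          using negligible_sphere[of "0::complex" m]
          by (intro AE_not_in) (simp add: negligible_iff_null_sets null_sets_def emeasure_completion)
        then show ?thesis by (intro emeasure_eq_AE) (auto simp: dist_norm)
      qed
      also have "\<dots> = ennreal (pi - pi * m\<^sup>2)"
        using m by (subst emeasure_Diff) (auto simp: emeasure_ball unit_ball_vol_2 ennreal_minus)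
      also have "ennreal (1 / pi) * \<dots> = ennreal (1 - m\<^sup>2)"
        using m by (subst ennreal_mult[symmetric]) (auto simp: field_simps power_le_one)
      finally show ?thesis .
    qed
    ultimately show ?thesis by simp
  qed
  then show "emeasure ?M {x<..} = emeasure ?N {x<..}" unfolding M N .
qed

lemma
  fixes g :: "real \<Rightarrow> real"
  assumes [measurable]: "g \<in> borel_measurable borel"
  shows integral_disc_radial: "(LINT z|disc_measure. g (norm z)) = (LINT r|lborel. (2 * r) * indicator {0..1} r * g r)"
    and integrable_disc_radial: "integrable disc_measure (\<lambda>z. g (norm z)) \<longleftrightarrow> integrable lborel (\<lambda>r. (2 * r) * indicator {0..1} r * g r)"
proof -
  have [measurable]: "(norm :: complex \<Rightarrow> real) \<in> borel_measurable disc_measure"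
    by (intro borel_measurable_disc_measure) simp
  have D: "density lborel (\<lambda>r. ennreal (2 * r) * indicator {0..1} r) = density lborel (\<lambda>r. ennreal (2 * r * indicator {0..1} r))"
    by (intro arg_cong[where f="density lborel"] ext) (auto simp: indicator_def)
  have "(LINT z|disc_measure. g (norm z)) = (LINT r|distr disc_measure borel norm. g r)"
    by (subst integral_distr) auto
  also have "\<dots> = (LINT r|lborel. (2 * r) * indicator {0..1} r * g r)"
    unfolding distr_disc_norm D by (subst integral_density) (auto simp: indicator_def)
  finally show "(LINT z|disc_measure. g (norm z)) = (LINT r|lborel. (2 * r) * indicator {0..1} r * g r)" .
  have "integrable disc_measure (\<lambda>z. g (norm z)) \<longleftrightarrow> integrable (distr disc_measure borel norm) g"
    by (subst integrable_distr_eq) auto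
  also have "\<dots> \<longleftrightarrow> integrable lborel (\<lambda>r. (2 * r) * indicator {0..1} r * g r)"
    unfolding distr_disc_norm D by (subst integrable_density) (auto simp: indicator_def)
  finally show "integrable disc_measure (\<lambda>z. g (norm z)) \<longleftrightarrow> integrable lborel (\<lambda>r. (2 * r) * indicator {0..1} r * g r)" .
qed

text \<open>Both sides are pushed forward to \<open>borel\<close>, since \<open>disc_measure\<close>
  itself carries the Lebesgue sigma-algebra.\<close>

lemma distr_disc_rotation:
  assumes c: "norm c = 1"
  shows "distr disc_measure borel (\<lambda>z. c * z) = distr disc_measure borel (\<lambda>z. z)"
proof (rule measure_eqI)
  fix A :: "complex set" assume "A \<in> sets (distr disc_measure borel (\<lambda>z. c * z))"
  then have [measurable]: "A \<in> sets borel" by simp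
  have pre: "(\<lambda>z. c * z) -` A \<inter> unit_disc \<in> sets borel"
    by (intro sets.Int measurable_sets_borel[of "(*) c" borel]) auto
  have eq: "(\<lambda>z. c * z) -` (A \<inter> unit_disc) = (\<lambda>z. c * z) -` A \<inter> unit_disc"
    using c by (auto simp: norm_mult)
  have "emeasure (distr disc_measure borel (\<lambda>z. c * z)) A = emeasure disc_measure ((\<lambda>z. c * z) -` A \<inter> unit_disc)"
    by (subst emeasure_distr) (auto simp: borel_measurable_disc_measure)
  also have "\<dots> = ennreal (1 / pi) * emeasure lborel ((\<lambda>z. c * z) -` A \<inter> unit_disc)"
    by (intro emeasure_disc_measure pre) auto
  also have "emeasure lborel ((\<lambda>z. c * z) -` A \<inter> unit_disc) = emeasure (distr lborel borel (\<lambda>z. c * z)) (A \<inter> unit_disc)"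
    unfolding eq[symmetric] by (subst emeasure_distr) auto
  also have "ennreal (1 / pi) * \<dots> = emeasure disc_measure (A \<inter> unit_disc)"
    unfolding distr_lborel_rotation[OF c] by (intro emeasure_disc_measure[symmetric]) auto
  also have "\<dots> = emeasure (distr disc_measure borel (\<lambda>z. z)) A"
    by (subst emeasure_distr) auto
  finally show "emeasure (distr disc_measure borel (\<lambda>z. c * z)) A = emeasure (distr disc_measure borel (\<lambda>z. z)) A" .
qed simp

lemma integral_disc_rotation:
  fixes g :: "complex \<Rightarrow> complex"
  assumes "norm c = 1" and [measurable]: "g \<in> borel_measurable borel"
  shows "(LINT z|disc_measure. g (c * z)) = (LINT z|disc_measure. g z)"
proof -
  have "(LINT z|disc_measure. g (c * z)) = (LINT z|distr disc_measure borel (\<lambda>z. c * z). g z)"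
    by (subst integral_distr) (auto intro: borel_measurable_disc_measure)
  also have "\<dots> = (LINT z|disc_measure. g z)"
    unfolding distr_disc_rotation[OF assms(1)] by (subst integral_distr) auto
  finally show ?thesis .
qed

text \<open>Rotation by the angle pi / (j - k) turns the integral into its own negative.\<close>

lemma integral_disc_monomials:
  fixes g :: "real \<Rightarrow> complex"
  assumes "j \<noteq> k" and [measurable]: "g \<in> borel_measurable borel"
  shows "(LINT z|disc_measure. z ^ j * cnj z ^ k * g (norm z)) = 0"
proof -
  define c where "c = cis (pi / (real j - real k))"
  have [measurable]: "cnj \<in> borel_measurable borel"
    by (intro borel_measurable_continuous_onI continuous_intros)
  have "c ^ j * cnj c ^ k = cis ((real j - real k) * (pi / (real j - real k)))"
    unfolding c_def cis_cnj Complex.DeMoivre cis_mult by (rule arg_cong[where f=cis]) (simp add: algebra_simps add_divide_distrib diff_divide_distrib)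
  also have "\<dots> = -1" using assms(1) by simp
  finally have c: "c ^ j * cnj c ^ k = -1" .
  define I where "I = (LINT z|disc_measure. z ^ j * cnj z ^ k * g (norm z))"
  have "I = (LINT z|disc_measure. (c * z) ^ j * cnj (c * z) ^ k * g (norm (c * z)))"
    unfolding I_def by (rule integral_disc_rotation[symmetric]) (auto simp: c_def)
  also have "\<dots> = (LINT z|disc_measure. (c ^ j * cnj c ^ k) * (z ^ j * cnj z ^ k * g (norm z)))"
    by (simp add: power_mult_distrib norm_mult c_def mult_ac)
  also have "\<dots> = - I" unfolding c I_def by simp
  finally show ?thesis by (simp add: I_def)
qed

section \<open>Moments of the exponential weight\<close>

lemma exp_weight_pos [simp]: "exp_weight \<alpha> z > 0"
  by (simp add: exp_weight_def)

lemma exp_weight_measurable [measurable]: "exp_weight \<alpha> \<in> borel_measurable borel"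
  unfolding exp_weight_def by measurable

lemma AE_disc: "AE z in disc_measure. z \<in> unit_disc"
  using AE_space[of disc_measure] by simp

lemma integrable_disc_bounded:
  fixes g :: "complex \<Rightarrow> 'b :: {banach, second_countable_topology}"
  assumes "g \<in> borel_measurable disc_measure" "\<And>z. z \<in> unit_disc \<Longrightarrow> norm (g z) \<le> B"
  shows "integrable disc_measure g"
  using assms by (intro disc.integrable_const_bound[of _ B] AE_I2) auto

text \<open>The origin is exempted because integrands such as \<open>|z|^k v(z)\<close> may vanish
  there; it is a null set.\<close>

lemma integral_disc_pos:
  fixes g :: "complex \<Rightarrow> real"
  assumes "integrable disc_measure g" "\<And>z. z \<in> unit_disc - {0} \<Longrightarrow> 0 < g z" "0 \<le> g 0"
  shows "0 < (LINT z|disc_measure. g z)"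
proof -
  have nn: "AE z in disc_measure. 0 \<le> g z"
  proof (rule AE_I2)
    show "0 \<le> g z" if "z \<in> space disc_measure" for z
      using assms(2)[of z] assms(3) that by (cases "z = 0") auto
  qed
  have "(LINT z|disc_measure. g z) \<noteq> 0"
  proof
    assume "(LINT z|disc_measure. g z) = 0"
    then have "AE z in disc_measure. g z = 0"
      using integral_nonneg_eq_0_iff_AE[OF assms(1) nn] by simp
    moreover have "AE z in disc_measure. z \<noteq> 0"
    proof -
      have "emeasure disc_measure {0} = 0" by (subst emeasure_disc_measure) auto
      moreover have "(\<lambda>z. z) -` {0} \<inter> space disc_measure \<in> sets disc_measure"
        by (rule measurable_sets[OF id_measurable_disc_measure]) simp
      then have "{0} \<in> sets disc_measure" by (simp add: Int_absorb2)
      ultimately show ?thesis by (intro AE_I[of _ _ "{0}"]) auto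
    qed
    ultimately have "AE z in disc_measure. False"
      using AE_disc by eventually_elim (use assms(2) in force)
    moreover have "{z \<in> space disc_measure. \<not> False} = space disc_measure" by auto
    ultimately have "emeasure disc_measure (space disc_measure) = 0"
      using AE_iff_measurable[OF sets.top, of disc_measure "\<lambda>_. False"] by blast
    then show False using prob_disc by simp
  qed
  moreover have "(LINT z|disc_measure. g z) \<ge> 0" using nn by (rule integral_nonneg_AE)
  ultimately show ?thesis by simp
qed

locale disc_weight =
  fixes \<alpha> :: real assumes \<alpha>: "\<alpha> > 0"
begin

abbreviation v :: "complex \<Rightarrow> real" where "v \<equiv> exp_weight \<alpha>"

lemma v_le_1: "z \<in> unit_disc \<Longrightarrow> v z \<le> 1"
  using \<alpha> by (simp add: exp_weight_def)

definition moment :: "nat \<Rightarrow> real" where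
  "moment m = (LINT z|disc_measure. norm z ^ m * v z)"

lemma integrable_moment: "integrable disc_measure (\<lambda>z. norm z ^ m * v z)"
proof (rule integrable_disc_bounded)
  show "norm (norm z ^ m * v z) \<le> 1" if "z \<in> unit_disc" for z
    using that mult_mono[OF power_le_one[of "norm z" m] v_le_1[OF that]] by (simp add: less_imp_le)
qed (auto intro: borel_measurable_disc_measure)

definition rweight :: "real \<Rightarrow> real" where "rweight r = exp (- (\<alpha> / (1 - r)))"

lemma moment_has_integral: "((\<lambda>r. 2 * r ^ Suc m * rweight r) has_integral moment m) {0..1}"
proof -
  have [measurable]: "rweight \<in> borel_measurable borel" unfolding rweight_def by measurable
  have v: "v z = rweight (norm z)" for z by (simp add: exp_weight_def rweight_def)
  have "integrable lborel (\<lambda>r. (2 * r) * indicator {0..1} r * (r ^ m * rweight r))"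
    using integrable_moment[of m] integrable_disc_radial[of "\<lambda>r. r ^ m * rweight r"] by (simp add: v)
  from has_integral_integral_lborel[OF this]
  have "((\<lambda>r. (2 * r) * indicator {0..1} r * (r ^ m * rweight r)) has_integral moment m) UNIV"
    using integral_disc_radial[of "\<lambda>r. r ^ m * rweight r"] by (simp add: v moment_def)
  moreover have "(\<lambda>r. (2 * r) * indicator {0..1} r * (r ^ m * rweight r)) =
      (\<lambda>r. if r \<in> {0..1} then 2 * r ^ Suc m * rweight r else 0)"
    by (auto simp: indicator_def)
  ultimately show ?thesis by (simp only: has_integral_restrict_UNIV)
qed

text \<open>Integrating the derivative of \<open>r\<^sup>k\<^sup>+\<^sup>2 (1 - r)\<^sup>2 exp (- \<alpha> / (1 - r))\<close>, which vanishes
  at both end points.\<close>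

lemma moment_rec:
  "(real k + 2) * (moment k - 2 * moment (Suc k) + moment (Suc (Suc k)))
      - 2 * (moment (Suc k) - moment (Suc (Suc k))) = \<alpha> * moment (Suc k)"
proof -
  \<comment> \<open>The factor \<open>(1 - r)^2\<close> cancels the denominator in the derivative of
    \<open>rweight\<close>, so that \<open>F'\<close> consists of moment integrands only. It also
    forces F to vanish at 1, where division by zero gives \<open>rweight\<close> the value
    \<open>exp 0 = 1\<close>.\<close>
  define F where "F r = r ^ (k + 2) * (1 - r)\<^sup>2 * rweight r" for r
  define F' where "F' r = (real k + 2) * (r ^ Suc k * rweight r - 2 * (r ^ Suc (Suc k) * rweight r) + r ^ Suc (Suc (Suc k)) * rweight r)
     - 2 * (r ^ Suc (Suc k) * rweight r - r ^ Suc (Suc (Suc k)) * rweight r) - \<alpha> * (r ^ Suc (Suc k) * rweight r)" for r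
  have deriv: "(F has_real_derivative F' r) (at r)" if "r < 1" for r
  proof -
    have w: "(rweight has_real_derivative (- (\<alpha> / (1 - r)\<^sup>2) * rweight r)) (at r)"
      unfolding rweight_def[abs_def]
      by (rule derivative_eq_intros refl)+ (use that in \<open>auto simp: power2_eq_square\<close>)
    have "(F has_real_derivative ((real (k + 2) * r ^ Suc k * (1 - r)\<^sup>2 + r ^ (k + 2) * (2 * (1 - r) * (-1))) * rweight r
        + r ^ (k + 2) * (1 - r)\<^sup>2 * (- (\<alpha> / (1 - r)\<^sup>2) * rweight r))) (at r)"
      unfolding F_def[abs_def]
      by (rule derivative_eq_intros w refl)+ simp
    moreover have "r ^ (k + 2) * (1 - r)\<^sup>2 * (- (\<alpha> / (1 - r)\<^sup>2) * rweight r) = - \<alpha> * (r ^ (k + 2) * rweight r)"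
      using that by simp
    moreover have "(real (k + 2) * r ^ Suc k * (1 - r)\<^sup>2 + r ^ (k + 2) * (2 * (1 - r) * (-1))) * rweight r
        - \<alpha> * (r ^ (k + 2) * rweight r) = F' r"
      unfolding F'_def by (simp add: power2_eq_square algebra_simps)
    ultimately show ?thesis by simp
  qed
  have cont: "continuous_on {0..1} F"
    unfolding continuous_on_eq_continuous_within
  proof
    fix r :: real assume r: "r \<in> {0..1}"
    show "continuous (at r within {0..1}) F"
    proof (cases "r = 1")
      case False
      then show ?thesis using DERIV_isCont[OF deriv[of r]] r by (auto intro: continuous_at_imp_continuous_at_within)
    next
      case True
      have "(F \<longlongrightarrow> 0) (at 1 within {0..1})"
      proof (rule Lim_null_comparison)
        show "\<forall>\<^sub>F r in at 1 within {0..1}. norm (F r) \<le> (1 - r)\<^sup>2"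
          unfolding eventually_at_filter
        proof (intro always_eventually allI impI)
          fix r :: real assume r: "r \<in> {0..1}"
          have "rweight r \<le> 1" "rweight r \<ge> 0" using r \<alpha> by (auto simp: rweight_def)
          moreover have "r ^ (k + 2) \<le> 1" using r by (intro power_le_one) auto
          ultimately have "r ^ (k + 2) * rweight r \<le> 1" using r by (intro mult_le_one) auto
          then have "r ^ (k + 2) * rweight r * (1 - r)\<^sup>2 \<le> 1 * (1 - r)\<^sup>2" by (intro mult_right_mono) auto
          then show "norm (F r) \<le> (1 - r)\<^sup>2" using r \<open>rweight r \<ge> 0\<close> by (simp add: F_def mult_ac abs_mult)
        qed
        show "((\<lambda>r::real. (1 - r)\<^sup>2) \<longlongrightarrow> 0) (at 1 within {0..1})"
          by (auto intro!: tendsto_eq_intros)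
      qed
      then show ?thesis by (simp add: True continuous_within F_def)
    qed
  qed
  have F': "(F' has_integral (F 1 - F 0)) {0..1}"
    by (rule fundamental_theorem_of_calculus_interior[OF _ cont])
       (auto intro: deriv has_real_derivative_iff_has_vector_derivative[THEN iffD1])
  have F01: "F 1 - F 0 = 0" by (simp add: F_def)
  have "((\<lambda>r. 2 * F' r) has_integral
      ((real k + 2) * (moment k - 2 * moment (Suc k) + moment (Suc (Suc k)))
      - 2 * (moment (Suc k) - moment (Suc (Suc k))) - \<alpha> * moment (Suc k))) {0..1}"
  proof -
    have eq: "2 * F' r = (real k + 2) * (2 * r ^ Suc k * rweight r - 2 * (2 * r ^ Suc (Suc k) * rweight r) + 2 * r ^ Suc (Suc (Suc k)) * rweight r)
     - 2 * (2 * r ^ Suc (Suc k) * rweight r - 2 * r ^ Suc (Suc (Suc k)) * rweight r) - \<alpha> * (2 * r ^ Suc (Suc k) * rweight r)" for r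
      by (simp add: F'_def algebra_simps)
    show ?thesis unfolding eq
      by (intro has_integral_diff has_integral_add has_integral_mult_right moment_has_integral)
  qed
  from has_integral_unique[OF this has_integral_mult_right[OF F', of 2]] F01
  show ?thesis by simp
qed

sublocale weight_moments moment \<alpha>
proof
  show "0 < \<alpha>" by (rule \<alpha>)
  show pos: "0 < moment k" for k
    unfolding moment_def by (intro integral_disc_pos integrable_moment) (auto simp: less_imp_le)
  show "moment (Suc k) < moment k" for k
  proof -
    have "0 < (LINT z|disc_measure. norm z ^ k * v z - norm z ^ Suc k * v z)"
    proof (intro integral_disc_pos Bochner_Integration.integrable_diff integrable_moment)
      fix z :: complex assume "z \<in> unit_disc - {0}"
      then have "0 < norm z ^ k * v z * (1 - norm z)" by simp
      then show "0 < norm z ^ k * v z - norm z ^ Suc k * v z" by (simp add: algebra_simps)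
    qed (auto simp: less_imp_le)
    also have "\<dots> = moment k - moment (Suc k)"
      unfolding moment_def by (intro Bochner_Integration.integral_diff integrable_moment)
    finally show ?thesis by simp
  qed
  show "(moment (Suc k))\<^sup>2 \<le> moment k * moment (Suc (Suc k))" for k
  proof -
    \<comment> \<open>The minimizer of the quadratic polynomial obtained by integrating
      \<open>|z|^k v(z) (t - |z|)^2\<close>; its nonnegativity there is the Cauchy-Schwarz
      inequality.\<close>
    define t where "t = moment (Suc k) / moment k"
    have "0 \<le> (LINT z|disc_measure. norm z ^ k * v z * (t - norm z)\<^sup>2)"
      by (intro Bochner_Integration.integral_nonneg) (auto simp: less_imp_le)
    also have "\<dots> = (LINT z|disc_measure. t\<^sup>2 * (norm z ^ k * v z) - 2 * t * (norm z ^ Suc k * v z) + norm z ^ Suc (Suc k) * v z)"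
      by (intro Bochner_Integration.integral_cong) (auto simp: algebra_simps power2_eq_square)
    also have "\<dots> = t\<^sup>2 * moment k - 2 * t * moment (Suc k) + moment (Suc (Suc k))"
      unfolding moment_def using integrable_moment by (simp del: power_Suc)
    also have "\<dots> = moment (Suc (Suc k)) - (moment (Suc k))\<^sup>2 / moment k"
      using pos[of k] by (simp add: t_def field_simps power2_eq_square)
    finally show ?thesis using pos[of k] by (simp add: field_simps)
  qed
qed (rule moment_rec)

end

section \<open>Power series and the reproducing kernel\<close>

lemma cnj_measurable [measurable]: "cnj \<in> borel_measurable borel"
  by (intro borel_measurable_continuous_onI continuous_intros)

lemma disc_integral_sums:
  fixes t :: "nat \<Rightarrow> complex \<Rightarrow> complex"
  assumes t: "\<And>n. integrable disc_measure (t n)"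
    and le: "\<And>n z. z \<in> unit_disc \<Longrightarrow> norm (t n z) \<le> a n * G z"
    and a: "summable a" "\<And>n. 0 \<le> a n" and G: "integrable disc_measure G"
    and s: "\<And>z. z \<in> unit_disc \<Longrightarrow> (\<lambda>n. t n z) sums s z"
  shows "integrable disc_measure s" "(\<lambda>n. LINT z|disc_measure. t n z) sums (LINT z|disc_measure. s z)"
proof -
  have 1: "AE z in disc_measure. summable (\<lambda>n. norm (t n z))"
  proof (rule AE_I2)
    fix z assume "z \<in> space disc_measure"
    then show "summable (\<lambda>n. norm (t n z))"
      using le by (intro summable_comparison_test'[OF summable_mult2[OF a(1), of "G z"]]) auto
  qed
  have 2: "summable (\<lambda>n. LINT z|disc_measure. norm (t n z))"
  proof (rule summable_comparison_test'[OF summable_mult2[OF a(1), of "LINT z|disc_measure. G z"]])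
    fix n
    have "(LINT z|disc_measure. norm (t n z)) \<le> (LINT z|disc_measure. a n * G z)"
      using le by (intro integral_mono integrable_norm t integrable_mult_right G) auto
    then show "norm (LINT z|disc_measure. norm (t n z)) \<le> a n * (LINT z|disc_measure. G z)"
      by simp
  qed
  have eq: "(\<Sum>n. t n z) = s z" if "z \<in> space disc_measure" for z
    using s[of z] that by (simp add: sums_iff)
  show "integrable disc_measure s"
    using integrable_suminf[OF t 1 2] eq Bochner_Integration.integrable_cong[of disc_measure disc_measure "\<lambda>z. \<Sum>n. t n z" s] by simp
  show "(\<lambda>n. LINT z|disc_measure. t n z) sums (LINT z|disc_measure. s z)"
    using sums_integral[OF t 1 2] eq Bochner_Integration.integral_cong[of disc_measure disc_measure "\<lambda>z. \<Sum>n. t n z" s] by simp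
qed

text \<open>The cutoff at R < R' makes the series converge uniformly on the support of g, and the
  angular average annihilates all terms but the one with n = k. The radial factor is kept general:
  it will be the truncated weight when moments are computed and an indicator for the mean value
  property.\<close>

lemma disc_coefficient_radial:
  fixes g :: "real \<Rightarrow> real" and c :: "nat \<Rightarrow> complex"
  assumes R: "0 \<le> R" "R < R'" and f: "\<And>z. z \<in> ball 0 R' \<Longrightarrow> (\<lambda>n. c n * z ^ n) sums f z"
    and g [measurable]: "g \<in> borel_measurable borel" and g1: "\<And>r. \<bar>g r\<bar> \<le> 1" and g0: "\<And>r. r \<ge> R \<Longrightarrow> g r = 0"
  shows "(LINT z|disc_measure. f z * cnj z ^ k * g (norm z)) = c k * (LINT z|disc_measure. norm z ^ (2 * k) * g (norm z))"
proof -
  define t where "t n z = c n * (z ^ n * cnj z ^ k * complex_of_real (g (norm z)))" for n z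
  define s where "s z = f z * cnj z ^ k * g (norm z)" for z
  obtain \<rho> where \<rho>: "R < \<rho>" "\<rho> < R'" using R dense by blast
  have "summable (\<lambda>n. c n * of_real \<rho> ^ n)"
    using f[of "of_real \<rho>"] \<rho> R by (auto simp: sums_iff)
  then have sm: "summable (\<lambda>n. norm (c n * of_real R ^ n))"
    by (rule powser_insidea) (use \<rho> R in auto)
  have bound: "norm (t n z) \<le> norm (c n * of_real R ^ n) * 1" if z: "z \<in> unit_disc" for n z
  proof (cases "norm z < R")
    case True
    have "norm (t n z) = norm (c n) * (norm z ^ n * (norm z ^ k * \<bar>g (norm z)\<bar>))"
      by (simp add: t_def norm_mult norm_power)
    also have "\<dots> \<le> norm (c n) * (R ^ n * (1 * 1))"
      using True z R g1 by (intro mult_left_mono mult_mono power_mono power_le_one) auto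
    finally show ?thesis using R by (simp add: norm_mult norm_power)
  next
    case False
    then show ?thesis using g0 by (simp add: t_def)
  qed
  have t: "integrable disc_measure (t n)" for n
  proof (rule integrable_disc_bounded)
    show "t n \<in> borel_measurable disc_measure"
      unfolding t_def[abs_def] by (intro borel_measurable_disc_measure) measurable
  qed (rule bound)
  have "(\<lambda>n. LINT z|disc_measure. t n z) sums (LINT z|disc_measure. s z)"
  proof (rule disc_integral_sums[OF t bound sm])
    show "(\<lambda>n. t n z) sums s z" if "z \<in> unit_disc" for z
    proof (cases "norm z < R")
      case True
      then have "(\<lambda>n. c n * z ^ n * (cnj z ^ k * g (norm z))) sums (f z * (cnj z ^ k * g (norm z)))"
        using R by (intro sums_mult2 f) auto
      then show ?thesis by (simp add: t_def s_def mult_ac)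
    qed (use g0 in \<open>simp add: t_def s_def\<close>)
  qed auto
  moreover have "(LINT z|disc_measure. t n z) = (if n = k then c k * (LINT z|disc_measure. norm z ^ (2 * k) * g (norm z)) else 0)" for n
  proof (cases "n = k")
    case True
    have "z ^ k * cnj z ^ k = complex_of_real (norm z ^ (2 * k))" for z
      by (metis complex_norm_square of_real_power power_mult power_mult_distrib)
    then have "(LINT z|disc_measure. t n z) = (LINT z|disc_measure. c k * complex_of_real (norm z ^ (2 * k) * g (norm z)))"
      by (simp add: t_def True)
    also have "\<dots> = c k * complex_of_real (LINT z|disc_measure. norm z ^ (2 * k) * g (norm z))"
      by (simp only: integral_mult_right_zero integral_complex_of_real)
    finally show ?thesis using True by simp
  next
    case False
    then show ?thesis
      using integral_disc_monomials[OF False, of "\<lambda>r. complex_of_real (g r)"]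
      by (simp add: t_def)
  qed
  ultimately have "(\<lambda>n. if n = k then c k * (LINT z|disc_measure. norm z ^ (2 * k) * g (norm z)) else 0)
      sums (LINT z|disc_measure. s z)" by simp
  then have "(LINT z|disc_measure. s z) = c k * (LINT z|disc_measure. norm z ^ (2 * k) * g (norm z))"
    by (rule sums_unique2) (rule sums_single)
  then show ?thesis by (simp add: s_def)
qed

context disc_weight
begin

lemma v_nonneg [simp]: "0 \<le> v z" by (simp add: less_imp_le)

lemma v_measurable_disc [measurable]: "v \<in> borel_measurable disc_measure"
  by (intro borel_measurable_disc_measure) simp

text \<open>Termwise integration may fail up to the boundary, as f is only known to be integrable
  against v. Truncation at radii \<open>R j\<close> increasing to 1 gives the identity for each j,
  and dominated convergence removes the cutoff.\<close>

lemma moment_coefficient: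
  assumes f: "\<And>z. z \<in> unit_disc \<Longrightarrow> (\<lambda>n. c n * z ^ n) sums f z"
    and int: "integrable disc_measure (\<lambda>z. f z * complex_of_real (v z))"
  shows "(LINT z|disc_measure. f z * cnj z ^ k * v z) = c k * moment (2 * k)"
proof -
  define R where "R j = 1 - 1 / (real j + 2)" for j
  have R: "0 \<le> R j" "R j < 1" for j by (auto simp: R_def field_simps)
  have Rlim: "R \<longlonglongrightarrow> 1" unfolding R_def[abs_def] by real_asymp
  define g where "g j r = indicator {..<R j} r * (indicator {..<1} r * rweight r)" for j r
  have gm [measurable]: "g j \<in> borel_measurable borel" for j
    unfolding g_def[abs_def] rweight_def by measurable
  have rw: "0 \<le> rweight r" "r < 1 \<Longrightarrow> rweight r \<le> 1" for r using \<alpha> by (auto simp: rweight_def)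
  have g1: "\<bar>g j r\<bar> \<le> 1" for j r using rw[of r] by (auto simp: g_def indicator_def)
  have gv: "z \<in> unit_disc \<Longrightarrow> g j (norm z) = indicator {..<R j} (norm z) * v z" for j z
    by (simp add: g_def rweight_def exp_weight_def)
  have ev: "\<forall>\<^sub>F j in sequentially. indicator {..<R j} (norm z) = (1::real)" if "z \<in> unit_disc" for z :: complex
    using order_tendstoD(1)[OF Rlim, of "norm z"] that by (auto elim!: eventually_mono)
  have fm: "f \<in> borel_measurable disc_measure"
  proof -
    have "(\<lambda>z. f z * complex_of_real (v z) / complex_of_real (v z)) \<in> borel_measurable disc_measure"
      using borel_measurable_integrable[OF int] by (intro borel_measurable_divide) auto
    moreover have "v z \<noteq> 0" for z by (simp add: less_imp_neq[symmetric])
    ultimately show ?thesis by simp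
  qed
  have conv1: "(\<lambda>j. LINT z|disc_measure. f z * cnj z ^ k * g j (norm z)) \<longlonglongrightarrow> (LINT z|disc_measure. f z * cnj z ^ k * v z)"
  proof (rule integral_dominated_convergence[where w="\<lambda>z. norm (f z * complex_of_real (v z))"])
    show "AE z in disc_measure. (\<lambda>j. f z * cnj z ^ k * complex_of_real (g j (norm z))) \<longlonglongrightarrow> f z * cnj z ^ k * complex_of_real (v z)"
    proof (rule AE_I2)
      fix z assume z: "z \<in> space disc_measure"
      then have "\<forall>\<^sub>F j in sequentially. g j (norm z) = v z" using ev[of z] by (auto elim!: eventually_mono simp: gv)
      then have "(\<lambda>j. g j (norm z)) \<longlonglongrightarrow> v z" by (rule tendsto_eventually)
      then show "(\<lambda>j. f z * cnj z ^ k * complex_of_real (g j (norm z))) \<longlonglongrightarrow> f z * cnj z ^ k * complex_of_real (v z)"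
        by (intro tendsto_intros)
    qed
    show "AE z in disc_measure. norm (f z * cnj z ^ k * complex_of_real (g j (norm z))) \<le> norm (f z * complex_of_real (v z))" for j
    proof (rule AE_I2)
      fix z assume z: "z \<in> space disc_measure"
      have "norm (f z * cnj z ^ k * complex_of_real (g j (norm z))) = norm (f z) * (norm z ^ k * (indicator {..<R j} (norm z) * v z))"
        using z by (simp add: gv norm_mult norm_power)
      also have "\<dots> \<le> norm (f z) * (1 * (1 * v z))"
        using z by (intro mult_left_mono mult_mono power_le_one) (auto simp: indicator_def)
      finally show "norm (f z * cnj z ^ k * complex_of_real (g j (norm z))) \<le> norm (f z * complex_of_real (v z))"
        by (simp add: norm_mult)
    qed
    show "integrable disc_measure (\<lambda>z. norm (f z * complex_of_real (v z)))" by (intro integrable_norm int)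
    show "(\<lambda>z. f z * cnj z ^ k * complex_of_real (v z)) \<in> borel_measurable disc_measure"
      using fm by measurable
    show "(\<lambda>z. f z * cnj z ^ k * complex_of_real (g j (norm z))) \<in> borel_measurable disc_measure" for j
      using fm by measurable
  qed
  have conv2: "(\<lambda>j. LINT z|disc_measure. norm z ^ (2 * k) * g j (norm z)) \<longlonglongrightarrow> moment (2 * k)"
    unfolding moment_def
  proof (rule integral_dominated_convergence[where w="\<lambda>z. norm z ^ (2 * k) * v z"])
    show "AE z in disc_measure. (\<lambda>j. norm z ^ (2 * k) * g j (norm z)) \<longlonglongrightarrow> norm z ^ (2 * k) * v z"
    proof (rule AE_I2)
      fix z assume z: "z \<in> space disc_measure"
      then have "\<forall>\<^sub>F j in sequentially. g j (norm z) = v z" using ev[of z] by (auto elim!: eventually_mono simp: gv)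
      then have "(\<lambda>j. g j (norm z)) \<longlonglongrightarrow> v z" by (rule tendsto_eventually)
      then show "(\<lambda>j. norm z ^ (2 * k) * g j (norm z)) \<longlonglongrightarrow> norm z ^ (2 * k) * v z"
        by (intro tendsto_intros)
    qed
    show "AE z in disc_measure. norm (norm z ^ (2 * k) * g j (norm z)) \<le> norm z ^ (2 * k) * v z" for j
      by (rule AE_I2) (auto simp: gv abs_mult indicator_def)
    show "integrable disc_measure (\<lambda>z. norm z ^ (2 * k) * v z)" by (rule integrable_moment)
  qed (auto intro!: borel_measurable_disc_measure)
  have "(\<lambda>j. LINT z|disc_measure. f z * cnj z ^ k * g j (norm z)) = (\<lambda>j. c k * complex_of_real (LINT z|disc_measure. norm z ^ (2 * k) * g j (norm z)))"
  proof
    fix j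
    show "(LINT z|disc_measure. f z * cnj z ^ k * g j (norm z)) = c k * complex_of_real (LINT z|disc_measure. norm z ^ (2 * k) * g j (norm z))"
      by (rule disc_coefficient_radial[OF R(1)[of j] R(2)[of j] f gm g1]) (auto simp: g_def)
  qed
  moreover have "(\<lambda>j. c k * complex_of_real (LINT z|disc_measure. norm z ^ (2 * k) * g j (norm z))) \<longlonglongrightarrow> c k * complex_of_real (moment (2 * k))"
    by (intro tendsto_intros conv2)
  ultimately show ?thesis using conv1 LIMSEQ_unique by simp
qed

lemma integrable_bounded_v:
  fixes f :: "complex \<Rightarrow> complex"
  assumes "f \<in> borel_measurable disc_measure" "\<And>z. z \<in> unit_disc \<Longrightarrow> norm (f z) \<le> B"
  shows "integrable disc_measure (\<lambda>z. f z * complex_of_real (v z))"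
proof (rule integrable_disc_bounded)
  show "norm (f z * complex_of_real (v z)) \<le> B" if "z \<in> unit_disc" for z
    using mult_mono[OF assms(2)[OF that] v_le_1[OF that]] norm_ge_zero[of "f z"] assms(2)[OF that]
    by (simp add: norm_mult)
qed (use assms(1) in measurable)

lemma parseval_finite:
  fixes c :: "nat \<Rightarrow> complex"
  defines "S \<equiv> \<lambda>N z. \<Sum>n<N. c n * z ^ n"
  shows "integrable disc_measure (\<lambda>z. (norm (S N z))\<^sup>2 * v z)"
    and "(LINT z|disc_measure. (norm (S N z))\<^sup>2 * v z) = (\<Sum>n<N. (norm (c n))\<^sup>2 * moment (2 * n))"
proof -
  have Sb: "norm (S N z) \<le> (\<Sum>n<N. norm (c n))" if "z \<in> unit_disc" for z
    unfolding S_def using that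
    by (intro sum_norm_le) (auto simp: norm_mult norm_power intro!: mult_left_le power_le_one)
  have Sm: "S N \<in> borel_measurable borel" unfolding S_def by measurable
  have Sm': "S N \<in> borel_measurable disc_measure" by (rule borel_measurable_disc_measure[OF Sm])
  have iS: "integrable disc_measure (\<lambda>z. S N z * complex_of_real (v z))"
    by (rule integrable_bounded_v[OF Sm' Sb])
  have iSk: "integrable disc_measure (\<lambda>z. S N z * cnj z ^ k * complex_of_real (v z))" for k
  proof (rule integrable_bounded_v)
    show "(\<lambda>z. S N z * cnj z ^ k) \<in> borel_measurable disc_measure"
      using Sm by (intro borel_measurable_disc_measure borel_measurable_times borel_measurable_power cnj_measurable)
    show "norm (S N z * cnj z ^ k) \<le> (\<Sum>n<N. norm (c n))" if "z \<in> unit_disc" for z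
      using Sb[OF that] that power_le_one[of "norm z" k] mult_mono[OF Sb[OF that], of "norm z ^ k" 1]
      by (auto simp: norm_mult norm_power sum_nonneg)
  qed
  have eq: "complex_of_real ((norm (S N z))\<^sup>2 * v z) = (\<Sum>k<N. cnj (c k) * (S N z * cnj z ^ k * complex_of_real (v z)))" for z
  proof -
    have "complex_of_real ((norm (S N z))\<^sup>2 * v z) = S N z * cnj (S N z) * complex_of_real (v z)"
      by (simp add: complex_norm_square del: of_real_power)
    also have "cnj (S N z) = (\<Sum>k<N. cnj (c k) * cnj z ^ k)" by (simp add: S_def)
    finally show ?thesis by (simp add: sum_distrib_left sum_distrib_right mult_ac)
  qed
  have "integrable disc_measure (\<lambda>z. complex_of_real ((norm (S N z))\<^sup>2 * v z))"
    unfolding eq by (intro Bochner_Integration.integrable_sum integrable_mult_right iSk)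
  then show "integrable disc_measure (\<lambda>z. (norm (S N z))\<^sup>2 * v z)"
    by (simp only: complex_of_real_integrable_eq)
  have Ssums: "(\<lambda>n. (if n < N then c n else 0) * z ^ n) sums S N z" for z
    using sums_If_finite_set[of "{..<N}" "\<lambda>n. c n * z ^ n"] by (simp add: S_def if_distrib[of "\<lambda>x. x * _"] cong: if_cong)
  have "complex_of_real (LINT z|disc_measure. (norm (S N z))\<^sup>2 * v z)
      = (LINT z|disc_measure. complex_of_real ((norm (S N z))\<^sup>2 * v z))"
    by (simp only: integral_complex_of_real)
  also have "\<dots> = (\<Sum>k<N. cnj (c k) * (LINT z|disc_measure. S N z * cnj z ^ k * complex_of_real (v z)))"
    unfolding eq by (subst Bochner_Integration.integral_sum) (auto intro!: integrable_mult_right iSk)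
  also have "\<dots> = (\<Sum>k<N. cnj (c k) * (c k * moment (2 * k)))"
    by (intro sum.cong refl) (simp add: moment_coefficient[OF Ssums iS])
  also have "\<dots> = complex_of_real (\<Sum>k<N. (norm (c k))\<^sup>2 * moment (2 * k))"
    by (simp add: complex_norm_square mult_ac del: of_real_power)
  finally show "(LINT z|disc_measure. (norm (S N z))\<^sup>2 * v z) = (\<Sum>n<N. (norm (c n))\<^sup>2 * moment (2 * n))"
    by (simp only: of_real_eq_iff)
qed

text \<open>Fatou's lemma for the partial sums; this half of Parseval is the one that yields upper
  bounds.\<close>

lemma parseval_le:
  fixes c :: "nat \<Rightarrow> complex"
  assumes f: "\<And>z. z \<in> unit_disc \<Longrightarrow> (\<lambda>n. c n * z ^ n) sums f z"
    and sm: "summable (\<lambda>n. (norm (c n))\<^sup>2 * moment (2 * n))"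
  shows "(\<integral>\<^sup>+z. ennreal ((norm (f z))\<^sup>2 * v z) \<partial>disc_measure) \<le> ennreal (\<Sum>n. (norm (c n))\<^sup>2 * moment (2 * n))"
proof -
  define u where "u N z = ennreal ((norm (\<Sum>n<N. c n * z ^ n))\<^sup>2 * v z)" for N z
  have um: "u N \<in> borel_measurable disc_measure" for N
    unfolding u_def[abs_def] by (intro borel_measurable_disc_measure) measurable
  have "(\<integral>\<^sup>+z. ennreal ((norm (f z))\<^sup>2 * v z) \<partial>disc_measure) = (\<integral>\<^sup>+z. liminf (\<lambda>N. u N z) \<partial>disc_measure)"
  proof (rule nn_integral_cong)
    fix z assume "z \<in> space disc_measure"
    then have "(\<lambda>N. \<Sum>n<N. c n * z ^ n) \<longlonglongrightarrow> f z" using f[of z] by (simp add: sums_def)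
    then have "(\<lambda>N. u N z) \<longlonglongrightarrow> ennreal ((norm (f z))\<^sup>2 * v z)"
      unfolding u_def by (intro tendsto_ennrealI tendsto_intros)
    then show "ennreal ((norm (f z))\<^sup>2 * v z) = liminf (\<lambda>N. u N z)"
      by (intro lim_imp_Liminf[symmetric]) auto
  qed
  also have "\<dots> \<le> liminf (\<lambda>N. \<integral>\<^sup>+z. u N z \<partial>disc_measure)"
    by (rule nn_integral_liminf[OF um])
  also have "\<dots> \<le> liminf (\<lambda>N. ennreal (\<Sum>n. (norm (c n))\<^sup>2 * moment (2 * n)))"
  proof (intro Liminf_mono always_eventually allI)
    fix N
    have "(\<integral>\<^sup>+z. u N z \<partial>disc_measure) = ennreal (\<Sum>n<N. (norm (c n))\<^sup>2 * moment (2 * n))"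
      unfolding u_def using parseval_finite[of c N] by (subst nn_integral_eq_integral) auto
    also have "\<dots> \<le> ennreal (\<Sum>n. (norm (c n))\<^sup>2 * moment (2 * n))"
      using x_pos by (intro ennreal_leI sum_le_suminf sm) (auto simp: less_imp_le)
    finally show "(\<integral>\<^sup>+z. u N z \<partial>disc_measure) \<le> ennreal (\<Sum>n. (norm (c n))\<^sup>2 * moment (2 * n))" .
  qed
  finally show ?thesis by (simp add: Liminf_const)
qed

text \<open>As v is radial, the monomials are orthogonal and the reproducing kernel depends on z and
  w only through \<open>z * cnj w\<close>. K is that function of one variable.\<close>

definition K :: "complex \<Rightarrow> complex" where "K u = (\<Sum>n. u ^ n / complex_of_real (moment (2 * n)))"

lemma summable_K: "norm u < 1 \<Longrightarrow> summable (\<lambda>n. norm (u ^ n / complex_of_real (moment (2 * n))))"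
  using summable_inverse_moments[of "norm u"] x_pos by (simp add: norm_divide norm_power less_imp_le)

lemma K_sums: "norm u < 1 \<Longrightarrow> (\<lambda>n. u ^ n / complex_of_real (moment (2 * n))) sums K u"
  unfolding K_def by (intro summable_sums summable_norm_cancel[OF summable_K])

lemma K_holomorphic: "K holomorphic_on unit_disc"
  by (rule power_series_holomorphic[where a="\<lambda>n. 1 / complex_of_real (moment (2 * n))"])
     (use K_sums in simp)

lemma K_cnj: "norm u < 1 \<Longrightarrow> K (cnj u) = cnj (K u)"
  using K_sums[of u, THEN sums_cnj[THEN iffD2]] K_sums[of "cnj u"] by (simp add: sums_unique2)

lemma norm_K_le:
  assumes "norm u \<le> t" "t < 1"
  shows "norm (K u) \<le> (\<Sum>n. t ^ n / moment (2 * n))"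
proof -
  have u: "norm u < 1" and t: "0 \<le> t" using assms order_trans[OF norm_ge_zero assms(1)] by auto
  have "norm (K u) \<le> (\<Sum>n. norm (u ^ n / complex_of_real (moment (2 * n))))"
    unfolding K_def by (rule summable_norm[OF summable_K[OF u]])
  also have "\<dots> \<le> (\<Sum>n. t ^ n / moment (2 * n))"
    using summable_inverse_moments[OF t assms(2)] x_pos assms
    by (intro suminf_le summable_K[OF u]) (auto simp: norm_divide norm_power less_imp_le intro!: divide_right_mono power_mono)
  finally show ?thesis .
qed

lemma norm_mult_disc: "z \<in> unit_disc \<Longrightarrow> w \<in> unit_disc \<Longrightarrow> norm (z * cnj w) < 1"
  using mult_strict_mono'[of "norm z" 1 "norm w" 1] by (simp add: norm_mult)

lemma K_section_holomorphic:
  assumes "z \<in> unit_disc" shows "(\<lambda>w. K (cnj z * w)) holomorphic_on unit_disc"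
proof -
  have "(\<lambda>w. cnj z * w) ` unit_disc \<subseteq> unit_disc"
    using norm_mult_disc[OF _ assms] by (auto simp: mult.commute)
  then have "K \<circ> (\<lambda>w. cnj z * w) holomorphic_on unit_disc"
    by (intro holomorphic_on_compose_gen[OF _ K_holomorphic] holomorphic_intros) auto
  then show ?thesis by (simp add: o_def)
qed

text \<open>Values off the disc are arbitrary, so f is compared with its restriction extended by
  0.\<close>

lemma holomorphic_measurable_disc:
  assumes "f holomorphic_on unit_disc" shows "f \<in> borel_measurable disc_measure"
proof -
  have "f \<in> borel_measurable (restrict_space borel unit_disc)"
    using assms by (intro borel_measurable_continuous_on_restrict holomorphic_on_imp_continuous_on)
  then have "(\<lambda>z. if z \<in> unit_disc then f z else 0) \<in> borel_measurable borel"
    by (subst (asm) measurable_restrict_space_iff[of _ _ 0]) auto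
  then have "(\<lambda>z. if z \<in> unit_disc then f z else 0) \<in> borel_measurable disc_measure"
    by (rule borel_measurable_disc_measure)
  then show ?thesis by (subst measurable_cong[where g="\<lambda>z. if z \<in> unit_disc then f z else 0"]) auto
qed

lemma A2_integrable:
  assumes "f \<in> Ap_space 2 v"
  shows "integrable disc_measure (\<lambda>z. f z * complex_of_real (v z))"
proof -
  have f: "f \<in> borel_measurable disc_measure" "integrable disc_measure (\<lambda>z. (norm (f z))\<^sup>2 * v z)"
    using assms by (auto simp: Ap_space_def Lp_space_def)
  show ?thesis
  proof (rule Bochner_Integration.integrable_bound)
    show "integrable disc_measure (\<lambda>z. (norm (f z))\<^sup>2 * v z + norm z ^ 0 * v z)"
      by (intro Bochner_Integration.integrable_add f integrable_moment)
    show "AE z in disc_measure. norm (f z * complex_of_real (v z)) \<le> norm ((norm (f z))\<^sup>2 * v z + norm z ^ 0 * v z)"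
    proof (rule AE_I2)
      fix z
      have "2 * norm (f z) \<le> (norm (f z))\<^sup>2 + 1"
        using zero_le_power2[of "norm (f z) - 1"] by (simp add: power2_eq_square algebra_simps)
      then have "norm (f z) \<le> (norm (f z))\<^sup>2 + 1" using norm_ge_zero[of "f z"] by linarith
      then have "norm (f z) * v z \<le> ((norm (f z))\<^sup>2 + 1) * v z" by (intro mult_right_mono) auto
      then show "norm (f z * complex_of_real (v z)) \<le> norm ((norm (f z))\<^sup>2 * v z + norm z ^ 0 * v z)"
        by (simp add: norm_mult algebra_simps)
    qed
  qed (use f in measurable)
qed

text \<open>Stated for every f integrable against v rather than for \<open>Ap_space 2 v\<close>:
  besides the reproducing property, it shows that the projection of a general f is a power series in
  z, hence holomorphic.\<close>

lemma integral_against_K: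
  assumes f: "integrable disc_measure (\<lambda>w. f w * complex_of_real (v w))" and z: "z \<in> unit_disc"
  shows "integrable disc_measure (\<lambda>w. f w * K (z * cnj w) * v w)"
    and "(\<lambda>n. (LINT w|disc_measure. f w * cnj w ^ n * v w) / moment (2 * n) * z ^ n)
            sums (LINT w|disc_measure. f w * K (z * cnj w) * v w)"
proof -
  define t where "t n w = (z ^ n / moment (2 * n)) * (f w * cnj w ^ n * v w)" for n w
  define G where "G w = norm (f w * complex_of_real (v w))" for w
  have fm: "(\<lambda>w. f w * complex_of_real (v w)) \<in> borel_measurable disc_measure" using f by auto
  have cm: "cnj \<in> borel_measurable disc_measure" by (intro borel_measurable_disc_measure) simp
  have le: "norm (f w * cnj w ^ n * v w) \<le> G w" if "w \<in> unit_disc" for w n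
    using that power_le_one[of "norm w" n] mult_left_mono[of "norm w ^ n" 1 "norm (f w) * v w"]
    by (simp add: G_def norm_mult norm_power mult_ac)
  have ti: "integrable disc_measure (\<lambda>w. f w * cnj w ^ n * v w)" for n
  proof (rule Bochner_Integration.integrable_bound[OF integrable_norm[OF f]])
    have "(\<lambda>w. (f w * complex_of_real (v w)) * cnj w ^ n) \<in> borel_measurable disc_measure"
      using fm cm by measurable
    then show "(\<lambda>w. f w * cnj w ^ n * complex_of_real (v w)) \<in> borel_measurable disc_measure" by (simp add: mult_ac)
  qed (use le in \<open>auto simp: G_def intro!: AE_I2\<close>)
  have t1: "integrable disc_measure (t n)" for n unfolding t_def by (intro integrable_mult_right ti)
  have t2: "norm (t n w) \<le> norm (z ^ n / complex_of_real (moment (2 * n))) * G w" if "w \<in> unit_disc" for n w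
    unfolding t_def norm_mult[of "_ / _"] by (intro mult_left_mono le that) simp
  have t3: "summable (\<lambda>n. norm (z ^ n / complex_of_real (moment (2 * n))))" using z by (intro summable_K) simp
  have t4: "integrable disc_measure G" unfolding G_def by (intro integrable_norm f)
  have t5: "(\<lambda>n. t n w) sums (f w * K (z * cnj w) * complex_of_real (v w))" if "w \<in> unit_disc" for w
    using sums_mult[OF K_sums[OF norm_mult_disc[OF z that]], of "f w * v w"]
    by (simp add: t_def power_mult_distrib mult_ac)
  note disc_integral_sums[OF t1 t2 t3 norm_ge_zero t4 t5]
  moreover have "(LINT w|disc_measure. t n w) = (LINT w|disc_measure. f w * cnj w ^ n * v w) / moment (2 * n) * z ^ n" for n
    unfolding t_def integral_mult_right_zero by simp
  ultimately show "integrable disc_measure (\<lambda>w. f w * K (z * cnj w) * v w)"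
    "(\<lambda>n. (LINT w|disc_measure. f w * cnj w ^ n * v w) / moment (2 * n) * z ^ n)
            sums (LINT w|disc_measure. f w * K (z * cnj w) * v w)" by simp_all
qed

lemma is_reproducing_kernel_K:
  assumes z: "z \<in> unit_disc"
  shows "is_reproducing_kernel_at v z (\<lambda>w. K (cnj z * w))"
  unfolding is_reproducing_kernel_at_def
proof (intro conjI ballI)
  have hol: "(\<lambda>w. K (cnj z * w)) holomorphic_on unit_disc" by (rule K_section_holomorphic[OF z])
  have m: "(\<lambda>w. K (cnj z * w)) \<in> borel_measurable disc_measure" by (rule holomorphic_measurable_disc[OF hol])
  define B where "B = (\<Sum>n. norm z ^ n / moment (2 * n))"
  have b: "norm (K (cnj z * w)) \<le> B" if "w \<in> unit_disc" for w
    unfolding B_def using that z by (intro norm_K_le) (auto simp: norm_mult intro!: mult_left_le)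
  have "integrable disc_measure (\<lambda>w. norm (K (cnj z * w)) powr 2 * v w)"
  proof (rule integrable_disc_bounded)
    show "norm (norm (K (cnj z * w)) powr 2 * v w) \<le> B\<^sup>2 * 1" if "w \<in> unit_disc" for w
      using mult_mono[OF power_mono[OF b[OF that] norm_ge_zero, of 2] v_le_1[OF that]] by simp
  qed (use m in measurable)
  with hol m show "(\<lambda>w. K (cnj z * w)) \<in> Ap_space 2 v" by (simp add: Ap_space_def Lp_space_def)
next
  fix f assume f: "f \<in> Ap_space 2 v"
  define c where "c n = (deriv ^^ n) f 0 / fact n" for n
  have fs: "(\<lambda>n. c n * w ^ n) sums f w" if "w \<in> unit_disc" for w
    using holomorphic_power_series[of f 0 1 w] f that by (simp add: Ap_space_def c_def)
  have int: "integrable disc_measure (\<lambda>w. f w * complex_of_real (v w))" by (rule A2_integrable[OF f])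
  have "moment (2 * n) \<noteq> 0" for n using x_pos[of "2 * n"] by simp
  moreover have "(LINT w|disc_measure. f w * cnj w ^ n * v w) = c n * moment (2 * n)" for n
    by (rule moment_coefficient[OF fs int])
  ultimately have "(\<lambda>n. c n * z ^ n) sums (LINT w|disc_measure. f w * K (z * cnj w) * v w)"
    using integral_against_K(2)[OF int z] by simp
  then have "f z = (LINT w|disc_measure. f w * K (z * cnj w) * v w)"
    using fs[OF z] sums_unique2 by blast
  also have "\<dots> = (LINT w|disc_measure. f w * cnj (K (cnj z * w)) * v w)"
    using K_cnj[of "cnj z * w" for w] norm_mult_disc[OF _ z]
    by (intro Bochner_Integration.integral_cong) (auto simp: mult.commute)
  finally show "f z = (LINT w|disc_measure. f w * cnj (K (cnj z * w)) * v w)" .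
qed

text \<open>Applying both reproducing properties to each other identifies every reproducing kernel,
  in particular the one selected by \<open>SOME\<close>.\<close>

lemma bergman_kernel_eq:
  assumes z: "z \<in> unit_disc" and w: "w \<in> unit_disc"
  shows "bergman_kernel v z w = K (z * cnj w)"
proof -
  define k where "k = reproducing_kernel v z"
  have k: "is_reproducing_kernel_at v z k"
    unfolding k_def reproducing_kernel_def by (rule someI[of "is_reproducing_kernel_at v z", OF is_reproducing_kernel_K[OF z]])
  have kw: "is_reproducing_kernel_at v w (\<lambda>u. K (cnj w * u))" by (rule is_reproducing_kernel_K[OF w])
  have "cnj (k w) = cnj (LINT u|disc_measure. k u * cnj (K (cnj w * u)) * v u)"
    using k kw by (simp add: is_reproducing_kernel_at_def)
  also have "\<dots> = (LINT u|disc_measure. cnj (k u * cnj (K (cnj w * u)) * v u))"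
    by (rule Bochner_Integration.integral_cnj[symmetric])
  also have "\<dots> = (LINT u|disc_measure. K (cnj w * u) * cnj (k u) * v u)"
    by (simp add: mult_ac)
  also have "\<dots> = K (cnj w * z)"
    using k kw by (simp add: is_reproducing_kernel_at_def)
  finally show ?thesis by (simp add: bergman_kernel_def k_def mult.commute)
qed

end

section \<open>The kernel estimate\<close>

declare id_measurable_disc_measure [measurable del]

section \<open>Integral of the reciprocal distance factor and the mean value property\<close>

lemma nn_integral_inverse_1_plus_square: "(\<integral>\<^sup>+(x::real). ennreal (1 / (1 + x\<^sup>2)) \<partial>lborel) \<le> ennreal pi"
proof -
  have half: "(\<integral>\<^sup>+(x::real). ennreal (1 / (1 + x\<^sup>2)) * indicator {0..} x \<partial>lborel) = ennreal (pi / 2)"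
    by (subst nn_integral_FTC_atLeast[where F=arctan and T="pi/2"])
       (auto intro!: derivative_eq_intros tendsto_arctan_at_top simp: inverse_eq_divide)
  have "(\<integral>\<^sup>+(x::real). ennreal (1 / (1 + x\<^sup>2)) \<partial>lborel)
      \<le> (\<integral>\<^sup>+(x::real). ennreal (1 / (1 + x\<^sup>2)) * indicator {0..} x + ennreal (1 / (1 + x\<^sup>2)) * indicator {0..} (-x) \<partial>lborel)"
    by (intro nn_integral_mono) (auto simp: indicator_def)
  also have "\<dots> = (\<integral>\<^sup>+(x::real). ennreal (1 / (1 + x\<^sup>2)) * indicator {0..} x \<partial>lborel)
      + (\<integral>\<^sup>+(x::real). ennreal (1 / (1 + x\<^sup>2)) * indicator {0..} (-x) \<partial>lborel)"
    by (intro nn_integral_add) measurable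
  also have "(\<integral>\<^sup>+(x::real). ennreal (1 / (1 + x\<^sup>2)) * indicator {0..} (-x) \<partial>lborel) = ennreal (pi / 2)"
    using nn_integral_real_affine[of "\<lambda>x::real. ennreal (1 / (1 + x\<^sup>2)) * indicator {0..} x" "-1" 0] half by simp
  also have "(\<integral>\<^sup>+(x::real). ennreal (1 / (1 + x\<^sup>2)) * indicator {0..} x \<partial>lborel) + ennreal (pi / 2) = ennreal pi"
    unfolding half by (subst ennreal_plus[symmetric]) auto
  finally show ?thesis .
qed

text \<open>For \<open>a = x^2\<close> and \<open>b = y^2\<close> the inequality
  \<open>(1 + a) * (1 + b) \<le> 2 * (1 + (a + b)^2)\<close> dominates the integrand by a product,
  which reduces the plane integral to two arctan integrals.\<close>

lemma nn_integral_inverse_1_plus_norm4: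
  "(\<integral>\<^sup>+(z::complex). ennreal (1 / (1 + norm z ^ 4)) \<partial>lborel) \<le> ennreal (2 * pi\<^sup>2)"
proof -
  define f :: "complex \<Rightarrow> real \<Rightarrow> real" where "f b x = 1 / (1 + x\<^sup>2)" for b x
  have "(\<integral>\<^sup>+(z::complex). ennreal (1 / (1 + norm z ^ 4)) \<partial>lborel)
      \<le> (\<integral>\<^sup>+(z::complex). 2 * (\<Prod>b\<in>Basis. ennreal (f b (z \<bullet> b))) \<partial>lborel)"
  proof (intro nn_integral_mono)
    fix z :: complex
    define a b where "a = (Re z)\<^sup>2" and "b = (Im z)\<^sup>2"
    have ab: "0 \<le> a" "0 \<le> b" by (auto simp: a_def b_def)
    have n: "norm z ^ 4 = (a + b)\<^sup>2"
      by (simp add: a_def b_def norm_complex_def power4_eq_xxxx power2_eq_square flip: real_sqrt_mult)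
    have "(1 + a) * (1 + b) \<le> 2 * (1 + (a + b)\<^sup>2)"
    proof -
      have "0 \<le> (a + b - 1)\<^sup>2" "0 \<le> (a - b)\<^sup>2" "0 \<le> a * b" "0 \<le> a\<^sup>2" "0 \<le> b\<^sup>2" using ab by auto
      then show ?thesis by (simp add: power2_eq_square algebra_simps)
    qed
    then have "1 / (1 + norm z ^ 4) \<le> 2 * (1 / (1 + a) * (1 / (1 + b)))"
      unfolding n using ab by (simp add: field_simps add_nonneg_pos add_pos_nonneg)
    then have "ennreal (1 / (1 + norm z ^ 4)) \<le> ennreal (2 * (1 / (1 + a) * (1 / (1 + b))))"
      by (rule ennreal_leI)
    also have "\<dots> = 2 * (\<Prod>b\<in>Basis. ennreal (f b (z \<bullet> b)))"
    proof -
      have "ennreal (2 * (A * B)) = 2 * (ennreal A * ennreal B)" if "0 \<le> A" "0 \<le> B" for A B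
        using that by (simp add: ennreal_mult)
      from this[of "1 / (1 + a)" "1 / (1 + b)"] ab show ?thesis
        by (simp only: Basis_complex_def f_def) (simp add: complex_inner_1_right complex_inner_i_right a_def b_def)
    qed
    finally show "ennreal (1 / (1 + norm z ^ 4)) \<le> 2 * (\<Prod>b\<in>Basis. ennreal (f b (z \<bullet> b)))" .
  qed
  also have "\<dots> = 2 * (\<integral>\<^sup>+(z::complex). (\<Prod>b\<in>Basis. ennreal (f b (z \<bullet> b))) \<partial>lborel)"
    unfolding f_def by (intro nn_integral_cmult) measurable
  also have "(\<integral>\<^sup>+(z::complex). (\<Prod>b\<in>Basis. ennreal (f b (z \<bullet> b))) \<partial>lborel) = (\<Prod>b\<in>Basis. \<integral>\<^sup>+x. ennreal (f b x) \<partial>lborel)"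
    by (rule nn_integral_lborel_prod) (auto simp: f_def)
  also have "2 * \<dots> \<le> 2 * (ennreal pi * ennreal pi)"
    using nn_integral_inverse_1_plus_square
    by (auto simp: Basis_complex_def f_def intro!: mult_left_mono mult_mono)
  also have "\<dots> = ennreal (2 * pi\<^sup>2)" by (simp add: power2_eq_square ennreal_mult)
  finally show ?thesis .
qed

lemma nn_integral_disc_bump:
  assumes "r > 0"
  shows "(\<integral>\<^sup>+w. ennreal (1 / (1 + norm (w - z) ^ 4 / r ^ 4)) \<partial>disc_measure) \<le> ennreal (2 * pi * r\<^sup>2)"
proof -
  define g where "g w = ennreal (1 / (1 + norm (w - z) ^ 4 / r ^ 4))" for w
  have [measurable]: "g \<in> borel_measurable borel" unfolding g_def by measurable
  have "(\<integral>\<^sup>+w. g w \<partial>disc_measure) = ennreal (1 / pi) * (\<integral>\<^sup>+w. g w * indicator unit_disc w \<partial>lborel)"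
    by (rule nn_integral_disc_measure) measurable
  also have "\<dots> \<le> ennreal (1 / pi) * (\<integral>\<^sup>+w. g w \<partial>lborel)"
    by (intro mult_left_mono nn_integral_mono) (auto simp: indicator_def)
  also have "(\<integral>\<^sup>+w. g w \<partial>lborel) = (\<integral>\<^sup>+w. g w \<partial>density (distr lborel borel (\<lambda>x. z + r *\<^sub>R x)) (\<lambda>_. ennreal (\<bar>r\<bar> ^ DIM(complex))))"
    using assms by (subst lborel_affine[of r z]) auto
  also have "\<dots> = ennreal (r\<^sup>2) * (\<integral>\<^sup>+x. g (z + r *\<^sub>R x) \<partial>lborel)"
    using assms by (simp add: nn_integral_density nn_integral_distr nn_integral_cmult)
  also have "(\<lambda>x. g (z + r *\<^sub>R x)) = (\<lambda>x. ennreal (1 / (1 + norm x ^ 4)))"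
    using assms by (simp add: g_def fun_eq_iff power_mult_distrib)
  also have "ennreal (1 / pi) * (ennreal (r\<^sup>2) * (\<integral>\<^sup>+(x::complex). ennreal (1 / (1 + norm x ^ 4)) \<partial>lborel))
      \<le> ennreal (1 / pi) * (ennreal (r\<^sup>2) * ennreal (2 * pi\<^sup>2))"
    by (intro mult_left_mono nn_integral_inverse_1_plus_norm4) auto
  also have "\<dots> = ennreal (2 * pi * r\<^sup>2)"
    by (simp add: ennreal_mult[symmetric] power2_eq_square field_simps)
  finally show ?thesis by (simp add: g_def)
qed

text \<open>Coefficient 0 of \<open>H (s + \<zeta>)\<close> in
  \<open>disc_coefficient_radial\<close> gives the mean value on a disc about 0; translation of
  Lebesgue measure moves it to s.\<close>

lemma disc_submean:
  fixes H :: "complex \<Rightarrow> complex"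
  assumes H: "H holomorphic_on ball s R'" and R: "0 < R" "R < R'" and sub: "ball s R \<subseteq> unit_disc"
  shows "ennreal (norm (H s) * R\<^sup>2) \<le> (\<integral>\<^sup>+w. ennreal (indicator (ball s R) w * norm (H w)) \<partial>disc_measure)"
proof -
  define c where "c n = (deriv ^^ n) H s / fact n" for n
  define k where "k w = ennreal (indicator (ball s R) w * norm (H w))" for w
  have "continuous_on (ball s R) (\<lambda>w. norm (H w))"
    using R by (intro continuous_on_norm holomorphic_on_imp_continuous_on holomorphic_on_subset[OF H]) auto
  then have "(\<lambda>w. indicator (ball s R) w *\<^sub>R norm (H w)) \<in> borel_measurable borel"
    by (intro borel_measurable_continuous_on_indicator) auto
  then have k [measurable]: "k \<in> borel_measurable borel" unfolding k_def by simp
  \<comment> \<open>That R is at most 1 is read off from the areas of the two discs in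
    \<open>sub\<close>.\<close>
  have sub0: "ball (0::complex) R \<subseteq> unit_disc"
  proof -
    have "ennreal (pi * R\<^sup>2) \<le> ennreal (pi * 1\<^sup>2)"
      using emeasure_mono[OF sub, of lborel] R by (simp add: emeasure_ball unit_ball_vol_2)
    then have "R\<^sup>2 \<le> 1" by (subst (asm) ennreal_le_iff) auto
    then have "R \<le> 1" using R by (simp add: power2_le_iff_abs_le abs_square_le_1)
    then show ?thesis by auto
  qed
  define f where "f \<zeta> = H (s + \<zeta>) * cnj \<zeta> ^ 0 * complex_of_real (indicator {..<R} (norm \<zeta>))" for \<zeta>
  have "(LINT \<zeta>|disc_measure. f \<zeta>) = c 0 * complex_of_real (LINT \<zeta>|disc_measure. norm \<zeta> ^ (2 * 0) * indicator {..<R} (norm \<zeta>))"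
    unfolding f_def
  proof (rule disc_coefficient_radial[of R R'])
    show "(\<lambda>n. c n * \<zeta> ^ n) sums H (s + \<zeta>)" if "\<zeta> \<in> ball 0 R'" for \<zeta>
      using holomorphic_power_series[OF H, of "s + \<zeta>"] that by (simp add: c_def dist_norm)
  qed (use R in \<open>auto simp: indicator_def\<close>)
  also have "c 0 = H s" by (simp add: c_def)
  also have "(LINT \<zeta>|disc_measure. norm \<zeta> ^ (2 * 0) * indicator {..<R} (norm \<zeta>)) = R\<^sup>2"
  proof -
    have "(LINT \<zeta>|disc_measure. norm \<zeta> ^ (2 * 0) * indicator {..<R} (norm \<zeta>)) = (LINT \<zeta>|disc_measure. indicator (ball 0 R) \<zeta>)"
      by (intro Bochner_Integration.integral_cong) (auto simp: indicator_def)
    also have "\<dots> = measure disc_measure (ball 0 R \<inter> space disc_measure)" by simp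
    also have "ball 0 R \<inter> space disc_measure = ball 0 R" using sub0 by auto
    finally show ?thesis using emeasure_disc_measure_ball[OF sub0] R by (simp add: measure_def)
  qed
  finally have eq: "(LINT \<zeta>|disc_measure. f \<zeta>) = H s * complex_of_real (R\<^sup>2)" .
  have "ennreal (norm (H s) * R\<^sup>2) = ennreal (norm (LINT \<zeta>|disc_measure. f \<zeta>))"
    unfolding eq norm_mult norm_of_real by simp
  also have "\<dots> \<le> (\<integral>\<^sup>+\<zeta>. ennreal (norm (f \<zeta>)) \<partial>disc_measure)"
    by (cases "integrable disc_measure f") (auto intro: integral_norm_bound_ennreal simp: not_integrable_integral_eq)
  also have "\<dots> = (\<integral>\<^sup>+\<zeta>. k (s + \<zeta>) \<partial>disc_measure)"
    by (intro nn_integral_cong) (auto simp: f_def k_def norm_mult indicator_def dist_norm)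
  also have "\<dots> = ennreal (1 / pi) * (\<integral>\<^sup>+\<zeta>. k (s + \<zeta>) * indicator unit_disc \<zeta> \<partial>lborel)"
    by (rule nn_integral_disc_measure) measurable
  also have "\<dots> \<le> ennreal (1 / pi) * (\<integral>\<^sup>+\<zeta>. k (s + \<zeta>) \<partial>lborel)"
    by (intro mult_left_mono nn_integral_mono) (auto simp: indicator_def)
  also have "(\<integral>\<^sup>+\<zeta>. k (s + \<zeta>) \<partial>lborel) = (\<integral>\<^sup>+w. k w \<partial>distr lborel borel ((+) s))"
    by (subst nn_integral_distr) auto
  also have "\<dots> = (\<integral>\<^sup>+w. k w * indicator unit_disc w \<partial>lborel)"
    unfolding lborel_distr_plus using sub by (intro nn_integral_cong) (auto simp: k_def indicator_def)
  also have "ennreal (1 / pi) * \<dots> = (\<integral>\<^sup>+w. k w \<partial>disc_measure)"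
    by (rule nn_integral_disc_measure[symmetric]) measurable
  finally show ?thesis by (simp add: k_def)
qed

text \<open>Near \<open>s\<close>, at distances of order \<open>(1 - s) powr (3/2)\<close>, the weight is comparable to the
  modulus of the holomorphic function \<open>exp (- \<alpha> / (1 - w))\<close>.\<close>

lemma inverse_one_minus_norm_le:
  assumes s: "1/2 \<le> s" "s < 1" and w: "norm (w - complex_of_real s) < R" and R: "R\<^sup>2 \<le> (1 - s) ^ 3 / 64"
  shows "norm w < 1" "1 / (1 - norm w) \<le> Re (1 / (1 - w)) + 1"
proof -
  define \<delta> x y where "\<delta> = 1 - s" and "x = 1 - Re w" and "y = Im w"
  have \<delta>: "0 < \<delta>" "\<delta> \<le> 1/2" using s by (auto simp: \<delta>_def)
  have w2: "(Re w - s)\<^sup>2 + y\<^sup>2 < R\<^sup>2"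
  proof -
    have "(norm (w - complex_of_real s))\<^sup>2 < R\<^sup>2" using w by (intro power_strict_mono) auto
    then show ?thesis by (simp add: cmod_power2 y_def)
  qed
  have d3: "\<delta> ^ 3 \<le> \<delta>\<^sup>2" using \<delta> by (intro power_decreasing) auto
  have y2: "y\<^sup>2 \<le> \<delta> ^ 3 / 64" using w2 R zero_le_power2[of "Re w - s"] unfolding \<delta>_def by linarith
  have "(\<delta> / 8)\<^sup>2 = \<delta>\<^sup>2 / 64" by (simp add: power_divide)
  then have "(Re w - s)\<^sup>2 \<le> (\<delta> / 8)\<^sup>2"
    using w2 R zero_le_power2[of y] d3 unfolding \<delta>_def by linarith
  then have "\<bar>Re w - s\<bar> \<le> \<delta> / 8" using \<delta> by (simp add: abs_le_square_iff[symmetric])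
  then have "Re w - s \<le> \<delta> / 8 \<and> - (Re w - s) \<le> \<delta> / 8" by (simp only: abs_le_iff)
  moreover have "x = \<delta> - (Re w - s)" by (simp add: x_def \<delta>_def)
  ultimately have x: "7/8 * \<delta> \<le> x" "x \<le> 9/8 * \<delta>" by simp_all
  have x0: "x > 0" "1 - x \<ge> 1/4" using x \<delta> by auto
  have y2': "2 * y\<^sup>2 \<le> \<delta> / 8"
  proof -
    have "\<delta>\<^sup>2 \<le> \<delta> * 1" unfolding power2_eq_square using \<delta> by (intro mult_left_mono) auto
    then show ?thesis using y2 d3 \<delta> by linarith
  qed
  \<comment> \<open>Since \<open>4 * (1 - x) \<ge> 1\<close>, the summand \<open>y^2\<close> fits
    into the cross term of the square of \<open>1 - x + 2 * y^2\<close>.\<close>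
  have nw: "norm w \<le> 1 - x + 2 * y\<^sup>2"
  proof -
    have "(norm w)\<^sup>2 = (1 - x)\<^sup>2 + y\<^sup>2" by (simp add: cmod_power2 x_def y_def)
    also have "\<dots> \<le> (1 - x)\<^sup>2 + 4 * (1 - x) * y\<^sup>2"
      using mult_right_mono[of 1 "4 * (1 - x)" "y\<^sup>2"] x0 by simp
    also have "\<dots> \<le> (1 - x + 2 * y\<^sup>2)\<^sup>2"
      using zero_le_power2[of "2 * y\<^sup>2"] by (simp add: power2_eq_square algebra_simps)
    finally show ?thesis by (rule power2_le_imp_le) (use x0 zero_le_power2[of y] in linarith)
  qed
  have xy: "x - 2 * y\<^sup>2 \<ge> \<delta> / 2" using x y2' \<delta> by linarith
  then show "norm w < 1" using nw \<delta> by linarith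
  have "1 / (1 - norm w) \<le> 1 / (x - 2 * y\<^sup>2)"
    using nw xy \<delta> by (intro divide_left_mono mult_pos_pos) auto
  also have "\<dots> = 1 / x + 2 * y\<^sup>2 / (x * (x - 2 * y\<^sup>2))"
    using x0 xy \<delta> by (simp add: divide_simps)
  also have "2 * y\<^sup>2 / (x * (x - 2 * y\<^sup>2)) \<le> (\<delta> ^ 3 / 32) / (\<delta> / 2 * (\<delta> / 2))"
    using y2 x xy \<delta> by (intro frac_le mult_mono) auto
  also have "\<dots> \<le> 1 / 2" using \<delta> by (simp add: field_simps power3_eq_cube)
  finally have 1: "1 / (1 - norm w) \<le> 1 / x + 1 / 2" by simp
  have "Re (1 / (1 - w)) = x / (x\<^sup>2 + y\<^sup>2)"
    by (simp add: Re_divide x_def y_def)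
  \<comment> \<open>The critical estimate: this error is of order \<open>y^2 / \<delta>^3\<close>,
    which is what limits R to a multiple of \<open>\<delta>^(3/2)\<close>.\<close>
  moreover have "1 / x - x / (x\<^sup>2 + y\<^sup>2) \<le> 1 / 2"
  proof -
    have "1 / x - x / (x\<^sup>2 + y\<^sup>2) = y\<^sup>2 / (x * (x\<^sup>2 + y\<^sup>2))"
      using x0 by (simp add: field_simps power2_eq_square add_pos_nonneg)
    also have "\<dots> \<le> (\<delta> ^ 3 / 64) / (\<delta> / 2 * (\<delta> / 2)\<^sup>2)"
    proof -
      have "(\<delta> / 2)\<^sup>2 \<le> x\<^sup>2" using x \<delta> by (intro power_mono) auto
      then have "(\<delta> / 2)\<^sup>2 \<le> x\<^sup>2 + y\<^sup>2" using zero_le_power2[of y] by linarith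
      then show ?thesis using y2 x \<delta> by (intro frac_le mult_mono) auto
    qed
    also have "\<dots> \<le> 1 / 2" using \<delta> by (simp add: field_simps power2_eq_square power3_eq_cube)
    finally show ?thesis .
  qed
  ultimately show "1 / (1 - norm w) \<le> Re (1 / (1 - w)) + 1" using 1 by linarith
qed

context disc_weight
begin

text \<open>The truncated kernel section \<open>f\<close> has value S at s and squared norm S. The
  mean value property for \<open>f^2\<close>, multiplied by a holomorphic substitute for v, bounds
  \<open>S^2 * R^2\<close> by a multiple of S, and cancelling S leaves the claim.\<close>

lemma sum_\<beta>_le:
  obtains C where "C > 0" "\<And>s. 0 \<le> s \<Longrightarrow> s < 1 \<Longrightarrow> (\<Sum>n. \<beta> s n) \<le> C / (1 - s) ^ 3 * exp (\<alpha> / (1 - s))"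
proof -
  have large: "(\<Sum>n. \<beta> s n) \<le> 64 * exp \<alpha> / (1 - s) ^ 3 * exp (\<alpha> / (1 - s))" if s: "1/2 \<le> s" "s < 1" for s
  proof (rule suminf_le_const[OF summable_\<beta>])
    fix N
    define S where "S = (\<Sum>n<N. \<beta> s n)"
    define R where "R = sqrt ((1 - s) ^ 3 / 64)"
    define c where "c n = complex_of_real (s ^ n / moment (2 * n))" for n
    define f where "f w = (\<Sum>n<N. c n * w ^ n)" for w
    \<comment> \<open>The exponential factor is normalized to be 1 at s, so that
      \<open>H s = S^2\<close>.\<close>
    define H where "H w = (f w)\<^sup>2 * exp (of_real \<alpha> / (1 - of_real s) - of_real \<alpha> / (1 - w))" for w
    have R0: "0 < R" using s by (simp add: R_def)
    have R2: "R\<^sup>2 = (1 - s) ^ 3 / 64" using s by (simp add: R_def)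
    have S0: "0 \<le> S" unfolding S_def using s by (intro sum_nonneg \<beta>_nonneg) auto
    have sub: "ball (of_real s) R \<subseteq> unit_disc"
      using inverse_one_minus_norm_le(1)[OF s, of _ R] R2 by (auto simp: dist_norm norm_minus_commute)
    have "R\<^sup>2 < (1 - s)\<^sup>2"
    proof -
      have "(1 - s) ^ 3 \<le> (1 - s)\<^sup>2" using s by (intro power_decreasing) auto
      moreover have "(1 - s)\<^sup>2 > 0" using s by simp
      ultimately show ?thesis unfolding R2 by linarith
    qed
    then have R1: "R < 1 - s" by (rule power2_less_imp_less) (use s in auto)
    have ne: "w \<noteq> 1" if "w \<in> ball (complex_of_real s) (1 - s)" for w
      using that s norm_of_real[of "s - 1", where 'a = complex] by (auto simp: dist_norm)
    have hol: "H holomorphic_on ball (of_real s) (1 - s)"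
      unfolding H_def f_def using ne by (intro holomorphic_intros) auto
    have fs: "f (of_real s) = of_real S"
      by (simp add: f_def c_def S_def \<beta>_def power_add mult_2)
    have "norm (H (of_real s)) * R\<^sup>2 = S\<^sup>2 * R\<^sup>2"
      by (simp add: H_def fs norm_power)
    then have "ennreal (S\<^sup>2 * R\<^sup>2) \<le> (\<integral>\<^sup>+w. ennreal (indicator (ball (of_real s) R) w * norm (H w)) \<partial>disc_measure)"
      using disc_submean[OF hol R0 R1 sub] by (simp only:)
    also have "\<dots> \<le> (\<integral>\<^sup>+w. ennreal (exp \<alpha> * exp (\<alpha> / (1 - s)) * ((norm (f w))\<^sup>2 * v w)) \<partial>disc_measure)"
    proof (intro nn_integral_mono ennreal_leI)
      fix w assume "w \<in> space disc_measure"
      show "indicator (ball (of_real s) R) w * norm (H w) \<le> exp \<alpha> * exp (\<alpha> / (1 - s)) * ((norm (f w))\<^sup>2 * v w)"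
      proof (cases "w \<in> ball (of_real s) R")
        case True
        then have "1 / (1 - norm w) \<le> Re (1 / (1 - w)) + 1"
          using inverse_one_minus_norm_le(2)[OF s, of w R] R2 by (simp add: dist_norm norm_minus_commute)
        then have "\<alpha> * (1 / (1 - norm w)) \<le> \<alpha> * (Re (1 / (1 - w)) + 1)"
          using \<alpha> by (intro mult_left_mono) auto
        then have "\<alpha> / (1 - s) - \<alpha> * Re (1 / (1 - w)) \<le> \<alpha> + \<alpha> / (1 - s) - \<alpha> / (1 - norm w)"
          by (simp add: algebra_simps)
        moreover have "Re (of_real \<alpha> / (1 - of_real s) - of_real \<alpha> / (1 - w)) = \<alpha> / (1 - s) - \<alpha> * Re (1 / (1 - w))"
        proof -
          have "of_real \<alpha> / (1 - of_real s) = complex_of_real (\<alpha> / (1 - s))" by simp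
          moreover have "of_real \<alpha> / (1 - w) = of_real \<alpha> * (1 / (1 - w))" by simp
          ultimately show ?thesis by (simp only: minus_complex.sel Re_complex_of_real times_complex.sel Im_complex_of_real)
        qed
        ultimately have "norm (exp (of_real \<alpha> / (1 - of_real s) - of_real \<alpha> / (1 - w)))
            \<le> exp (\<alpha> + \<alpha> / (1 - s) - \<alpha> / (1 - norm w))"
          unfolding norm_exp_eq_Re by simp
        also have "\<dots> = exp \<alpha> * exp (\<alpha> / (1 - s)) * v w"
          by (simp add: exp_weight_def exp_add exp_diff exp_minus divide_inverse)
        finally have "(norm (f w))\<^sup>2 * norm (exp (of_real \<alpha> / (1 - of_real s) - of_real \<alpha> / (1 - w)))
            \<le> (norm (f w))\<^sup>2 * (exp \<alpha> * exp (\<alpha> / (1 - s)) * v w)"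
          by (intro mult_left_mono) auto
        then show ?thesis using True by (simp add: H_def norm_mult norm_power mult_ac)
      qed simp
    qed
    also have "\<dots> = ennreal (exp \<alpha> * exp (\<alpha> / (1 - s))) * (\<integral>\<^sup>+w. ennreal ((norm (f w))\<^sup>2 * v w) \<partial>disc_measure)"
      unfolding f_def
      by (subst nn_integral_cmult[symmetric]) (auto intro!: borel_measurable_disc_measure simp: ennreal_mult[symmetric])
    also have "(\<integral>\<^sup>+w. ennreal ((norm (f w))\<^sup>2 * v w) \<partial>disc_measure) = ennreal S"
    proof -
      have "(\<Sum>n<N. (norm (c n))\<^sup>2 * moment (2 * n)) = S"
        unfolding S_def
      proof (intro sum.cong refl)
        fix n
        show "(norm (c n))\<^sup>2 * moment (2 * n) = \<beta> s n"
          using s x_pos[of "2*n"] unfolding c_def norm_of_real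
          by (simp add: \<beta>_def power_divide power2_eq_square power_mult power_mult_distrib)
      qed
      then show ?thesis
        unfolding f_def using parseval_finite[of c N] by (subst nn_integral_eq_integral) auto
    qed
    also have "ennreal (exp \<alpha> * exp (\<alpha> / (1 - s))) * ennreal S = ennreal (exp \<alpha> * exp (\<alpha> / (1 - s)) * S)"
      using S0 by (simp add: ennreal_mult)
    finally have "S\<^sup>2 * R\<^sup>2 \<le> exp \<alpha> * exp (\<alpha> / (1 - s)) * S"
      using S0 by (subst (asm) ennreal_le_iff) auto
    then have "S * (S * R\<^sup>2) \<le> S * (exp \<alpha> * exp (\<alpha> / (1 - s)))" by (simp add: power2_eq_square mult_ac)
    then have "S * R\<^sup>2 \<le> exp \<alpha> * exp (\<alpha> / (1 - s))"
      using S0 by (cases "S = 0") auto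
    then show "(\<Sum>n<N. \<beta> s n) \<le> 64 * exp \<alpha> / (1 - s) ^ 3 * exp (\<alpha> / (1 - s))"
      using s unfolding R2 S_def[symmetric] by (simp add: field_simps)
  qed (use s in auto)
  \<comment> \<open>The 64 is from \<open>R^2\<close> and \<open>exp \<alpha>\<close> from the
    summand 1 in \<open>inverse_one_minus_norm_le\<close>; the series at 1/2 covers all smaller s by
    monotonicity.\<close>
  define C where "C = 64 * exp \<alpha> + (\<Sum>n. \<beta> (1/2) n)"
  have Z0: "(\<Sum>n. \<beta> (1/2) n) \<ge> 0" by (intro suminf_nonneg summable_\<beta> \<beta>_nonneg) auto
  then have C: "C > 0" "C \<ge> 64 * exp \<alpha>" "C \<ge> (\<Sum>n. \<beta> (1/2) n)" by (auto simp: C_def add_pos_nonneg)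
  have "(\<Sum>n. \<beta> s n) \<le> C / (1 - s) ^ 3 * exp (\<alpha> / (1 - s))" if s: "0 \<le> s" "s < 1" for s
  proof (cases "1/2 \<le> s")
    case True
    have "64 * exp \<alpha> / (1 - s) ^ 3 * exp (\<alpha> / (1 - s)) \<le> C / (1 - s) ^ 3 * exp (\<alpha> / (1 - s))"
      using s C by (intro mult_right_mono divide_right_mono) auto
    with large[OF True s(2)] show ?thesis by linarith
  next
    case False
    have "(\<Sum>n. \<beta> s n) \<le> (\<Sum>n. \<beta> (1/2) n)"
      using False s by (intro suminf_le \<beta>_mono summable_\<beta>) auto
    also have "\<dots> \<le> C" by (rule C)
    also have "C / 1 * 1 \<le> C / (1 - s) ^ 3 * exp (\<alpha> / (1 - s))"
      using s C \<alpha> by (intro mult_mono divide_left_mono power_le_one) auto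
    finally show ?thesis by simp
  qed
  with C(1) show ?thesis using that by blast
qed

section \<open>Off-diagonal decay of the kernel\<close>

lemma sums_times_linear:
  fixes c :: "nat \<Rightarrow> complex"
  assumes "(\<lambda>n. c n * w ^ n) sums S"
  shows "(\<lambda>n. ((case n of 0 \<Rightarrow> 0 | Suc m \<Rightarrow> c m) - z * c n) * w ^ n) sums ((w - z) * S)"
proof -
  have "(\<lambda>m. (case Suc m of 0 \<Rightarrow> 0 | Suc m \<Rightarrow> c m) * w ^ Suc m) sums (w * S)"
    using sums_mult[OF assms, of w] by (simp add: mult_ac)
  then have "(\<lambda>n. (case n of 0 \<Rightarrow> 0 | Suc m \<Rightarrow> c m) * w ^ n) sums (w * S)"
    by (subst (asm) sums_Suc_iff) simp
  from sums_diff[OF this sums_mult[OF assms, of z]] show ?thesis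
    by (simp add: algebra_simps)
qed

text \<open>Since \<open>c (n - 1) = c n * p n / cnj z\<close>, a shift of the coefficients becomes
  multiplication by \<open>p n\<close>. At n = 0 the truncated subtraction in
  \<open>g (n - 1)\<close> is harmless because \<open>p 0 = 0\<close>.\<close>

lemma coefficient_step:
  fixes g :: "nat \<Rightarrow> real"
  assumes z: "z \<noteq> 0"
  defines "c \<equiv> \<lambda>n. cnj z ^ n / complex_of_real (moment (2 * n))"
  shows "(case n of 0 \<Rightarrow> 0 | Suc m \<Rightarrow> c m * complex_of_real (g m)) - z * (c n * complex_of_real (g n))
     = c n / cnj z * complex_of_real (p n * g (n - 1) - (norm z)\<^sup>2 * g n)"
proof -
  have zz: "z * cnj z = complex_of_real ((norm z)\<^sup>2)" by (simp add: complex_norm_square del: of_real_power)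
  have a: "z * (c n * complex_of_real (g n)) = c n / cnj z * complex_of_real ((norm z)\<^sup>2 * g n)"
    unfolding of_real_mult zz[symmetric] using z by (simp add: field_simps)
  show ?thesis
  proof (cases n)
    case 0
    then show ?thesis using a by (simp del: of_real_power)
  next
    case (Suc m)
    have "c m = c n / cnj z * complex_of_real (p n)"
      using z x_pos[of "2 * m"] x_pos[of "2 * Suc m"] by (simp add: c_def Suc p_Suc)
    then have "(case n of 0 \<Rightarrow> 0 | Suc m \<Rightarrow> c m * complex_of_real (g m)) = c n / cnj z * complex_of_real (p n * g (n - 1))"
      by (simp add: Suc)
    then show ?thesis unfolding a of_real_diff right_diff_distrib by (rule arg_cong2[where f="(-)"]) simp
  qed
qed

lemma norm_coefficient_sq:
  assumes "s = norm z"
  shows "(norm (cnj z ^ n / complex_of_real (moment (2 * n)) * complex_of_real r))\<^sup>2 * moment (2 * n) = \<beta> s n * r\<^sup>2"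
proof -
  have "norm (cnj z ^ n / complex_of_real (moment (2 * n)) * complex_of_real r) = s ^ n / moment (2 * n) * \<bar>r\<bar>"
    using x_pos[of "2*n"] assms by (simp add: norm_mult norm_divide norm_power)
  then show ?thesis
    using x_pos[of "2*n"] by (simp add: \<beta>_def power_mult_distrib power_divide power2_eq_square mult_2 power_add)
qed

lemma K_section_sums:
  assumes "z \<in> unit_disc" "w \<in> unit_disc"
  shows "(\<lambda>n. cnj z ^ n / complex_of_real (moment (2 * n)) * w ^ n) sums K (cnj z * w)"
  using K_sums[of "cnj z * w"] norm_mult_disc[OF assms(2,1)] by (simp add: power_mult_distrib mult.commute)

lemma nn_integral_K_sq_le:
  assumes z: "z \<in> unit_disc"
  shows "(\<integral>\<^sup>+w. ennreal ((norm (K (cnj z * w)))\<^sup>2 * v w) \<partial>disc_measure) \<le> ennreal (\<Sum>n. \<beta> (norm z) n)"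
proof -
  have eq: "(norm (cnj z ^ n / complex_of_real (moment (2 * n))))\<^sup>2 * moment (2 * n) = \<beta> (norm z) n" for n
    using norm_coefficient_sq[OF refl, where z=z and n=n and r=1] by simp
  show ?thesis
    using parseval_le[OF K_section_sums[OF z], unfolded eq] summable_\<beta>[of "norm z"] z by simp
qed

text \<open>Multiplication by \<open>w - z\<close> acts on the Taylor coefficients of the kernel section like
  multiplication by \<open>p n - |z|\<^sup>2\<close>, up to commutator terms.\<close>

lemma nn_integral_K_sq_dist4_le:
  assumes z: "z \<in> unit_disc" "z \<noteq> 0"
  defines "s \<equiv> norm z"
  shows "(\<integral>\<^sup>+w. ennreal (norm (w - z) ^ 4 * (norm (K (cnj z * w)))\<^sup>2 * v w) \<partial>disc_measure)
    \<le> ennreal (2 / s ^ 4 * ((\<Sum>n. \<beta> s n * (p n - s\<^sup>2) ^ 4) + (\<Sum>n. \<beta> s n * (d n)\<^sup>2)))"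
proof -
  have s: "0 < s" "s < 1" "s\<^sup>2 \<le> 1" using z by (auto simp: s_def power_le_one)
  define c where "c n = cnj z ^ n / complex_of_real (moment (2 * n))" for n
  \<comment> \<open>The outcome of two applications of \<open>coefficient_step\<close>. It equals
    \<open>(p n - s^2)^2 - p n * (p n - p (n - 1))\<close>, the second product being the commutator
    of shift and multiplication.\<close>
  define q where "q n = p n * (p (n - 1) - s\<^sup>2) - s\<^sup>2 * (p n - s\<^sup>2)" for n
  define F where "F w = (w - z) * ((w - z) * K (cnj z * w))" for w
  define c2 where "c2 n = c n / (cnj z)\<^sup>2 * complex_of_real (q n)" for n
  have sums1: "(\<lambda>n. (c n / cnj z * complex_of_real (p n - s\<^sup>2)) * w ^ n) sums ((w - z) * K (cnj z * w))"
    if "w \<in> unit_disc" for w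
  proof -
    have "(case n of 0 \<Rightarrow> 0 | Suc m \<Rightarrow> c m) - z * c n = c n / cnj z * complex_of_real (p n - s\<^sup>2)" for n
      using coefficient_step[OF z(2), where n=n and g="\<lambda>_. 1"]
      unfolding c_def s_def of_real_1 mult_1_right .
    then show ?thesis
      using sums_times_linear[OF K_section_sums[OF z(1) that, folded c_def], of z] by simp
  qed
  have sums2: "(\<lambda>n. c2 n * w ^ n) sums F w" if w: "w \<in> unit_disc" for w
  proof -
    have "(case n of 0 \<Rightarrow> 0 | Suc m \<Rightarrow> c m / cnj z * complex_of_real (p m - s\<^sup>2)) - z * (c n / cnj z * complex_of_real (p n - s\<^sup>2)) = c2 n" for n
    proof -
      have "(case n of 0 \<Rightarrow> 0 | Suc m \<Rightarrow> c m / cnj z * complex_of_real (p m - s\<^sup>2)) - z * (c n / cnj z * complex_of_real (p n - s\<^sup>2))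
          = ((case n of 0 \<Rightarrow> 0 | Suc m \<Rightarrow> c m * complex_of_real (p m - s\<^sup>2)) - z * (c n * complex_of_real (p n - s\<^sup>2))) / cnj z"
        by (simp add: diff_divide_distrib split: nat.split)
      also have "\<dots> = c n / cnj z * complex_of_real (p n * (p (n - 1) - s\<^sup>2) - s\<^sup>2 * (p n - s\<^sup>2)) / cnj z"
        using coefficient_step[OF z(2), where n=n and g="\<lambda>n. p n - s\<^sup>2"] unfolding c_def s_def by simp
      also have "\<dots> = c2 n" by (simp add: c2_def q_def power2_eq_square)
      finally show ?thesis .
    qed
    then show ?thesis using sums_times_linear[OF sums1[OF w], of z] unfolding F_def by simp
  qed
  have nc: "(norm (c2 n))\<^sup>2 * moment (2 * n) = \<beta> s n * (q n)\<^sup>2 / s ^ 4" for n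
  proof -
    have "norm (c2 n) = norm (c n * complex_of_real (q n)) / s\<^sup>2"
      by (simp add: c2_def norm_mult norm_divide norm_power s_def)
    then have "(norm (c2 n))\<^sup>2 * moment (2 * n) = (norm (c n * complex_of_real (q n)))\<^sup>2 * moment (2 * n) / s ^ 4"
      by (simp add: power_divide flip: power_mult)
    then show ?thesis using norm_coefficient_sq[OF s_def[THEN meta_eq_to_obj_eq], where n=n and r="q n"] by (simp add: c_def)
  qed
  note sm = summable_\<beta>_mult[OF less_imp_le[OF s(1)] s(2)]
  have p1: "\<bar>p n - s\<^sup>2\<bar> \<le> 1" for n
    using p_nonneg[of n] p_le_1[of n] s zero_le_power2[of s] unfolding abs_le_iff by linarith
  have smy: "summable (\<lambda>n. \<beta> s n * (p n - s\<^sup>2) ^ 4)"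
    by (rule sm[of _ 1]) (use power_le_one[OF abs_ge_zero p1, of _ 4] in simp)
  have smd: "summable (\<lambda>n. \<beta> s n * (d n)\<^sup>2)"
    by (rule sm[of _ 1]) (use d_nonneg d_le_1 in \<open>simp add: power_le_one\<close>)
  \<comment> \<open>The commutator part. One factor \<open>p n\<close> is merged with
    \<open>\<beta> s n\<close> to lower the index of the weight, which then matches the increment
    \<open>d (n - 1)\<close>.\<close>
  define e where "e n = \<beta> s n * (p n * (p n - p (n - 1)))\<^sup>2" for n
  have e_Suc: "0 \<le> e (Suc n)" "e (Suc n) \<le> \<beta> s n * (d n)\<^sup>2" for n
  proof -
    have "e (Suc n) = (\<beta> s (Suc n) * p (Suc n)) * (p (Suc n) * (d n)\<^sup>2)"
      by (simp add: e_def d_def power2_eq_square mult_ac)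
    also have "\<dots> = \<beta> s n * (d n)\<^sup>2 * (s\<^sup>2 * p (Suc n))"
      unfolding \<beta>_Suc_p by (simp add: mult_ac)
    also have "\<dots> \<le> \<beta> s n * (d n)\<^sup>2 * (1 * 1)"
      using s p_le_1[of "Suc n"] p_nonneg[of "Suc n"] \<beta>_nonneg[of s n] by (intro mult_left_mono mult_mono) auto
    finally show "e (Suc n) \<le> \<beta> s n * (d n)\<^sup>2" by simp
    show "0 \<le> e (Suc n)" using s \<beta>_nonneg[of s "Suc n"] by (simp add: e_def)
  qed
  have sme': "summable (\<lambda>n. e (Suc n))"
    by (rule summable_comparison_test'[OF smd]) (use e_Suc in auto)
  then have sme: "summable e" by (simp add: summable_Suc_iff)
  have e_0: "e 0 = 0" by (simp add: e_def)
  have "(\<Sum>n. e n) = (\<Sum>n. e (Suc n))"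
    using suminf_split_head[OF sme] e_0 by simp
  also have "\<dots> \<le> (\<Sum>n. \<beta> s n * (d n)\<^sup>2)"
    by (intro suminf_le e_Suc sme' smd)
  finally have e_le: "(\<Sum>n. e n) \<le> (\<Sum>n. \<beta> s n * (d n)\<^sup>2)" .
  have q_le: "\<beta> s n * (q n)\<^sup>2 / s ^ 4 \<le> 2 / s ^ 4 * (\<beta> s n * (p n - s\<^sup>2) ^ 4 + e n)" for n
  proof -
    define a b where "a = (p n - s\<^sup>2)\<^sup>2" and "b = p n * (p n - p (n - 1))"
    have "q n = a - b" by (simp add: q_def a_def b_def power2_eq_square algebra_simps)
    moreover have "(a - b)\<^sup>2 \<le> 2 * (a\<^sup>2 + b\<^sup>2)"
      using zero_le_power2[of "a + b"] by (simp add: power2_eq_square algebra_simps)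
    ultimately have "\<beta> s n * (q n)\<^sup>2 / s ^ 4 \<le> \<beta> s n * (2 * (a\<^sup>2 + b\<^sup>2)) / s ^ 4"
      using s \<beta>_nonneg[of s n] by (intro divide_right_mono mult_left_mono) auto
    also have "\<dots> = 2 / s ^ 4 * (\<beta> s n * a\<^sup>2 + \<beta> s n * b\<^sup>2)"
      using s by (simp add: field_simps)
    also have "a\<^sup>2 = (p n - s\<^sup>2) ^ 4" by (simp add: a_def flip: power_mult)
    finally show ?thesis by (simp add: e_def b_def)
  qed
  have sm2: "summable (\<lambda>n. 2 / s ^ 4 * (\<beta> s n * (p n - s\<^sup>2) ^ 4 + e n))"
    by (intro summable_mult summable_add smy sme)
  have smq: "summable (\<lambda>n. \<beta> s n * (q n)\<^sup>2 / s ^ 4)"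
    by (rule summable_comparison_test'[OF sm2]) (use q_le s \<beta>_nonneg[of s] in \<open>simp add: abs_of_nonneg\<close>)
  have "(\<Sum>n. \<beta> s n * (q n)\<^sup>2 / s ^ 4) \<le> (\<Sum>n. 2 / s ^ 4 * (\<beta> s n * (p n - s\<^sup>2) ^ 4 + e n))"
    by (intro suminf_le q_le smq sm2)
  also have "\<dots> = 2 / s ^ 4 * ((\<Sum>n. \<beta> s n * (p n - s\<^sup>2) ^ 4) + (\<Sum>n. e n))"
    using suminf_mult[OF summable_add[OF smy sme], of "2 / s ^ 4"] suminf_add[OF smy sme] by simp
  also have "\<dots> \<le> 2 / s ^ 4 * ((\<Sum>n. \<beta> s n * (p n - s\<^sup>2) ^ 4) + (\<Sum>n. \<beta> s n * (d n)\<^sup>2))"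
    using e_le s by (intro mult_left_mono add_left_mono) auto
  finally have le: "(\<Sum>n. \<beta> s n * (q n)\<^sup>2 / s ^ 4) \<le> \<dots>" .
  have "(\<integral>\<^sup>+w. ennreal ((norm (F w))\<^sup>2 * v w) \<partial>disc_measure) \<le> ennreal (\<Sum>n. \<beta> s n * (q n)\<^sup>2 / s ^ 4)"
    using parseval_le[OF sums2, unfolded nc] smq by simp
  also have "\<dots> \<le> ennreal (2 / s ^ 4 * ((\<Sum>n. \<beta> s n * (p n - s\<^sup>2) ^ 4) + (\<Sum>n. \<beta> s n * (d n)\<^sup>2)))"
    by (rule ennreal_leI[OF le])
  finally show ?thesis
    by (simp add: F_def norm_mult power_mult_distrib mult_ac flip: power_mult power_add)
qed

lemma norm_K_swap:
  assumes "z \<in> unit_disc" "w \<in> unit_disc"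
  shows "norm (K (w * cnj z)) = norm (K (z * cnj w))"
  using K_cnj[OF norm_mult_disc[OF assms]] by (simp add: mult.commute)

lemma nn_integral_K_sq_weighted_le:
  obtains C where "C > 0" "\<And>z. z \<in> unit_disc \<Longrightarrow>
    (\<integral>\<^sup>+w. ennreal ((1 + norm (w - z) ^ 4 / (1 - norm z) ^ 6) * ((norm (K (cnj z * w)))\<^sup>2 * v w)) \<partial>disc_measure)
      \<le> ennreal (C / ((1 - norm z) ^ 3 * v z))"
proof -
  obtain A where A: "A > 0" "\<And>s. 0 \<le> s \<Longrightarrow> s < 1 \<Longrightarrow>
       (\<Sum>n. \<beta> s n * (p n - s\<^sup>2) ^ 4) + (\<Sum>n. \<beta> s n * (d n)\<^sup>2) \<le> A * ((1 - s\<^sup>2) ^ 6 * (\<Sum>n. \<beta> s n) + 1)"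
    by (rule sum_\<beta>_fourth_moment) blast
  obtain C0 where C0: "C0 > 0" "\<And>s. 0 \<le> s \<Longrightarrow> s < 1 \<Longrightarrow> (\<Sum>n. \<beta> s n) \<le> C0 / (1 - s) ^ 3 * exp (\<alpha> / (1 - s))"
    by (rule sum_\<beta>_le) blast
  \<comment> \<open>1025 is 1 + 16 * 64 and serves s < 1/2. For s at least 1/2, 2048 is 32 * 64,
    from \<open>2 / s^4 \<le> 32\<close> and \<open>(1 - s^2)^6 \<le> 64 * \<delta>^6\<close>, and
    864 is 32 * 27.\<close>
  define C where "C = (1025 + 2048 * A) * C0 + 864 * A / \<alpha> ^ 3"
  have C: "C > 0" using A C0 \<alpha> by (auto simp: C_def intro!: add_pos_nonneg mult_pos_pos)
  have "(\<integral>\<^sup>+w. ennreal ((1 + norm (w - z) ^ 4 / (1 - norm z) ^ 6) * ((norm (K (cnj z * w)))\<^sup>2 * v w)) \<partial>disc_measure)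
      \<le> ennreal (C / ((1 - norm z) ^ 3 * v z))" if z: "z \<in> unit_disc" for z
  proof -
    define s \<delta> Z V where "s = norm z" and "\<delta> = 1 - s" and "Z = (\<Sum>n. \<beta> s n)" and "V = 1 / (\<delta> ^ 3 * v z)"
    define k where "k w = (norm (K (cnj z * w)))\<^sup>2 * v w" for w
    have s: "0 \<le> s" "s < 1" using z by (auto simp: s_def)
    have \<delta>: "0 < \<delta>" "\<delta> \<le> 1" using s by (auto simp: \<delta>_def)
    have V: "V > 0" using \<delta> by (simp add: V_def)
    have "exp (\<alpha> / (1 - s)) = 1 / v z"
      by (simp add: exp_weight_def s_def exp_minus inverse_eq_divide)
    then have Z: "Z \<le> C0 * V" using C0(2)[OF s] by (simp add: Z_def V_def \<delta>_def)
    have Z0: "0 \<le> Z" unfolding Z_def using s by (intro suminf_nonneg summable_\<beta> \<beta>_nonneg) auto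
    have km: "k \<in> borel_measurable disc_measure"
      unfolding k_def using holomorphic_measurable_disc[OF K_section_holomorphic[OF z]] by measurable
    have dm: "(\<lambda>w. norm (w - z)) \<in> borel_measurable disc_measure"
      by (intro borel_measurable_disc_measure) measurable
    have em: "(\<lambda>w. ennreal (norm (w - z) ^ 4 * k w)) \<in> borel_measurable disc_measure"
      by (intro measurable_compose[OF _ measurable_ennreal] borel_measurable_times borel_measurable_power dm km)
    have k0: "0 \<le> k w" for w by (simp add: k_def)
    have kZ: "(\<integral>\<^sup>+w. ennreal (k w) \<partial>disc_measure) \<le> ennreal Z"
      using nn_integral_K_sq_le[OF z] by (simp add: k_def Z_def s_def)
    have "(\<integral>\<^sup>+w. ennreal ((1 + norm (w - z) ^ 4 / \<delta> ^ 6) * k w) \<partial>disc_measure) \<le> ennreal (C * V)"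
    \<comment> \<open>The bound for \<open>|w - z|^4\<close> loses a factor \<open>s^(-4)\<close>,
      so points near the centre are treated with the trivial bound
      \<open>|w - z| \<le> 2\<close>.\<close>
    proof (cases "s < 1/2")
      case True
      have "(\<integral>\<^sup>+w. ennreal ((1 + norm (w - z) ^ 4 / \<delta> ^ 6) * k w) \<partial>disc_measure)
          \<le> (\<integral>\<^sup>+w. ennreal 1025 * ennreal (k w) \<partial>disc_measure)"
      proof (rule nn_integral_mono)
        fix w assume w: "w \<in> space disc_measure"
        have "norm (w - z) \<le> 2" using norm_triangle_ineq4[of w z] w z by auto
        then have "norm (w - z) ^ 4 \<le> 2 ^ 4" by (intro power_mono) auto
        moreover have "(1/2) ^ 6 \<le> \<delta> ^ 6" using True by (intro power_mono) (auto simp: \<delta>_def)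
        ultimately have "norm (w - z) ^ 4 / \<delta> ^ 6 \<le> 2 ^ 4 / (1/2) ^ 6" by (intro frac_le) auto
        then have "1 + norm (w - z) ^ 4 / \<delta> ^ 6 \<le> 1025" by (simp add: power_divide)
        then have "(1 + norm (w - z) ^ 4 / \<delta> ^ 6) * k w \<le> 1025 * k w"
          by (intro mult_right_mono k0)
        then show "ennreal ((1 + norm (w - z) ^ 4 / \<delta> ^ 6) * k w) \<le> ennreal 1025 * ennreal (k w)"
          by (subst ennreal_mult[symmetric]) (auto intro: ennreal_leI k0)
      qed
      also have "\<dots> = ennreal 1025 * (\<integral>\<^sup>+w. ennreal (k w) \<partial>disc_measure)"
        using km by (intro nn_integral_cmult) measurable
      also have "\<dots> \<le> ennreal 1025 * ennreal Z" by (intro mult_left_mono kZ) simp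
      also have "\<dots> = ennreal (1025 * Z)" using Z0 by (simp add: ennreal_mult)
      also have "\<dots> \<le> ennreal (C * V)"
      proof (rule ennreal_leI)
        have "1025 * Z \<le> (1025 * C0) * V" using Z by simp
        also have "\<dots> \<le> C * V"
          using A C0 V \<alpha> by (intro mult_right_mono) (auto simp: C_def algebra_simps)
        finally show "1025 * Z \<le> C * V" .
      qed
      finally show ?thesis .
    next
      case False
      have z0: "z \<noteq> 0" using False by (auto simp: s_def)
      define E where "E = 2 / s ^ 4 * ((\<Sum>n. \<beta> s n * (p n - s\<^sup>2) ^ 4) + (\<Sum>n. \<beta> s n * (d n)\<^sup>2))"
      have E: "E \<le> 32 * A * (64 * \<delta> ^ 6 * Z + 1)"
      proof -
        have "(1/2) ^ 4 \<le> s ^ 4" using False by (intro power_mono) auto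
        then have "2 / s ^ 4 \<le> 2 / (1/2) ^ 4" by (intro frac_le) auto
        then have s4: "2 / s ^ 4 \<le> 32" by (simp add: power_divide)
        have "1 - s\<^sup>2 = \<delta> * (1 + s)" by (simp add: \<delta>_def power2_eq_square algebra_simps)
        also have "\<dots> \<le> \<delta> * 2" using \<delta> s by (intro mult_left_mono) auto
        finally have "(1 - s\<^sup>2) ^ 6 \<le> (\<delta> * 2) ^ 6" using s by (intro power_mono) (auto simp: power_le_one)
        then have e6: "(1 - s\<^sup>2) ^ 6 \<le> 64 * \<delta> ^ 6" by (simp add: power_mult_distrib)
        have "E \<le> 2 / s ^ 4 * (A * ((1 - s\<^sup>2) ^ 6 * Z + 1))"
          unfolding E_def Z_def by (intro mult_left_mono A(2) s) auto
        also have "\<dots> \<le> 32 * (A * (64 * \<delta> ^ 6 * Z + 1))"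
          using s4 e6 A(1) Z0 s by (intro mult_mono add_right_mono mult_left_mono mult_right_mono mult_nonneg_nonneg add_nonneg_nonneg) (auto simp: power_le_one)
        finally show ?thesis by simp
      qed
      \<comment> \<open>The additive 1 in \<open>sum_\<beta>_fourth_moment\<close> turns into
        \<open>\<delta>^(-6)\<close> here; it is harmless because \<open>1 / v z\<close> dominates
        \<open>\<delta>^(-3)\<close>.\<close>
      have v\<delta>: "1 / \<delta> ^ 6 \<le> 27 / \<alpha> ^ 3 * V"
      proof -
        have "\<alpha> / \<delta> / 3 \<le> exp (\<alpha> / \<delta> / 3)"
          using exp_ge_add_one_self[of "\<alpha> / \<delta> / 3"] by linarith
        then have "(\<alpha> / \<delta> / 3) ^ 3 \<le> exp (\<alpha> / \<delta> / 3) ^ 3"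
          using \<alpha> \<delta> by (intro power_mono) auto
        also have "\<dots> = exp (\<alpha> / \<delta>)" by (simp flip: exp_of_nat_mult)
        also have "\<dots> = 1 / v z" by (simp add: exp_weight_def s_def \<delta>_def exp_minus inverse_eq_divide)
        finally have "\<alpha> ^ 3 / (27 * \<delta> ^ 3) \<le> 1 / v z" by (simp add: power_divide)
        then have "27 / (\<alpha> ^ 3 * \<delta> ^ 3) * (\<alpha> ^ 3 / (27 * \<delta> ^ 3)) \<le> 27 / (\<alpha> ^ 3 * \<delta> ^ 3) * (1 / v z)"
          using \<alpha> \<delta> by (intro mult_left_mono) auto
        then show ?thesis using \<alpha> \<delta> by (simp add: V_def field_simps flip: power_add)
      qed
      have "(\<integral>\<^sup>+w. ennreal ((1 + norm (w - z) ^ 4 / \<delta> ^ 6) * k w) \<partial>disc_measure)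
          = (\<integral>\<^sup>+w. ennreal (k w) + ennreal (1 / \<delta> ^ 6) * ennreal (norm (w - z) ^ 4 * k w) \<partial>disc_measure)"
        using \<delta> k0 by (intro nn_integral_cong) (simp add: ennreal_mult[symmetric] ennreal_plus[symmetric] algebra_simps del: ennreal_plus)
      also have "\<dots> = (\<integral>\<^sup>+w. ennreal (k w) \<partial>disc_measure) + (\<integral>\<^sup>+w. ennreal (1 / \<delta> ^ 6) * ennreal (norm (w - z) ^ 4 * k w) \<partial>disc_measure)"
        by (intro nn_integral_add borel_measurable_times_ennreal borel_measurable_const em measurable_compose[OF km measurable_ennreal])
      also have "(\<integral>\<^sup>+w. ennreal (1 / \<delta> ^ 6) * ennreal (norm (w - z) ^ 4 * k w) \<partial>disc_measure)
          = ennreal (1 / \<delta> ^ 6) * (\<integral>\<^sup>+w. ennreal (norm (w - z) ^ 4 * k w) \<partial>disc_measure)"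
        by (rule nn_integral_cmult[OF em])
      also have "(\<integral>\<^sup>+w. ennreal (k w) \<partial>disc_measure) + \<dots> \<le> ennreal Z + ennreal (1 / \<delta> ^ 6) * ennreal (32 * A * (64 * \<delta> ^ 6 * Z + 1))"
      proof (intro add_mono kZ mult_left_mono)
        show "(\<integral>\<^sup>+w. ennreal (norm (w - z) ^ 4 * k w) \<partial>disc_measure) \<le> ennreal (32 * A * (64 * \<delta> ^ 6 * Z + 1))"
          using order_trans[OF nn_integral_K_sq_dist4_le[OF z z0] ennreal_leI[OF E[unfolded E_def s_def]]]
          by (simp add: k_def mult_ac s_def)
      qed simp
      also have "\<dots> = ennreal (Z + 1 / \<delta> ^ 6 * (32 * A * (64 * \<delta> ^ 6 * Z + 1)))"
        using A Z0 \<delta> by (simp add: ennreal_mult[symmetric] ennreal_plus[symmetric] del: ennreal_plus)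
      also have "\<dots> \<le> ennreal (C * V)"
      proof (rule ennreal_leI)
        have "Z + 1 / \<delta> ^ 6 * (32 * A * (64 * \<delta> ^ 6 * Z + 1)) = (1 + 2048 * A) * Z + 32 * A * (1 / \<delta> ^ 6)"
          using \<delta> by (simp add: field_simps)
        also have "\<dots> \<le> (1 + 2048 * A) * (C0 * V) + 32 * A * (27 / \<alpha> ^ 3 * V)"
          using A Z v\<delta> by (intro add_mono mult_left_mono) auto
        also have "\<dots> = ((1 + 2048 * A) * C0 + 864 * A / \<alpha> ^ 3) * V" by (simp add: algebra_simps)
        also have "\<dots> \<le> C * V"
          using A C0 V by (intro mult_right_mono) (auto simp: C_def)
        finally show "Z + 1 / \<delta> ^ 6 * (32 * A * (64 * \<delta> ^ 6 * Z + 1)) \<le> C * V" .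
      qed
      finally show ?thesis .
    qed
    then show ?thesis by (simp add: k_def V_def \<delta>_def s_def)
  qed
  with C show ?thesis using that by blast
qed

lemma nn_integral_K_le:
  obtains C where "C > 0" "\<And>z. z \<in> unit_disc \<Longrightarrow>
    (\<integral>\<^sup>+w. ennreal (norm (K (z * cnj w)) * sqrt (v z) * sqrt (v w)) \<partial>disc_measure) \<le> ennreal C"
proof -
  obtain C1 where C1: "C1 > 0" "\<And>z. z \<in> unit_disc \<Longrightarrow>
    (\<integral>\<^sup>+w. ennreal ((1 + norm (w - z) ^ 4 / (1 - norm z) ^ 6) * ((norm (K (cnj z * w)))\<^sup>2 * v w)) \<partial>disc_measure)
      \<le> ennreal (C1 / ((1 - norm z) ^ 3 * v z))"
    by (rule nn_integral_K_sq_weighted_le) blast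
  have "(\<integral>\<^sup>+w. ennreal (norm (K (z * cnj w)) * sqrt (v z) * sqrt (v w)) \<partial>disc_measure) \<le> ennreal (C1 / 2 + pi)"
    if z: "z \<in> unit_disc" for z
  proof -
    define \<delta> r where "\<delta> = 1 - norm z" and "r = sqrt (\<delta> ^ 3)"
    define W where "W w = 1 + norm (w - z) ^ 4 / \<delta> ^ 6" for w
    define k where "k w = (norm (K (cnj z * w)))\<^sup>2 * v w" for w
    have \<delta>: "\<delta> > 0" using z by (simp add: \<delta>_def)
    have r: "r > 0" "r\<^sup>2 = \<delta> ^ 3" "r ^ 4 = \<delta> ^ 6"
    proof -
      show "r > 0" "r\<^sup>2 = \<delta> ^ 3" using \<delta> by (auto simp: r_def)
      then have "(r\<^sup>2)\<^sup>2 = (\<delta> ^ 3)\<^sup>2" by simp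
      then show "r ^ 4 = \<delta> ^ 6" by (simp flip: power_mult)
    qed
    have km: "k \<in> borel_measurable disc_measure"
      unfolding k_def using holomorphic_measurable_disc[OF K_section_holomorphic[OF z]] by measurable
    have Wm: "W \<in> borel_measurable disc_measure"
      unfolding W_def by (intro borel_measurable_disc_measure) measurable
    have W: "W w \<ge> 1" for w using \<delta> by (simp add: W_def)
    have k0: "k w \<ge> 0" for w by (simp add: k_def)
    have pt: "norm (K (z * cnj w)) * sqrt (v z) * sqrt (v w) \<le> \<delta> ^ 3 * v z / 2 * (W w * k w) + 1 / (2 * \<delta> ^ 3) * (1 / W w)"
      if w: "w \<in> unit_disc" for w
    proof -
      define X where "X = norm (K (z * cnj w)) * sqrt (v z) * sqrt (v w)"
      \<comment> \<open>This t balances the two halves: \<open>1 / W\<close> has integral of order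
        \<open>\<delta>^3\<close> and \<open>W * k\<close> has integral of order
        \<open>1 / (\<delta>^3 * v z)\<close>, so each half contributes a constant.\<close>
      define t where "t = \<delta> ^ 3 * W w"
      have t: "t > 0" using \<delta> W[of w] by (simp add: t_def)
      have X2: "X\<^sup>2 = v z * k w"
        using norm_K_swap[OF z w] by (simp add: X_def k_def power_mult_distrib mult.commute)
      have "0 \<le> (t * X - 1)\<^sup>2 / t" using t by simp
      also have "\<dots> = t * X\<^sup>2 + 1 / t - 2 * X" using t by (simp add: field_simps power2_eq_square)
      finally have "X \<le> t * X\<^sup>2 / 2 + 1 / t / 2" by simp
      then show ?thesis unfolding X2 by (simp add: X_def t_def mult_ac)
    qed
    have "(\<integral>\<^sup>+w. ennreal (norm (K (z * cnj w)) * sqrt (v z) * sqrt (v w)) \<partial>disc_measure)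
        \<le> (\<integral>\<^sup>+w. ennreal (\<delta> ^ 3 * v z / 2) * ennreal (W w * k w) + ennreal (1 / (2 * \<delta> ^ 3)) * ennreal (1 / W w) \<partial>disc_measure)"
    proof (rule nn_integral_mono)
      fix w assume "w \<in> space disc_measure"
      then have "ennreal (norm (K (z * cnj w)) * sqrt (v z) * sqrt (v w)) \<le> ennreal (\<delta> ^ 3 * v z / 2 * (W w * k w) + 1 / (2 * \<delta> ^ 3) * (1 / W w))"
        by (intro ennreal_leI pt) simp
      also have "\<dots> = ennreal (\<delta> ^ 3 * v z / 2) * ennreal (W w * k w) + ennreal (1 / (2 * \<delta> ^ 3)) * ennreal (1 / W w)"
      proof -
        have "0 \<le> W w" using W[of w] by simp
        then show ?thesis using \<delta> k0[of w]
          by (subst ennreal_plus) (auto simp: ennreal_mult[symmetric])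
      qed
      finally show "ennreal (norm (K (z * cnj w)) * sqrt (v z) * sqrt (v w)) \<le> \<dots>" .
    qed
    also have "\<dots> = ennreal (\<delta> ^ 3 * v z / 2) * (\<integral>\<^sup>+w. ennreal (W w * k w) \<partial>disc_measure)
        + ennreal (1 / (2 * \<delta> ^ 3)) * (\<integral>\<^sup>+w. ennreal (1 / W w) \<partial>disc_measure)"
      using km Wm by (subst nn_integral_add) (auto simp: nn_integral_cmult)
    also have "\<dots> \<le> ennreal (\<delta> ^ 3 * v z / 2) * ennreal (C1 / (\<delta> ^ 3 * v z)) + ennreal (1 / (2 * \<delta> ^ 3)) * ennreal (2 * pi * \<delta> ^ 3)"
      using C1(2)[OF z] nn_integral_disc_bump[OF r(1), of z]
      by (intro add_mono mult_left_mono) (auto simp: W_def k_def \<delta>_def r(2,3))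
    also have "\<dots> = ennreal (\<delta> ^ 3 * v z / 2 * (C1 / (\<delta> ^ 3 * v z)) + 1 / (2 * \<delta> ^ 3) * (2 * pi * \<delta> ^ 3))"
      using \<delta> C1(1) by (subst ennreal_plus) (auto simp: ennreal_mult[symmetric])
    also have "\<delta> ^ 3 * v z / 2 * (C1 / (\<delta> ^ 3 * v z)) + 1 / (2 * \<delta> ^ 3) * (2 * pi * \<delta> ^ 3) = C1 / 2 + pi"
      using \<delta> less_imp_neq[OF exp_weight_pos[of \<alpha> z], symmetric] by (simp add: field_simps)
    finally show ?thesis .
  qed
  moreover have "C1 / 2 + pi > 0" using C1(1) pi_gt_zero by (intro add_pos_pos) auto
  ultimately show ?thesis using that by blast
qed

end

section \<open>Schur's test\<close>

text \<open>The tangent line of the convex function \<open>g powr q\<close> at a, arranged with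
  nonnegative terms on both sides so that it can be integrated in \<open>ennreal\<close>.\<close>

lemma powr_tangent_le:
  fixes a g q :: real
  assumes "1 \<le> q" "0 \<le> g" "0 \<le> a"
  shows "q * a powr (q - 1) * g \<le> g powr q + (q - 1) * a powr q"
proof (cases "q = 1")
  case True
  then show ?thesis using assms by simp
next
  case False
  define r where "r = q / (q - 1)"
  have q: "q > 1" using assms False by simp
  have r: "r > 1" "1 / q + 1 / r = 1" using q by (auto simp: r_def field_simps)
  have "g * a powr (q - 1) \<le> g powr q / q + (a powr (q - 1)) powr r / r"
    using q r assms by (intro Youngs_inequality) auto
  also have "(a powr (q - 1)) powr r = a powr q"
    using q by (simp add: powr_powr r_def)
  finally have "q * (g * a powr (q - 1)) \<le> q * (g powr q / q + a powr q / r)"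
    using q by (intro mult_left_mono) auto
  also have "\<dots> = g powr q + (q - 1) * a powr q"
    using q by (simp add: r_def field_simps)
  finally show ?thesis by (simp add: mult_ac)
qed

text \<open>Jensen's inequality, obtained by integrating the tangent line at \<open>T / C\<close>.\<close>

lemma schur_pointwise:
  fixes g h :: "'a \<Rightarrow> real"
  assumes q: "1 \<le> q" and C: "0 < C" and T: "0 \<le> T"
    and g [measurable]: "g \<in> borel_measurable M" and h [measurable]: "h \<in> borel_measurable M"
    and nonneg: "\<And>w. w \<in> space M \<Longrightarrow> 0 \<le> g w" "\<And>w. w \<in> space M \<Longrightarrow> 0 \<le> h w"
    and hC: "(\<integral>\<^sup>+w. ennreal (h w) \<partial>M) \<le> ennreal C"
    and TI: "ennreal T \<le> (\<integral>\<^sup>+w. ennreal (g w * h w) \<partial>M)"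
  shows "ennreal (T powr q) \<le> ennreal (C powr (q - 1)) * (\<integral>\<^sup>+w. ennreal (g w powr q * h w) \<partial>M)"
proof -
  define a where "a = T / C"
  define X where "X = (\<integral>\<^sup>+w. ennreal (g w powr q * h w) \<partial>M)"
  have a: "0 \<le> a" "T = a * C" using T C by (auto simp: a_def)
  have "ennreal (q * a powr (q - 1) * T) \<le> ennreal (q * a powr (q - 1)) * (\<integral>\<^sup>+w. ennreal (g w * h w) \<partial>M)"
    using q T by (subst ennreal_mult) (auto intro!: mult_left_mono TI)
  also have "\<dots> = (\<integral>\<^sup>+w. ennreal (q * a powr (q - 1)) * ennreal (g w * h w) \<partial>M)"
    by (intro nn_integral_cmult[symmetric]) measurable
  also have "\<dots> \<le> (\<integral>\<^sup>+w. ennreal (g w powr q * h w) + ennreal ((q - 1) * a powr q) * ennreal (h w) \<partial>M)"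
  proof (rule nn_integral_mono)
    fix w assume w: "w \<in> space M"
    have "q * a powr (q - 1) * g w * h w \<le> (g w powr q + (q - 1) * a powr q) * h w"
      using q a nonneg[OF w] by (intro mult_right_mono powr_tangent_le) auto
    then have "q * a powr (q - 1) * (g w * h w) \<le> g w powr q * h w + (q - 1) * a powr q * h w"
      by (simp add: algebra_simps)
    then have "ennreal (q * a powr (q - 1) * (g w * h w)) \<le> ennreal (g w powr q * h w + (q - 1) * a powr q * h w)"
      by (rule ennreal_leI)
    then show "ennreal (q * a powr (q - 1)) * ennreal (g w * h w)
        \<le> ennreal (g w powr q * h w) + ennreal ((q - 1) * a powr q) * ennreal (h w)"
      using q nonneg[OF w] by (simp add: ennreal_mult[symmetric] ennreal_plus[symmetric] del: ennreal_plus)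
  qed
  also have "\<dots> = X + ennreal ((q - 1) * a powr q) * (\<integral>\<^sup>+w. ennreal (h w) \<partial>M)"
    unfolding X_def by (subst nn_integral_add) (auto simp: nn_integral_cmult)
  also have "\<dots> \<le> X + ennreal ((q - 1) * a powr q) * ennreal C"
    by (intro add_left_mono mult_left_mono hC) simp
  also have "\<dots> = X + ennreal ((q - 1) * a powr q * C)"
    using q C by (simp add: ennreal_mult)
  finally have le: "ennreal (q * a powr (q - 1) * T) \<le> X + ennreal ((q - 1) * a powr q * C)" .
  have "a powr (q - 1) * T = a powr q * C"
    using a q C by (cases "a = 0") (auto simp: powr_diff)
  then have "q * a powr (q - 1) * T = a powr q * C + (q - 1) * a powr q * C"
    by (simp add: algebra_simps)
  with le have le2: "ennreal (a powr q * C + (q - 1) * a powr q * C) \<le> X + ennreal ((q - 1) * a powr q * C)" by simp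
  \<comment> \<open>The common summand can be cancelled when X is finite; for infinite X the claim
    is trivial.\<close>
  have "ennreal (a powr q * C) \<le> X"
  proof (cases X)
    case (real x)
    then show ?thesis using le2 q C
      by (simp add: ennreal_plus[symmetric] del: ennreal_plus)
  qed simp
  then have "ennreal (C powr (q - 1)) * ennreal (a powr q * C) \<le> ennreal (C powr (q - 1)) * X"
    by (intro mult_left_mono) auto
  moreover have "C powr (q - 1) * (a powr q * C) = T powr q"
    using C T by (simp add: a_def powr_divide powr_diff)
  ultimately show ?thesis
    using C by (simp add: X_def ennreal_mult[symmetric])
qed

text \<open>This is why the exponent of the weight is half of the exponent of the norm: with
  \<open>g = |f| sqrt v\<close>, the weighted spaces become unweighted ones and a single kernel
  serves every exponent.\<close>

lemma v_powr_half_powr: "norm a powr q * exp_weight \<alpha> z powr (q / 2) = (norm a * sqrt (exp_weight \<alpha> z)) powr q"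
  using exp_weight_pos[of \<alpha> z]
  by (simp add: powr_mult powr_powr less_imp_le flip: powr_half_sqrt)

section \<open>Boundedness of the projection\<close>

context disc_weight
begin

lemma K_measurable [measurable]: "K \<in> borel_measurable borel"
  unfolding K_def[abs_def] by measurable

text \<open>The modulus of the kernel of the projection after conjugation with
  \<open>sqrt v\<close>. It is symmetric on the disc, so one bound covers both conditions of Schur's
  test.\<close>

definition schur_kernel :: "complex \<Rightarrow> complex \<Rightarrow> real" where
  "schur_kernel z w = norm (K (z * cnj w)) * sqrt (v z) * sqrt (v w)"

lemma schur_kernel_nonneg [simp]: "0 \<le> schur_kernel z w"
  by (simp add: schur_kernel_def)

lemma schur_kernel_sym: "z \<in> unit_disc \<Longrightarrow> w \<in> unit_disc \<Longrightarrow> schur_kernel z w = schur_kernel w z"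
  by (simp add: schur_kernel_def norm_K_swap[of w z])

lemma schur_kernel_measurable:
  "(\<lambda>(z, w). schur_kernel z w) \<in> borel_measurable (disc_measure \<Otimes>\<^sub>M disc_measure)"
proof -
  have [measurable]: "fst \<in> (disc_measure \<Otimes>\<^sub>M disc_measure) \<rightarrow>\<^sub>M borel" "snd \<in> (disc_measure \<Otimes>\<^sub>M disc_measure) \<rightarrow>\<^sub>M borel"
    using measurable_compose[OF measurable_fst id_measurable_disc_measure, of disc_measure]
      measurable_compose[OF measurable_snd id_measurable_disc_measure, of disc_measure] by simp_all
  show ?thesis unfolding schur_kernel_def case_prod_beta by measurable
qed

lemma schur_kernel_measurable_section:
  "schur_kernel z \<in> borel_measurable disc_measure"
  unfolding schur_kernel_def[abs_def] by (intro borel_measurable_disc_measure) measurable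

text \<open>Since \<open>v \<le> sqrt v\<close> on the disc, the hypothesis makes f integrable
  against v and \<open>integral_against_K\<close> applies. Splitting v into
  \<open>sqrt v * sqrt v\<close> assigns one factor to f and one to the kernel.\<close>

lemma bergman_projection_pointwise:
  assumes f: "f \<in> borel_measurable disc_measure"
    and g: "integrable disc_measure (\<lambda>w. norm (f w) * sqrt (v w))"
  shows "z \<in> unit_disc \<Longrightarrow> integrable disc_measure (bergman_integrand v f z)"
    and "bergman_projection v f holomorphic_on unit_disc"
    and "z \<in> unit_disc \<Longrightarrow> ennreal (norm (bergman_projection v f z) * sqrt (v z))
      \<le> (\<integral>\<^sup>+w. ennreal (norm (f w) * sqrt (v w) * schur_kernel z w) \<partial>disc_measure)"
proof -
  have int: "integrable disc_measure (\<lambda>w. f w * complex_of_real (v w))"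
  proof (rule Bochner_Integration.integrable_bound[OF g])
    show "(\<lambda>w. f w * complex_of_real (v w)) \<in> borel_measurable disc_measure" using f by measurable
    show "AE w in disc_measure. norm (f w * complex_of_real (v w)) \<le> norm (norm (f w) * sqrt (v w))"
    proof (rule AE_I2)
      fix w assume w: "w \<in> space disc_measure"
      have "v w = sqrt (v w) * sqrt (v w)" by simp
      also have "\<dots> \<le> sqrt (v w) * 1" using v_le_1[of w] w by (intro mult_left_mono) auto
      finally have "norm (f w) * v w \<le> norm (f w) * sqrt (v w)" by (intro mult_left_mono) auto
      then show "norm (f w * complex_of_real (v w)) \<le> norm (norm (f w) * sqrt (v w))" by (simp add: norm_mult)
    qed
  qed
  have eq: "bergman_integrand v f z w = f w * K (z * cnj w) * v w" if "z \<in> unit_disc" "w \<in> unit_disc" for z w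
    using bergman_kernel_eq[OF that] by (simp add: bergman_integrand_def)
  have intz: "integrable disc_measure (bergman_integrand v f z)" if z: "z \<in> unit_disc" for z
    using integral_against_K(1)[OF int z] eq[OF z]
    by (subst Bochner_Integration.integrable_cong[OF refl, where g="\<lambda>w. f w * K (z * cnj w) * v w"]) auto
  then show "z \<in> unit_disc \<Longrightarrow> integrable disc_measure (bergman_integrand v f z)" .
  have P: "bergman_projection v f z = (LINT w|disc_measure. f w * K (z * cnj w) * v w)" if z: "z \<in> unit_disc" for z
    unfolding bergman_projection_def using eq[OF z] by (intro Bochner_Integration.integral_cong) auto
  show "bergman_projection v f holomorphic_on unit_disc"
    by (rule power_series_holomorphic[where a="\<lambda>n. (LINT w|disc_measure. f w * cnj w ^ n * v w) / moment (2 * n)"])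
       (use integral_against_K(2)[OF int] P in simp)
  show "ennreal (norm (bergman_projection v f z) * sqrt (v z))
      \<le> (\<integral>\<^sup>+w. ennreal (norm (f w) * sqrt (v w) * schur_kernel z w) \<partial>disc_measure)" if z: "z \<in> unit_disc"
  proof -
    have "ennreal (norm (bergman_projection v f z)) \<le> (\<integral>\<^sup>+w. ennreal (norm (bergman_integrand v f z w)) \<partial>disc_measure)"
      unfolding bergman_projection_def by (rule integral_norm_bound_ennreal[OF intz[OF z]])
    then have "ennreal (sqrt (v z)) * ennreal (norm (bergman_projection v f z))
        \<le> ennreal (sqrt (v z)) * (\<integral>\<^sup>+w. ennreal (norm (bergman_integrand v f z w)) \<partial>disc_measure)"
      by (intro mult_left_mono) auto
    also have "\<dots> = (\<integral>\<^sup>+w. ennreal (sqrt (v z)) * ennreal (norm (bergman_integrand v f z w)) \<partial>disc_measure)"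
      by (intro nn_integral_cmult[symmetric] measurable_compose[OF _ measurable_ennreal]
          borel_measurable_integrable[OF integrable_norm[OF intz[OF z]]])
    also have "\<dots> = (\<integral>\<^sup>+w. ennreal (norm (f w) * sqrt (v w) * schur_kernel z w) \<partial>disc_measure)"
    proof (rule nn_integral_cong)
      fix w assume w: "w \<in> space disc_measure"
      have "sqrt (v z) * norm (bergman_integrand v f z w) = norm (f w) * norm (K (z * cnj w)) * sqrt (v z) * (sqrt (v w) * sqrt (v w))"
        using eq[OF z] w by (simp add: norm_mult mult_ac)
      also have "\<dots> = norm (f w) * sqrt (v w) * schur_kernel z w"
        unfolding schur_kernel_def by (simp only: mult_ac)
      finally show "ennreal (sqrt (v z)) * ennreal (norm (bergman_integrand v f z w)) = ennreal (norm (f w) * sqrt (v w) * schur_kernel z w)"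
        by (simp add: ennreal_mult[symmetric])
    qed
    finally show ?thesis by (simp add: ennreal_mult[symmetric] mult.commute)
  qed
qed

text \<open>Jensen's inequality in w costs \<open>C powr (q - 1)\<close>, and exchanging the
  integrals costs one more C by symmetry. T is only assumed to be dominated, so no measurability of
  the kernel integral of g enters.\<close>

lemma schur_Lp:
  assumes q: "1 \<le> q" and C: "0 < C" "\<And>z. z \<in> unit_disc \<Longrightarrow> (\<integral>\<^sup>+w. ennreal (schur_kernel z w) \<partial>disc_measure) \<le> ennreal C"
    and g [measurable]: "g \<in> borel_measurable disc_measure" "\<And>w. 0 \<le> g w"
    and T: "\<And>z. 0 \<le> T z" "\<And>z. z \<in> unit_disc \<Longrightarrow> ennreal (T z) \<le> (\<integral>\<^sup>+w. ennreal (g w * schur_kernel z w) \<partial>disc_measure)"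
  shows "(\<integral>\<^sup>+z. ennreal (T z powr q) \<partial>disc_measure) \<le> ennreal (C powr q) * (\<integral>\<^sup>+w. ennreal (g w powr q) \<partial>disc_measure)"
proof -
  note [measurable] = schur_kernel_measurable schur_kernel_measurable_section
  have sm: "(\<lambda>(z, w). ennreal (schur_kernel z w)) \<in> borel_measurable (disc_measure \<Otimes>\<^sub>M disc_measure)"
    using measurable_compose[OF schur_kernel_measurable measurable_ennreal] by (simp add: case_prod_beta)
  have gm: "(\<lambda>w. ennreal (g w powr q)) \<in> borel_measurable disc_measure" by measurable
  have pm: "(\<lambda>(z, w). ennreal (g w powr q * schur_kernel z w)) \<in> borel_measurable (disc_measure \<Otimes>\<^sub>M disc_measure)"
    using borel_measurable_times_ennreal[OF measurable_compose[OF measurable_snd gm] sm]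
    by (simp add: case_prod_beta ennreal_mult)
  have "(\<integral>\<^sup>+z. ennreal (T z powr q) \<partial>disc_measure)
      \<le> (\<integral>\<^sup>+z. ennreal (C powr (q - 1)) * (\<integral>\<^sup>+w. ennreal (g w powr q * schur_kernel z w) \<partial>disc_measure) \<partial>disc_measure)"
    using C by (intro nn_integral_mono schur_pointwise q g T schur_kernel_measurable_section) auto
  also have "\<dots> = ennreal (C powr (q - 1)) * (\<integral>\<^sup>+z. (\<integral>\<^sup>+w. ennreal (g w powr q * schur_kernel z w) \<partial>disc_measure) \<partial>disc_measure)"
    by (intro nn_integral_cmult disc.borel_measurable_nn_integral pm)
  also have "(\<integral>\<^sup>+z. (\<integral>\<^sup>+w. ennreal (g w powr q * schur_kernel z w) \<partial>disc_measure) \<partial>disc_measure)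
      = (\<integral>\<^sup>+w. (\<integral>\<^sup>+z. ennreal (g w powr q * schur_kernel z w) \<partial>disc_measure) \<partial>disc_measure)"
    by (rule disc2.Fubini'[OF pm, symmetric])
  also have "\<dots> \<le> (\<integral>\<^sup>+w. ennreal C * ennreal (g w powr q) \<partial>disc_measure)"
  proof (rule nn_integral_mono)
    fix w assume w: "w \<in> space disc_measure"
    have "(\<integral>\<^sup>+z. ennreal (g w powr q * schur_kernel z w) \<partial>disc_measure)
        = (\<integral>\<^sup>+z. ennreal (g w powr q) * ennreal (schur_kernel w z) \<partial>disc_measure)"
      using w by (intro nn_integral_cong) (auto simp: ennreal_mult schur_kernel_sym)
    also have "\<dots> = ennreal (g w powr q) * (\<integral>\<^sup>+z. ennreal (schur_kernel w z) \<partial>disc_measure)"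
      by (intro nn_integral_cmult) measurable
    also have "\<dots> \<le> ennreal (g w powr q) * ennreal C"
      using w by (intro mult_left_mono C) auto
    finally show "(\<integral>\<^sup>+z. ennreal (g w powr q * schur_kernel z w) \<partial>disc_measure) \<le> ennreal C * ennreal (g w powr q)"
      by (simp add: mult.commute)
  qed
  also have "\<dots> = ennreal C * (\<integral>\<^sup>+w. ennreal (g w powr q) \<partial>disc_measure)"
    by (intro nn_integral_cmult gm)
  finally have "(\<integral>\<^sup>+z. ennreal (T z powr q) \<partial>disc_measure)
      \<le> ennreal (C powr (q - 1)) * (ennreal C * (\<integral>\<^sup>+w. ennreal (g w powr q) \<partial>disc_measure))"
    by (simp add: mult_left_mono)
  also have "\<dots> = ennreal (C powr q) * (\<integral>\<^sup>+w. ennreal (g w powr q) \<partial>disc_measure)"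
    using C(1) by (simp add: mult.assoc[symmetric] ennreal_mult[symmetric] powr_diff)
  finally show ?thesis .
qed

lemma schur_kernel_bound:
  obtains C where "0 < C" "\<And>z. z \<in> unit_disc \<Longrightarrow> (\<integral>\<^sup>+w. ennreal (schur_kernel z w) \<partial>disc_measure) \<le> ennreal C"
  using nn_integral_K_le unfolding schur_kernel_def by blast

lemma bergman_projection_bounded_Lp:
  assumes q: "1 \<le> q"
  shows "bergman_projection_bounded v (Lp_space q (\<lambda>z. v z powr (q / 2)))
    (Ap_space q (\<lambda>z. v z powr (q / 2))) (Lp_norm q (\<lambda>z. v z powr (q / 2)))"
proof -
  obtain C where C: "0 < C" "\<And>z. z \<in> unit_disc \<Longrightarrow> (\<integral>\<^sup>+w. ennreal (schur_kernel z w) \<partial>disc_measure) \<le> ennreal C"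
    by (rule schur_kernel_bound) blast
  have main: "(\<forall>z\<in>unit_disc. integrable disc_measure (bergman_integrand v f z)) \<and>
      bergman_projection v f \<in> Ap_space q (\<lambda>z. v z powr (q / 2)) \<and>
      Lp_norm q (\<lambda>z. v z powr (q / 2)) (bergman_projection v f) \<le> C * Lp_norm q (\<lambda>z. v z powr (q / 2)) f"
    if "f \<in> Lp_space q (\<lambda>z. v z powr (q / 2))" for f
  proof -
    define g where "g w = norm (f w) * sqrt (v w)" for w
    define T where "T z = norm (bergman_projection v f z) * sqrt (v z)" for z
    have fm: "f \<in> borel_measurable disc_measure" and gq: "integrable disc_measure (\<lambda>w. g w powr q)"
      using that by (auto simp: Lp_space_def v_powr_half_powr g_def)
    have gm: "g \<in> borel_measurable disc_measure" unfolding g_def using fm by measurable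
    have g0: "0 \<le> g w" "0 \<le> T w" for w by (auto simp: g_def T_def)
    \<comment> \<open>As area measure is finite, \<open>g \<le> g powr q + 1\<close> gives
      convergence of the integrals defining the projection.\<close>
    have gi: "integrable disc_measure g"
    proof (rule Bochner_Integration.integrable_bound[OF Bochner_Integration.integrable_add[OF gq disc.integrable_const[of 1]]])
      show "AE w in disc_measure. norm (g w) \<le> norm (g w powr q + 1)"
      proof (rule AE_I2)
        fix w
        have "g w \<le> g w powr q + 1"
        proof (cases "g w \<le> 1")
          case False
          then have "g w powr 1 \<le> g w powr q" using q by (intro powr_mono) auto
          then show ?thesis using False by simp
        qed (simp add: add_increasing)
        then show "norm (g w) \<le> norm (g w powr q + 1)" using g0[of w] by (simp add: add_nonneg_nonneg)
      qed
    qed (rule gm)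
    note P = bergman_projection_pointwise[OF fm gi[unfolded g_def]]
    have Pm: "bergman_projection v f \<in> borel_measurable disc_measure"
      by (rule holomorphic_measurable_disc[OF P(2)])
    have Tm: "(\<lambda>z. T z powr q) \<in> borel_measurable disc_measure" unfolding T_def using Pm by measurable
    have "(\<integral>\<^sup>+z. ennreal (T z powr q) \<partial>disc_measure) \<le> ennreal (C powr q) * (\<integral>\<^sup>+w. ennreal (g w powr q) \<partial>disc_measure)"
      using P(3) by (intro schur_Lp q C gm g0) (auto simp: T_def g_def)
    also have "(\<integral>\<^sup>+w. ennreal (g w powr q) \<partial>disc_measure) = ennreal (LINT w|disc_measure. g w powr q)"
      by (intro nn_integral_eq_integral gq) auto
    also have "ennreal (C powr q) * \<dots> = ennreal (C powr q * (LINT w|disc_measure. g w powr q))"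
      by (intro ennreal_mult[symmetric]) auto
    finally have le: "(\<integral>\<^sup>+z. ennreal (T z powr q) \<partial>disc_measure) \<le> ennreal (C powr q * (LINT w|disc_measure. g w powr q))" .
    have Ti: "integrable disc_measure (\<lambda>z. T z powr q)"
      using le by (intro integrableI_bounded Tm) (auto simp: less_top[symmetric] top_unique)
    then have "ennreal (LINT z|disc_measure. T z powr q) = (\<integral>\<^sup>+z. ennreal (T z powr q) \<partial>disc_measure)"
      by (intro nn_integral_eq_integral[symmetric]) auto
    with le have "ennreal (LINT z|disc_measure. T z powr q) \<le> ennreal (C powr q * (LINT w|disc_measure. g w powr q))" by simp
    then have le': "(LINT z|disc_measure. T z powr q) \<le> C powr q * (LINT w|disc_measure. g w powr q)"
      by (subst (asm) ennreal_le_iff) auto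
    have "(LINT z|disc_measure. T z powr q) powr (1 / q) \<le> (C powr q * (LINT w|disc_measure. g w powr q)) powr (1 / q)"
      using le' q by (intro powr_mono2) auto
    also have "\<dots> = C * (LINT w|disc_measure. g w powr q) powr (1 / q)"
      using q C(1) by (simp add: powr_mult powr_powr)
    finally have "Lp_norm q (\<lambda>z. v z powr (q / 2)) (bergman_projection v f) \<le> C * Lp_norm q (\<lambda>z. v z powr (q / 2)) f"
      by (simp add: Lp_norm_def v_powr_half_powr T_def g_def)
    moreover have "bergman_projection v f \<in> Ap_space q (\<lambda>z. v z powr (q / 2))"
      using P(2) Pm Ti by (simp add: Ap_space_def Lp_space_def v_powr_half_powr T_def)
    ultimately show ?thesis using P(1) by blast
  qed
  then show ?thesis
    unfolding bergman_projection_bounded_def using C(1) less_imp_le by blast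
qed

text \<open>The supremum bound M comes out of the integral, and the bound for the integral of
  \<open>schur_kernel z\<close> suffices without interpolation or duality.\<close>

lemma bergman_projection_bounded_Linf:
  "bergman_projection_bounded v (Linf_space (\<lambda>z. v z powr (1 / 2)))
    (Ainf_space (\<lambda>z. v z powr (1 / 2))) (Linf_norm (\<lambda>z. v z powr (1 / 2)))"
proof -
  have half: "v z powr (1 / 2) = sqrt (v z)" for z by (simp add: powr_half_sqrt)
  obtain C where C: "0 < C" "\<And>z. z \<in> unit_disc \<Longrightarrow> (\<integral>\<^sup>+w. ennreal (schur_kernel z w) \<partial>disc_measure) \<le> ennreal C"
    by (rule schur_kernel_bound) blast
  have main: "(\<forall>z\<in>unit_disc. integrable disc_measure (bergman_integrand v f z)) \<and>
      bergman_projection v f \<in> Ainf_space (\<lambda>z. sqrt (v z)) \<and>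
      Linf_norm (\<lambda>z. sqrt (v z)) (bergman_projection v f) \<le> C * Linf_norm (\<lambda>z. sqrt (v z)) f"
    if "f \<in> Linf_space (\<lambda>z. sqrt (v z))" for f
  proof -
    define g where "g w = norm (f w) * sqrt (v w)" for w
    define M where "M = Linf_norm (\<lambda>z. sqrt (v z)) f"
    have fm: "f \<in> borel_measurable disc_measure" and bdd: "bdd_above (g ` unit_disc)"
      using that by (auto simp: Linf_space_def g_def)
    have gm: "g \<in> borel_measurable disc_measure" unfolding g_def using fm by measurable
    have gM: "g w \<le> M" if "w \<in> unit_disc" for w
      using cSUP_upper[OF that bdd] by (simp add: M_def Linf_norm_def g_def)
    have g0: "0 \<le> g w" for w by (simp add: g_def)
    have M0: "0 \<le> M" using g0[of 0] gM[of 0] by simp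
    have gi: "integrable disc_measure g"
      by (rule integrable_disc_bounded[OF gm, of M]) (use g0 gM in simp)
    note P = bergman_projection_pointwise[OF fm gi[unfolded g_def]]
    have PM: "norm (bergman_projection v f z) * sqrt (v z) \<le> C * M" if z: "z \<in> unit_disc" for z
    proof -
      have "ennreal (norm (bergman_projection v f z) * sqrt (v z)) \<le> (\<integral>\<^sup>+w. ennreal (g w * schur_kernel z w) \<partial>disc_measure)"
        using P(3)[OF z] by (simp add: g_def)
      also have "\<dots> \<le> (\<integral>\<^sup>+w. ennreal M * ennreal (schur_kernel z w) \<partial>disc_measure)"
        using gM M0 by (intro nn_integral_mono) (auto simp: ennreal_mult[symmetric] intro!: ennreal_leI mult_right_mono)
      also have "\<dots> = ennreal M * (\<integral>\<^sup>+w. ennreal (schur_kernel z w) \<partial>disc_measure)"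
        by (intro nn_integral_cmult measurable_compose[OF schur_kernel_measurable_section measurable_ennreal])
      also have "\<dots> \<le> ennreal M * ennreal C" by (intro mult_left_mono C z) simp
      also have "\<dots> = ennreal (C * M)" using M0 C(1) by (simp add: ennreal_mult mult.commute)
      finally show ?thesis using M0 C(1) by (subst (asm) ennreal_le_iff) auto
    qed
    have "bdd_above ((\<lambda>z. norm (bergman_projection v f z) * sqrt (v z)) ` unit_disc)"
      using PM by (intro bdd_aboveI2)
    moreover have "Linf_norm (\<lambda>z. sqrt (v z)) (bergman_projection v f) \<le> C * M"
      unfolding Linf_norm_def using PM by (intro cSUP_least) auto
    ultimately show ?thesis
      using P(1,2) holomorphic_measurable_disc[OF P(2)] by (auto simp: Ainf_space_def Linf_space_def M_def)
  qed
  then show ?thesis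
    unfolding bergman_projection_bounded_def half using C(1) less_imp_le by blast
qed

end

theorem theorem1:
  fixes \<alpha> :: real and v :: "complex \<Rightarrow> real"
  assumes "\<alpha> > 0"
  defines "v \<equiv> exp_weight \<alpha>"
  shows "(\<forall>p::real. 1 \<le> p \<longrightarrow>
            bergman_projection_bounded v
              (Lp_space p (\<lambda>z. v z powr (p / 2)))
              (Ap_space p (\<lambda>z. v z powr (p / 2)))
              (Lp_norm p (\<lambda>z. v z powr (p / 2))))
       \<and> bergman_projection_bounded v
            (Linf_space (\<lambda>z. v z powr (1 / 2)))
            (Ainf_space (\<lambda>z. v z powr (1 / 2)))
            (Linf_norm (\<lambda>z. v z powr (1 / 2)))"
proof -
  interpret disc_weight \<alpha> by standard (rule assms)
  show ?thesis
    unfolding v_def using bergman_projection_bounded_Lp bergman_projection_bounded_Linf by blast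
qed

end
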